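(* Let $p,p'\ge2$ be coprime integers, $k+2=\frac{p'}p$, let $r,s\in\mathbb Z$ with $0<r<p$, $0<s<p'$, and let $\lambda\in\mathbb C$. Let $\mathcal E_{r,s}^\lambda=L^{Vir}(d_{p,p'},h_{p,p'}^{r,s})\otimes\Pi_{(-1)}(\lambda)$, viewed as a $V_k(sl(2))$-module. Then: (1) $\mathcal E_{r,s}^\lambda$ is a $\mathbb Z_{\ge0}$-graded $V_k(sl(2))$-module. (2) Its top component is $\mathcal E_{r,s}^\lambda(0)=\mathrm{span}_{\mathbb C}\{E_{r,s}^{\lambda+j}\mid j\in\mathbb Z\}$, and it has conformal weight $\frac k4+h_{p,p'}^{r,s}$. If $\lambda\notin\lambda_{r,s}^{\pm}+\mathbb Z$ (for both signs), then $\mathcal E_{r,s}^\lambda(0)$ is an irreducible $sl(2)$-module. (3) The character of $\mathcal E_{r,s}^\lambda$ is $$\mathrm{ch}[\mathcal E_{r,s}^\lambda](q,z)=z^{-k+2\lambda}\,\chi_{r,s}(q)\,\frac{\delta(z^2)}{\eta(\tau)^2}.$$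
   Context: $d_{p,p'}=1-\frac{6(p-p')^2}{pp'}$, $h_{p,p'}^{r,s}=\frac{(sp-rp')^2-(p-p')^2}{4pp'}$. $L^{Vir}(d_{p,p'},h)$ is the irreducible highest weight Virasoro module of central charge $d_{p,p'}$ and highest weight $h$; $v_{r,s}$ is the highest weight vector of $L^{Vir}(d_{p,p'},h^{r,s}_{p,p'})$, and $\omega_{p,p'}$ is the conformal vector of the simple Virasoro vertex algebra $L^{Vir}(d_{p,p'},0)$. Let $\langle c,c\rangle=\langle d,d\rangle=0$, $\langle c,d\rangle=2$; $M(1)$ is the Heisenberg vertex algebra generated by $c(z),d(z)$ with $[a(m),b(n)]=m\langle a,b\rangle\delta_{m+n,0}$; $\Pi(0)=M(1)\otimes\mathbb C[\mathbb Zc]$ is the lattice-type vertex algebra. Put $\mu=\frac d2+\frac k4c$, $\nu=\frac d2-\frac k4c$. For $r\in\mathbb Z$, $\lambda\in\mathbb C$, $\Pi_{(r)}(\lambda)=\Pi(0)e^{r\mu+\lambda c}=\bigoplus_{j\in\mathbb Z}M(1)\otimes e^{r\mu+(\lambda+j)c}$ with the usual lattice vertex operators. The simple affine vertex algebra $V_k(sl(2))$ acts on $L^{Vir}(d_{p,p'},0)\otimes\Pi(0)$-modules through the homomorphism $V_k(sl(2))\to L^{Vir}(d_{p,p'},0)\otimes\Pi(0)$ given by $e\mapsto e^c$, $h\mapsto2\mu(-1)\mathbf 1$, $f\mapsto[(k+2)\omega_{p,p'}-\nu(-1)^2-(k+1)\nu(-2)]e^{-c}$. $E_{r,s}^\lambda=v_{r,s}\otimes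 e^{-\mu+\lambda c}$, $\lambda_{r,s}^{\pm}=\frac{p'-p}{2p}\pm\frac{sp-rp'}{2p}$. Grading and conformal weight are with respect to the Sugawara operator $L_{sug}(0)$ (the top component is the lowest $L_{sug}(0)$-eigenspace). $\mathrm{ch}[M](q,z)=\mathrm{Tr}_M\,q^{L_{sug}(0)-c_{sug}/24}z^{h(0)}$ as a formal series, $c_{sug}=\frac{3k}{k+2}$; $\chi_{r,s}(q)=\mathrm{Tr}\,q^{L(0)-d_{p,p'}/24}$ is the character of $L^{Vir}(d_{p,p'},h_{p,p'}^{r,s})$; $\delta(z^2)=\sum_{\ell\in\mathbb Z}z^{2\ell}$; $\eta(\tau)=q^{1/24}\prod_{n\ge1}(1-q^n)$, $q=e^{2\pi i\tau}$. *)

theory Defs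
  imports "HOL-Analysis.Analysis" "HOL-Library.Poly_Mapping" "HOL-Library.Multiset"
    "HOL-Computational_Algebra.Formal_Power_Series"
begin

section \<open>Complex vector spaces\<close>

class complex_vector = ab_group_add +
  fixes scaleC :: "complex \<Rightarrow> 'a \<Rightarrow> 'a"  (infixr \<open>*\<^sub>C\<close> 75)
  assumes scaleC_add_right: "a *\<^sub>C (x + y) = a *\<^sub>C x + a *\<^sub>C y"
    and scaleC_add_left: "(a + b) *\<^sub>C x = a *\<^sub>C x + b *\<^sub>C x"
    and scaleC_scaleC: "a *\<^sub>C (b *\<^sub>C x) = (a * b) *\<^sub>C x"
    and scaleC_one: "1 *\<^sub>C x = x"

global_interpretation cvec: vector_space "scaleC :: complex \<Rightarrow> 'a \<Rightarrow> 'a::complex_vector"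
  by unfold_locales (simp_all add: scaleC_add_right scaleC_add_left scaleC_scaleC scaleC_one)

abbreviation clinear :: "('a::complex_vector \<Rightarrow> 'b::complex_vector) \<Rightarrow> bool" where
  "clinear \<equiv> Vector_Spaces.linear scaleC scaleC"

instantiation complex :: complex_vector
begin
definition scaleC_complex :: "complex \<Rightarrow> complex \<Rightarrow> complex" where
  "scaleC_complex a x = a * x"
instance
  by standard (simp_all add: scaleC_complex_def algebra_simps)
end

instantiation poly_mapping :: (type, complex_vector) complex_vector
begin
definition scaleC_poly_mapping :: "complex \<Rightarrow> ('a \<Rightarrow>\<^sub>0 'b) \<Rightarrow> ('a \<Rightarrow>\<^sub>0 'b)" where
  "scaleC_poly_mapping a p = Poly_Mapping.map (scaleC a) p"
lemma lookup_scaleC: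
  fixes p :: "'a \<Rightarrow>\<^sub>0 'b"
  shows "Poly_Mapping.lookup (a *\<^sub>C p) x = a *\<^sub>C Poly_Mapping.lookup p x"
  by (simp add: scaleC_poly_mapping_def Poly_Mapping.map.rep_eq when_def cvec.scale_zero_right)
instance
  by standard
    (auto intro!: poly_mapping_eqI simp: lookup_scaleC Poly_Mapping.lookup_add scaleC_add_right
      scaleC_add_left scaleC_scaleC scaleC_one)
end

definition eigenspace :: "('a::complex_vector \<Rightarrow> 'a) \<Rightarrow> complex \<Rightarrow> 'a set" where
  "eigenspace T x = {w. T w = x *\<^sub>C w}"

definition finite_dimensional :: "'a::complex_vector set \<Rightarrow> bool" where
  "finite_dimensional S \<longleftrightarrow> (\<exists>B. finite B \<and> cvec.span B = S)"

definition direct_sum_decomposition :: "(nat \<Rightarrow> 'a::complex_vector set) \<Rightarrow> bool" where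
  "direct_sum_decomposition G \<longleftrightarrow>
     (\<forall>n. cvec.subspace (G n)) \<and>
     (\<forall>w. \<exists>!x :: nat \<Rightarrow>\<^sub>0 'a. (\<forall>n. Poly_Mapping.lookup x n \<in> G n) \<and>
        w = (\<Sum>n\<in>Poly_Mapping.keys x. Poly_Mapping.lookup x n))"

section \<open>Vertex algebras and their modules\<close>

text \<open>A state-field map is given by its modes: \<open>Y a n b\<close> is \<open>a\<^sub>(\<^sub>n\<^sub>) b\<close>, where
  \<open>Y(a,z) = \<Sum>n. a\<^sub>(\<^sub>n\<^sub>) z^(-n-1)\<close>.  The last axiom is the Borcherds identity, the component form of
  the Jacobi identity; by truncation all its sums have finite support.\<close>

locale vertex_algebra =
  fixes vac :: "'a::complex_vector" and Y :: "'a \<Rightarrow> int \<Rightarrow> 'a \<Rightarrow> 'a"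
  assumes linear_left: "clinear (\<lambda>a. Y a n b)"
    and linear_right: "clinear (Y a n)"
    and truncation: "\<exists>N. \<forall>n\<ge>N. Y a n b = 0"
    and vacuum_left: "Y vac n b = (if n = -1 then b else 0)"
    and creation: "Y a (-1) vac = a"
    and creation_nonneg: "n \<ge> 0 \<Longrightarrow> Y a n vac = 0"
    and borcherds:
      "(\<Sum>i::nat. (of_int m gchoose i) *\<^sub>C Y (Y a (l + int i) b) (m + n - int i) c) =
       (\<Sum>i::nat. ((-1) ^ i * (of_int l gchoose i)) *\<^sub>C
          (Y a (l + m - int i) (Y b (n + int i) c)
           - ((-1) powi l) *\<^sub>C Y b (l + n - int i) (Y a (m + int i) c)))"

locale va_module = vertex_algebra vac Y
  for vac :: "'a::complex_vector" and Y :: "'a \<Rightarrow> int \<Rightarrow> 'a \<Rightarrow> 'a" +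
  fixes YM :: "'a \<Rightarrow> int \<Rightarrow> 'm::complex_vector \<Rightarrow> 'm"
  assumes mod_linear_left: "clinear (\<lambda>a. YM a n w)"
    and mod_linear_right: "clinear (YM a n)"
    and mod_truncation: "\<exists>N. \<forall>n\<ge>N. YM a n w = 0"
    and mod_vacuum: "YM vac n w = (if n = -1 then w else 0)"
    and mod_borcherds:
      "(\<Sum>i::nat. (of_int m gchoose i) *\<^sub>C YM (Y a (l + int i) b) (m + n - int i) w) =
       (\<Sum>i::nat. ((-1) ^ i * (of_int l gchoose i)) *\<^sub>C
          (YM a (l + m - int i) (YM b (n + int i) w)
           - ((-1) powi l) *\<^sub>C YM b (l + n - int i) (YM a (m + int i) w)))"

definition va_hom ::
  "'a::complex_vector \<Rightarrow> ('a \<Rightarrow> int \<Rightarrow> 'a \<Rightarrow> 'a) \<Rightarrow>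
   'b::complex_vector \<Rightarrow> ('b \<Rightarrow> int \<Rightarrow> 'b \<Rightarrow> 'b) \<Rightarrow> ('a \<Rightarrow> 'b) \<Rightarrow> bool" where
  "va_hom vac Y vac' Y' Phi \<longleftrightarrow>
     clinear Phi \<and> Phi vac = vac' \<and> (\<forall>a n b. Phi (Y a n b) = Y' (Phi a) n (Phi b))"

definition va_ideal :: "('a::complex_vector \<Rightarrow> int \<Rightarrow> 'a \<Rightarrow> 'a) \<Rightarrow> 'a set \<Rightarrow> bool" where
  "va_ideal Y I \<longleftrightarrow>
     cvec.subspace I \<and> (\<forall>a n. \<forall>b\<in>I. Y a n b \<in> I \<and> Y b n a \<in> I)"

definition simple_va :: "('a::complex_vector \<Rightarrow> int \<Rightarrow> 'a \<Rightarrow> 'a) \<Rightarrow> bool" where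
  "simple_va Y \<longleftrightarrow>
     (UNIV :: 'a set) \<noteq> {0} \<and> (\<forall>I. va_ideal Y I \<longrightarrow> I = {0} \<or> I = UNIV)"

section \<open>Virasoro modules\<close>

definition virasoro_rep :: "complex \<Rightarrow> (int \<Rightarrow> 'a::complex_vector \<Rightarrow> 'a) \<Rightarrow> bool" where
  "virasoro_rep c L \<longleftrightarrow>
     (\<forall>n. clinear (L n)) \<and>
     (\<forall>m n w. L m (L n w) - L n (L m w) =
        of_int (m - n) *\<^sub>C L (m + n) w
        + (if m + n = 0 then of_int (m ^ 3 - m) / 12 * c else 0) *\<^sub>C w)"

text \<open>The operators \<open>L\<close> make the whole type into \<open>L\<^sup>V\<^sup>i\<^sup>r(c,h)\<close>, with highest weight vector \<open>v\<close>
  (which generates, by irreducibility).\<close>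

definition irreducible_virasoro_hw ::
  "complex \<Rightarrow> complex \<Rightarrow> (int \<Rightarrow> 'a::complex_vector \<Rightarrow> 'a) \<Rightarrow> 'a \<Rightarrow> bool" where
  "irreducible_virasoro_hw c h L v \<longleftrightarrow>
     virasoro_rep c L \<and>
     v \<noteq> 0 \<and> L 0 v = h *\<^sub>C v \<and> (\<forall>n>0. L n v = 0) \<and>
     (\<forall>S. cvec.subspace S \<and> (\<forall>n. \<forall>w\<in>S. L n w \<in> S) \<longrightarrow> S = {0} \<or> S = UNIV)"

definition simple_virasoro_va ::
  "complex \<Rightarrow> 'a::complex_vector \<Rightarrow> ('a \<Rightarrow> int \<Rightarrow> 'a \<Rightarrow> 'a) \<Rightarrow> 'a \<Rightarrow> bool" where
  "simple_virasoro_va c vac Y om \<longleftrightarrow>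
     vertex_algebra vac Y \<and> irreducible_virasoro_hw c 0 (\<lambda>n. Y om (n + 1)) vac"

definition irreducible_virasoro_va_module ::
  "complex \<Rightarrow> complex \<Rightarrow> 'a::complex_vector \<Rightarrow> ('a \<Rightarrow> int \<Rightarrow> 'a \<Rightarrow> 'a) \<Rightarrow> 'a \<Rightarrow>
   ('a \<Rightarrow> int \<Rightarrow> 'm::complex_vector \<Rightarrow> 'm) \<Rightarrow> 'm \<Rightarrow> bool" where
  "irreducible_virasoro_va_module c h vac Y om YM v \<longleftrightarrow>
     va_module vac Y YM \<and> irreducible_virasoro_hw c h (\<lambda>n. YM om (n + 1)) v"

definition d_vir :: "nat \<Rightarrow> nat \<Rightarrow> complex" where
  "d_vir p p' = 1 - 6 * (of_nat p - of_nat p')\<^sup>2 / (of_nat p * of_nat p')"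

definition h_vir :: "nat \<Rightarrow> nat \<Rightarrow> int \<Rightarrow> int \<Rightarrow> complex" where
  "h_vir p p' r s =
     ((of_int s * of_nat p - of_int r * of_nat p')\<^sup>2 - (of_nat p - of_nat p')\<^sup>2)
       / (4 * of_nat p * of_nat p')"

definition lambda_plus :: "nat \<Rightarrow> nat \<Rightarrow> int \<Rightarrow> int \<Rightarrow> complex" where
  "lambda_plus p p' r s =
     (of_nat p' - of_nat p) / (2 * of_nat p)
       + (of_int s * of_nat p - of_int r * of_nat p') / (2 * of_nat p)"

definition lambda_minus :: "nat \<Rightarrow> nat \<Rightarrow> int \<Rightarrow> int \<Rightarrow> complex" where
  "lambda_minus p p' r s =
     (of_nat p' - of_nat p) / (2 * of_nat p)
       - (of_int s * of_nat p - of_int r * of_nat p') / (2 * of_nat p)"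

section \<open>Affine and finite-dimensional \<open>sl(2)\<close>\<close>

text \<open>The commutation relations of affine \<open>sl(2)\<close> at level \<open>k\<close>, for the invariant form with
  \<open>(e,f) = 1\<close>, \<open>(h,h) = 2\<close>.\<close>

definition affine_sl2_relations ::
  "complex \<Rightarrow> (int \<Rightarrow> 'a::complex_vector \<Rightarrow> 'a) \<Rightarrow> (int \<Rightarrow> 'a \<Rightarrow> 'a) \<Rightarrow> (int \<Rightarrow> 'a \<Rightarrow> 'a) \<Rightarrow> bool" where
  "affine_sl2_relations k e h f \<longleftrightarrow>
     (\<forall>m n w.
        e m (e n w) - e n (e m w) = 0 \<and>
        f m (f n w) - f n (f m w) = 0 \<and>
        h m (e n w) - e n (h m w) = 2 *\<^sub>C e (m + n) w \<and>
        h m (f n w) - f n (h m w) = (-2) *\<^sub>C f (m + n) w \<and>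
        h m (h n w) - h n (h m w) = (if m + n = 0 then 2 * of_int m * k else 0) *\<^sub>C w \<and>
        e m (f n w) - f n (e m w) = h (m + n) w + (if m + n = 0 then of_int m * k else 0) *\<^sub>C w)"

definition simple_affine_sl2_va ::
  "complex \<Rightarrow> 'a::complex_vector \<Rightarrow> ('a \<Rightarrow> int \<Rightarrow> 'a \<Rightarrow> 'a) \<Rightarrow> 'a \<Rightarrow> 'a \<Rightarrow> 'a \<Rightarrow> bool" where
  "simple_affine_sl2_va k vac Y e h f \<longleftrightarrow>
     vertex_algebra vac Y \<and>
     affine_sl2_relations k (Y e) (Y h) (Y f) \<and>
     (\<forall>S. cvec.subspace S \<and> vac \<in> S \<and>
          (\<forall>n. \<forall>w\<in>S. Y e n w \<in> S \<and> Y h n w \<in> S \<and> Y f n w \<in> S) \<longrightarrow> S = UNIV) \<and>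
     simple_va Y"

definition sugawara ::
  "complex \<Rightarrow> ('a::complex_vector \<Rightarrow> int \<Rightarrow> 'a \<Rightarrow> 'a) \<Rightarrow> 'a \<Rightarrow> 'a \<Rightarrow> 'a \<Rightarrow> 'a" where
  "sugawara k Y e h f =
     (1 / (2 * (k + 2))) *\<^sub>C (Y e (-1) f + Y f (-1) e + (1 / 2) *\<^sub>C Y h (-1) h)"

definition sl2_module ::
  "'a::complex_vector set \<Rightarrow> ('a \<Rightarrow> 'a) \<Rightarrow> ('a \<Rightarrow> 'a) \<Rightarrow> ('a \<Rightarrow> 'a) \<Rightarrow> bool" where
  "sl2_module S e h f \<longleftrightarrow>
     cvec.subspace S \<and>
     clinear e \<and> clinear h \<and> clinear f \<and>
     (\<forall>w\<in>S. e w \<in> S \<and> h w \<in> S \<and> f w \<in> S \<and>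
        h (e w) - e (h w) = 2 *\<^sub>C e w \<and>
        h (f w) - f (h w) = (-2) *\<^sub>C f w \<and>
        e (f w) - f (e w) = h w)"

definition irreducible_sl2_module ::
  "'a::complex_vector set \<Rightarrow> ('a \<Rightarrow> 'a) \<Rightarrow> ('a \<Rightarrow> 'a) \<Rightarrow> ('a \<Rightarrow> 'a) \<Rightarrow> bool" where
  "irreducible_sl2_module S e h f \<longleftrightarrow>
     sl2_module S e h f \<and> S \<noteq> {0} \<and>
     (\<forall>U. U \<subseteq> S \<and> sl2_module U e h f \<longrightarrow> U = {0} \<or> U = S)"

section \<open>The Heisenberg and lattice-type vertex algebra\<close>

text \<open>The pair \<open>(x, y)\<close> stands for \<open>x c + y d\<close> in the span of \<open>c\<close> and \<open>d\<close>.\<close>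

type_synonym cartan = "complex \<times> complex"

definition cform :: "cartan \<Rightarrow> cartan \<Rightarrow> complex" where
  "cform a b = 2 * (fst a * snd b + snd a * fst b)"

definition c_vec :: cartan where "c_vec = (1, 0)"
definition d_vec :: cartan where "d_vec = (0, 1)"

definition mu_vec :: "complex \<Rightarrow> cartan" where "mu_vec k = (k / 4, 1 / 2)"
definition nu_vec :: "complex \<Rightarrow> cartan" where "nu_vec k = (- k / 4, 1 / 2)"

text \<open>\<open>M(1)\<close> is the polynomial algebra in \<open>c(-n), d(-n)\<close>, \<open>n \<ge> 1\<close>.  Its monomials are multisets in
  which \<open>(Cgen, i)\<close> and \<open>(Dgen, i)\<close> stand for \<open>c(-(i+1))\<close> and \<open>d(-(i+1))\<close>.  A basis of
  \<open>\<Pi>\<^sub>(\<^sub>r\<^sub>)(\<lambda>)\<close> is indexed by pairs \<open>(j, M)\<close>, standing for \<open>M \<otimes> e^(r\<mu> + (\<lambda>+j)c)\<close>; so all the spaces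
  \<open>\<Pi>\<^sub>(\<^sub>r\<^sub>)(\<lambda>)\<close>, including \<open>\<Pi>(0) = \<Pi>\<^sub>(\<^sub>0\<^sub>)(0)\<close>, have the same underlying vector space, and
  \<open>r\<close>, \<open>\<lambda>\<close> only enter through the operators acting on it.\<close>

datatype hgen = Cgen | Dgen

type_synonym pi_index = "int \<times> (hgen \<times> nat) multiset"
type_synonym pi_space = "pi_index \<Rightarrow>\<^sub>0 complex"

definition pi_linext :: "(pi_index \<Rightarrow> pi_space) \<Rightarrow> pi_space \<Rightarrow> pi_space" where
  "pi_linext g w = (\<Sum>b\<in>Poly_Mapping.keys w. Poly_Mapping.lookup w b *\<^sub>C g b)"

text \<open>\<open>pi_exp j\<close> is \<open>e^(jc)\<close> in \<open>\<Pi>(0)\<close>, and \<open>e^(r\<mu> + (\<lambda>+j)c)\<close> in \<open>\<Pi>\<^sub>(\<^sub>r\<^sub>)(\<lambda>)\<close>.\<close>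

definition pi_exp :: "int \<Rightarrow> pi_space" where
  "pi_exp j = Poly_Mapping.single (j, {#}) 1"

definition pi_weight :: "complex \<Rightarrow> int \<Rightarrow> complex \<Rightarrow> int \<Rightarrow> cartan" where
  "pi_weight k r lam j =
     (of_int r * fst (mu_vec k) + (lam + of_int j), of_int r * snd (mu_vec k))"

text \<open>\<open>heis k r lam \<alpha> n\<close> is \<open>\<alpha>(n)\<close> on \<open>\<Pi>\<^sub>(\<^sub>r\<^sub>)(\<lambda>)\<close>: multiplication by a variable for \<open>n < 0\<close>,
  a derivation for \<open>n > 0\<close>, and \<open>\<alpha>(0) e^\<beta> = \<langle>\<alpha>,\<beta>\<rangle> e^\<beta>\<close>.\<close>

definition heis_basis ::
  "complex \<Rightarrow> int \<Rightarrow> complex \<Rightarrow> cartan \<Rightarrow> int \<Rightarrow> pi_index \<Rightarrow> pi_space" where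
  "heis_basis k r lam \<alpha> n = (\<lambda>(j, M).
     if n < 0 then
       Poly_Mapping.single (j, add_mset (Cgen, nat (- n - 1)) M) (fst \<alpha>)
       + Poly_Mapping.single (j, add_mset (Dgen, nat (- n - 1)) M) (snd \<alpha>)
     else if n = 0 then
       Poly_Mapping.single (j, M) (cform \<alpha> (pi_weight k r lam j))
     else
       Poly_Mapping.single (j, M - {#(Cgen, nat (n - 1))#})
         (of_int n * cform \<alpha> c_vec * of_nat (count M (Cgen, nat (n - 1))))
       + Poly_Mapping.single (j, M - {#(Dgen, nat (n - 1))#})
         (of_int n * cform \<alpha> d_vec * of_nat (count M (Dgen, nat (n - 1)))))"

definition heis ::
  "complex \<Rightarrow> int \<Rightarrow> complex \<Rightarrow> cartan \<Rightarrow> int \<Rightarrow> pi_space \<Rightarrow> pi_space" where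
  "heis k r lam \<alpha> n = pi_linext (heis_basis k r lam \<alpha> n)"

definition pi_shift :: "int \<Rightarrow> pi_space \<Rightarrow> pi_space" where
  "pi_shift m = pi_linext (\<lambda>(j, M). Poly_Mapping.single (j + m, M) 1)"

text \<open>For commuting operators \<open>A 1, A 2, \<dots>\<close>, \<open>exp_coeff A n\<close> is the coefficient of \<open>x^n\<close> in
  \<open>S(x) = exp (\<Sum>i\<ge>1. A i x^i / i)\<close>; the recursion is \<open>S' = (\<Sum>i\<ge>1. A i x^(i-1)) S\<close>.\<close>

fun exp_coeff ::
  "(nat \<Rightarrow> 'a::complex_vector \<Rightarrow> 'a) \<Rightarrow> nat \<Rightarrow> 'a \<Rightarrow> 'a" where
  "exp_coeff A 0 w = w"
| "exp_coeff A (Suc n) w =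
     (1 / of_nat (Suc n)) *\<^sub>C (\<Sum>i\<le>n. A (Suc i) (exp_coeff A (n - i) w))"

text \<open>The modes, on \<open>\<Pi>\<^sub>(\<^sub>r\<^sub>)(\<lambda>)\<close>, of the usual lattice vertex operator
  \<open>Y(e^(mc), z) = exp (\<Sum>n\<ge>1. m c(-n) z^n / n) exp (- \<Sum>n\<ge>1. m c(n) z^(-n) / n) e^(mc) z^(m c(0))\<close>.
  No cocycle is needed since \<open>\<langle>c,c\<rangle> = 0\<close>, and \<open>m c(0)\<close> is the integer \<open>\<langle>mc, r\<mu> + (\<lambda>+j)c\<rangle> = m r\<close>.
  The coefficient of \<open>z^(-n-1)\<close> collects the terms \<open>z^i z^(-j) z^(m r)\<close> with \<open>i - j + m r = -n-1\<close>.\<close>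

definition lattice_mode ::
  "complex \<Rightarrow> int \<Rightarrow> complex \<Rightarrow> int \<Rightarrow> int \<Rightarrow> pi_space \<Rightarrow> pi_space" where
  "lattice_mode k r lam m n w =
     (\<Sum>j::nat.
        if int j - m * r - n - 1 < 0 then 0
        else exp_coeff (\<lambda>i u. of_int m *\<^sub>C heis k r lam c_vec (- int i) u)
               (nat (int j - m * r - n - 1))
               (exp_coeff (\<lambda>i u. (- of_int m) *\<^sub>C heis k r lam c_vec (int i) u) j
                 (pi_shift m w)))"

text \<open>\<open>\<Pi>(0)\<close> is generated by \<open>c, d, e^c, e^(-c)\<close>, so the vertex algebra structure is the only one
  in which these vectors have the prescribed fields; similarly for \<open>\<Pi>\<^sub>(\<^sub>r\<^sub>)(\<lambda>)\<close>.  The vector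
  \<open>\<alpha>(-1)1\<close> is \<open>heis k 0 0 \<alpha> (-1) (pi_exp 0)\<close>.\<close>

definition lattice_va :: "complex \<Rightarrow> (pi_space \<Rightarrow> int \<Rightarrow> pi_space \<Rightarrow> pi_space) \<Rightarrow> bool" where
  "lattice_va k Y \<longleftrightarrow>
     vertex_algebra (pi_exp 0) Y \<and>
     (\<forall>\<alpha> n. Y (heis k 0 0 \<alpha> (-1) (pi_exp 0)) n = heis k 0 0 \<alpha> n) \<and>
     (\<forall>m n. Y (pi_exp m) n = lattice_mode k 0 0 m n)"

definition lattice_va_module ::
  "complex \<Rightarrow> int \<Rightarrow> complex \<Rightarrow> (pi_space \<Rightarrow> int \<Rightarrow> pi_space \<Rightarrow> pi_space) \<Rightarrow>
   (pi_space \<Rightarrow> int \<Rightarrow> pi_space \<Rightarrow> pi_space) \<Rightarrow> bool" where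
  "lattice_va_module k r lam Y YW \<longleftrightarrow>
     va_module (pi_exp 0) Y YW \<and>
     (\<forall>\<alpha> n. YW (heis k 0 0 \<alpha> (-1) (pi_exp 0)) n = heis k r lam \<alpha> n) \<and>
     (\<forall>m n. YW (pi_exp m) n = lattice_mode k r lam m n)"

section \<open>Tensor products with lattice modules\<close>

text \<open>\<open>U \<otimes> \<Pi>\<close>, for \<open>\<Pi>\<close> with basis indexed by \<open>pi_index\<close>, is the space of finitely supported
  families in \<open>U\<close> indexed by \<open>pi_index\<close>.\<close>

type_synonym 'a tensor_pi = "pi_index \<Rightarrow>\<^sub>0 'a"

definition tensor :: "'a::complex_vector \<Rightarrow> pi_space \<Rightarrow> 'a tensor_pi" where
  "tensor u w = Poly_Mapping.map (\<lambda>x. x *\<^sub>C u) w"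

text \<open>\<open>(a \<otimes> b)\<^sub>(\<^sub>n\<^sub>) = \<Sum>i. a\<^sub>(\<^sub>i\<^sub>) \<otimes> b\<^sub>(\<^sub>n\<^sub>-\<^sub>1\<^sub>-\<^sub>i\<^sub>)\<close>, the modes of \<open>Y(a,z) \<otimes> Y(b,z)\<close>, extended bilinearly.\<close>

definition tensor_Y ::
  "('a::complex_vector \<Rightarrow> int \<Rightarrow> 'm::complex_vector \<Rightarrow> 'm) \<Rightarrow>
   (pi_space \<Rightarrow> int \<Rightarrow> pi_space \<Rightarrow> pi_space) \<Rightarrow>
   'a tensor_pi \<Rightarrow> int \<Rightarrow> 'm tensor_pi \<Rightarrow> 'm tensor_pi" where
  "tensor_Y YA YB u n w =
     (\<Sum>b\<in>Poly_Mapping.keys u. \<Sum>b'\<in>Poly_Mapping.keys w. \<Sum>i::int.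
        tensor (YA (Poly_Mapping.lookup u b) i (Poly_Mapping.lookup w b'))
          (YB (Poly_Mapping.single b 1) (n - 1 - i) (Poly_Mapping.single b' 1)))"

definition phi_e :: "'a::complex_vector \<Rightarrow> 'a tensor_pi" where
  "phi_e vacL = tensor vacL (pi_exp 1)"

definition phi_h :: "complex \<Rightarrow> 'a::complex_vector \<Rightarrow> 'a tensor_pi" where
  "phi_h k vacL = 2 *\<^sub>C tensor vacL (heis k 0 0 (mu_vec k) (-1) (pi_exp 0))"

definition phi_f :: "complex \<Rightarrow> 'a::complex_vector \<Rightarrow> 'a \<Rightarrow> 'a tensor_pi" where
  "phi_f k vacL om =
     (k + 2) *\<^sub>C tensor om (pi_exp (-1))
     - tensor vacL (heis k 0 0 (nu_vec k) (-1) (heis k 0 0 (nu_vec k) (-1) (pi_exp (-1))))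
     - (k + 1) *\<^sub>C tensor vacL (heis k 0 0 (nu_vec k) (-2) (pi_exp (-1)))"

section \<open>Gradings and characters\<close>

definition top_weight :: "('m::complex_vector \<Rightarrow> 'm) \<Rightarrow> complex" where
  "top_weight L0 = (THE \<Delta>. eigenspace L0 \<Delta> \<noteq> {0} \<and>
     (\<forall>x. eigenspace L0 x \<noteq> {0} \<longrightarrow> (\<exists>n::nat. x = \<Delta> + of_nat n)))"

definition top_component :: "('m::complex_vector \<Rightarrow> 'm) \<Rightarrow> 'm set" where
  "top_component L0 = eigenspace L0 (top_weight L0)"

text \<open>\<open>G\<close> is a grading of the module by nonnegative integers, with \<open>G n = 0\<close> for \<open>n < 0\<close> and
  \<open>a\<^sub>(\<^sub>m\<^sub>) G n \<subseteq> G (n + N - m - 1)\<close> for \<open>a\<close> of conformal weight \<open>N\<close>; \<open>om\<close> is the conformal vector.\<close>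

definition nonneg_graded_module ::
  "'a::complex_vector \<Rightarrow> ('a \<Rightarrow> int \<Rightarrow> 'a \<Rightarrow> 'a) \<Rightarrow> 'a \<Rightarrow>
   ('a \<Rightarrow> int \<Rightarrow> 'm::complex_vector \<Rightarrow> 'm) \<Rightarrow> (nat \<Rightarrow> 'm set) \<Rightarrow> bool" where
  "nonneg_graded_module vac Y om YM G \<longleftrightarrow>
     va_module vac Y YM \<and>
     direct_sum_decomposition G \<and>
     (\<forall>N a m n w. a \<in> eigenspace (Y om 1) (of_int N) \<and> w \<in> G n \<longrightarrow>
        YM a m w \<in> (if int n + N - m - 1 \<ge> 0 then G (nat (int n + N - m - 1)) else {0}))"

text \<open>Formal series \<open>\<Sum> F(a,b) q^a z^b\<close> with complex exponents; the product is used only for factors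
  whose convolution sums are finite.\<close>

type_synonym qz_series = "complex \<times> complex \<Rightarrow> complex"

definition qz_mult :: "qz_series \<Rightarrow> qz_series \<Rightarrow> qz_series"  (infixl \<open>\<star>\<close> 70) where
  "(F \<star> G) y = (\<Sum>x. F x * G (y - x))"

definition q_series :: "(complex \<Rightarrow> complex) \<Rightarrow> qz_series" where
  "q_series F = (\<lambda>(a, b). if b = 0 then F a else 0)"

definition z_power :: "complex \<Rightarrow> qz_series" where
  "z_power x = (\<lambda>(a, b). if a = 0 \<and> b = x then 1 else 0)"

definition delta_z2 :: qz_series where
  "delta_z2 = (\<lambda>(a, b). if a = 0 \<and> (\<exists>l::int. b = 2 * of_int l) then 1 else 0)"

text \<open>The series \<open>q^x F(q)\<close> for a power series \<open>F\<close>.\<close>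

definition q_shift :: "complex \<Rightarrow> complex fps \<Rightarrow> complex \<Rightarrow> complex" where
  "q_shift x F a = (if \<exists>n::nat. a = x + of_nat n
                    then fps_nth F (THE n. a = x + of_nat n) else 0)"

definition euler_product :: "complex fps" where
  "euler_product = prodinf (\<lambda>n. 1 - fps_X ^ Suc n)"

definition eta :: qz_series where
  "eta = q_series (q_shift (1 / 24) euler_product)"

definition inverse_eta_squared :: qz_series where
  "inverse_eta_squared = q_series (q_shift (- 1 / 12) (inverse (euler_product\<^sup>2)))"

lemma q_shift_eq: "q_shift x F (x + of_nat n) = fps_nth F n"
  by (auto simp: q_shift_def intro!: arg_cong[of _ _ "fps_nth F"])

lemma q_series_mult:
  "q_series (q_shift x F) \<star> q_series (q_shift y G) = q_series (q_shift (x + y) (F * G))"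
proof
  fix u :: "complex \<times> complex"
  obtain a b where u: "u = (a, b)" by (cases u)
  let ?f = "\<lambda>w. q_series (q_shift x F) w * q_series (q_shift y G) (u - w)"
  have supp: "\<exists>i j. w = (x + of_nat i, 0) \<and> b = 0 \<and> a = x + y + of_nat (i + j)"
    if "?f w \<noteq> 0" for w
  proof -
    obtain a' b' where w: "w = (a', b')" by (cases w)
    from that have "b' = 0" "b = 0" "q_shift x F a' \<noteq> 0" "q_shift y G (a - a') \<noteq> 0"
      by (auto simp: u w q_series_def split: if_splits)
    moreover from this obtain i j where "a' = x + of_nat i" "a - a' = y + of_nat j"
      by (auto simp: q_shift_def split: if_splits)
    ultimately show ?thesis
      by (intro exI[of _ i] exI[of _ j]) (auto simp: w algebra_simps)
  qed
  show "(q_series (q_shift x F) \<star> q_series (q_shift y G)) u = q_series (q_shift (x + y) (F * G)) u"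
  proof (cases "b = 0 \<and> (\<exists>n::nat. a = x + y + of_nat n)")
    case False
    then have "?f w = 0" for w using supp by blast
    moreover have "q_series (q_shift (x + y) (F * G)) u = 0"
      using False by (auto simp: u q_series_def q_shift_def)
    moreover from calculation(1) have "(\<Sum>w. ?f w) = 0"
      by (simp only: Sum_any.neutral)
    ultimately show ?thesis by (simp only: qz_mult_def)
  next
    case True
    then obtain n :: nat where b: "b = 0" and a: "a = x + y + of_nat n" by blast
    let ?A = "(\<lambda>i. (x + of_nat i, 0::complex)) ` {..n}"
    have sub: "{w. ?f w \<noteq> 0} \<subseteq> ?A"
    proof
      fix w assume "w \<in> {w. ?f w \<noteq> 0}"
      then obtain i j where w: "w = (x + of_nat i, 0)" and "a = x + y + of_nat (i + j)"
        using supp by blast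
      then have "n = i + j" using a by (metis add_left_imp_eq of_nat_eq_iff)
      then show "w \<in> ?A" using w by auto
    qed
    have inj: "inj_on (\<lambda>i. (x + of_nat i, 0::complex)) {..n}" by (auto simp: inj_on_def)
    have "(\<Sum>w. ?f w) = (\<Sum>w\<in>?A. ?f w)"
      by (rule Sum_any.expand_superset[OF _ sub]) auto
    also have "\<dots> = (\<Sum>i\<le>n. ?f (x + of_nat i, 0))"
      by (simp add: sum.reindex[OF inj] o_def)
    also have "\<dots> = (\<Sum>i\<le>n. fps_nth F i * fps_nth G (n - i))"
    proof (rule sum.cong[OF refl])
      fix i assume "i \<in> {..n}"
      then have "a - (x + of_nat i) = y + of_nat (n - i)"
        by (simp add: a of_nat_diff)
      then show "?f (x + of_nat i, 0) = fps_nth F i * fps_nth G (n - i)"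
        by (simp add: u b q_series_def q_shift_eq)
    qed
    also have "\<dots> = q_series (q_shift (x + y) (F * G)) u"
      by (simp add: u a b q_series_def q_shift_eq fps_mult_nth atLeast0AtMost)
    finally show ?thesis by (simp add: qz_mult_def)
  qed
qed

lemma euler_product_has_prod: "(\<lambda>n. 1 - fps_X ^ Suc n :: complex fps) has_prod euler_product"
  and euler_product_nth_0: "fps_nth euler_product 0 = 1"
proof -
  let ?f = "\<lambda>n. 1 - fps_X ^ Suc n :: complex fps"
  let ?P = "\<lambda>n. \<Prod>i\<le>n. ?f i"
  define L where "L = Abs_fps (\<lambda>m. fps_nth (?P m) m)"
  have stable: "fps_nth (?P (m + j)) m = fps_nth (?P m) m" for m j
  proof (induction j)
    case (Suc j)
    have "?P (m + Suc j) = ?P (m + j) - ?P (m + j) * fps_X ^ Suc (m + Suc j)"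
      by (simp add: algebra_simps)
    moreover have "fps_nth (?P (m + j) * fps_X ^ Suc (m + Suc j)) m = 0"
      by (simp only: fps_X_power_mult_right_nth) simp
    ultimately show ?case using Suc by simp
  qed simp
  have lim: "?P \<longlonglongrightarrow> L"
  proof (rule tendsto_fpsI)
    fix m
    show "\<forall>\<^sub>F n in sequentially. fps_nth (?P n) m = fps_nth L m"
      using eventually_ge_at_top[of m]
    proof eventually_elim
      case (elim n)
      then show ?case using stable[of m "n - m"] by (simp add: L_def)
    qed
  qed
  have L0: "fps_nth L 0 = 1" by (simp add: L_def)
  then have "L \<noteq> 0" by auto
  with lim have "?f has_prod L" by (simp add: has_prod_def raw_has_prod_def)
  moreover from this have "euler_product = L"
    unfolding euler_product_def by (rule has_prod_unique[symmetric])
  ultimately show "?f has_prod euler_product" "fps_nth euler_product 0 = 1"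
    using L0 by auto
qed

lemma eta_eta_inverse: "eta \<star> eta \<star> inverse_eta_squared = z_power 0"
proof -
  have "euler_product * euler_product * inverse (euler_product\<^sup>2) = 1"
    using inverse_mult_eq_1'[of "euler_product\<^sup>2"]
    by (simp add: euler_product_nth_0 power2_eq_square)
  then have "eta \<star> eta \<star> inverse_eta_squared = q_series (q_shift 0 1)"
    by (simp add: eta_def inverse_eta_squared_def q_series_mult)
  also have "\<dots> = z_power 0"
    by (auto simp: fun_eq_iff q_series_def z_power_def q_shift_def)
  finally show ?thesis .
qed

text \<open>Characters are defined for operators whose (joint) eigenspaces are finite-dimensional and span;
  the trace of \<open>q^(L0 - c/24) z^(h0)\<close> is then the generating series of their dimensions.\<close>

definition joint_eigenspace ::
  "('m::complex_vector \<Rightarrow> 'm) \<Rightarrow> ('m \<Rightarrow> 'm) \<Rightarrow> complex \<Rightarrow> complex \<Rightarrow> 'm set" where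
  "joint_eigenspace L0 h0 x y = eigenspace L0 x \<inter> eigenspace h0 y"

definition has_character :: "('m::complex_vector \<Rightarrow> 'm) \<Rightarrow> ('m \<Rightarrow> 'm) \<Rightarrow> bool" where
  "has_character L0 h0 \<longleftrightarrow>
     (\<forall>x y. finite_dimensional (joint_eigenspace L0 h0 x y)) \<and>
     cvec.span (\<Union>x. \<Union>y. joint_eigenspace L0 h0 x y) = UNIV"

definition character ::
  "complex \<Rightarrow> ('m::complex_vector \<Rightarrow> 'm) \<Rightarrow> ('m \<Rightarrow> 'm) \<Rightarrow> qz_series" where
  "character c L0 h0 = (\<lambda>(a, b). of_nat (cvec.dim (joint_eigenspace L0 h0 (a + c / 24) b)))"

definition q_character :: "complex \<Rightarrow> ('m::complex_vector \<Rightarrow> 'm) \<Rightarrow> qz_series" where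
  "q_character c L0 = q_series (\<lambda>a. of_nat (cvec.dim (eigenspace L0 (a + c / 24))))"

end

theory Submission
  imports Defs
begin

text \<open>The Borcherds identity of a tensor product of modules follows from locality and associativity.
  Both sides satisfy the recursion coming from \<open>z - w\<close>, so the identity for all \<open>(l, m, n)\<close> follows from
  the cases where \<open>l\<close> or \<open>m\<close> is large.  On pure tensors the composites of modes are convolutions of those
  of the factors; multiplication by \<open>(z - w)^l\<close> and by \<open>(x + y)^m\<close> distributes over the factors,
  and so does the substitution \<open>z = x + y\<close>.

  The Sugawara vector is mapped to \<open>\<omega> \<otimes> 1 + 1 \<otimes> \<omega>\<^sub>\<Pi>\<close>, so \<open>L\<^sub>s\<^sub>u\<^sub>g(0)\<close> acts on \<open>x \<otimes> M e^\<beta>\<close> as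
  \<open>L(0) + k/4 + deg M\<close>, and \<open>h(0)\<close> as \<open>-k + 2\<lambda> + 2j\<close>.  This gives the top component, and the character by
  counting the monomials \<open>M\<close>.  The grading property follows since the zero mode of the Sugawara
  vector is the translation operator on \<open>V\<^sub>k(sl(2))\<close>.  On the top component \<open>e\<close> shifts the basis,
  \<open>h\<close> is diagonal with simple spectrum, and the Casimir element yields \<open>f\<close>, which has a vanishing
  matrix entry exactly when \<open>\<lambda> \<in> \<lambda>\<^sup>\<plusminus> + \<int>\<close>.\<close>

text \<open>The right-hand side of the Borcherds identity is a difference, so convolving the
  identities of two factors produces mixed terms. They are absent once one of the three sums
  vanishes, and this happens exactly in the two ranges: the iterates vanish for large l, the
  opposite products for large m. The homomorphism carries the identity to V_k(sl(2)), whose algebra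
  axioms are hypotheses; on the tensor product only the modes enter. The image of f contains the
  Virasoro field and a square of Heisenberg modes, so its action is never computed on the module:
  only e_(-1)f is computed, in the vertex algebra, and f_(-1)e follows by commutation. With r = -1
  the operator c(0) acts as -1, so the dependence of c(0)d(0)/2 on j cancels that of nu(0), and
  L_sug(0) does not see j. Its nonzero eigenspaces are infinite-dimensional for this reason; h(0)
  separates the values of j, and the character is computed on joint eigenspaces.\<close>

abbreviation "lookup \<equiv> Poly_Mapping.lookup"
abbreviation "single \<equiv> Poly_Mapping.single"
abbreviation "keys \<equiv> Poly_Mapping.keys"

section \<open>Linear maps and finitely supported sums\<close>

lemma clinear_iff:
  "clinear g \<longleftrightarrow> (\<forall>x y. g (x + y) = g x + g y) \<and> (\<forall>a x. g (a *\<^sub>C x) = a *\<^sub>C g x)"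
  for g :: "'a::complex_vector \<Rightarrow> 'b::complex_vector"
  by (simp add: Vector_Spaces.linear_iff cvec.vector_space_axioms)

lemma clinearI:
  fixes g :: "'a::complex_vector \<Rightarrow> 'b::complex_vector"
  assumes "\<And>x y. g (x + y) = g x + g y" and "\<And>a x. g (a *\<^sub>C x) = a *\<^sub>C g x"
  shows "clinear g"
  using assms by (simp add: clinear_iff)

lemma clinear_add: "clinear g \<Longrightarrow> g (x + y) = g x + g y"
  and clinear_scale: "clinear g \<Longrightarrow> g (a *\<^sub>C x) = a *\<^sub>C g x"
  by (simp_all add: clinear_iff)

lemma clinear_0:
  fixes g :: "'a::complex_vector \<Rightarrow> 'b::complex_vector"
  shows "clinear g \<Longrightarrow> g 0 = 0"
  using clinear_scale[of g 0 0] by simp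

lemma clinear_minus:
  fixes g :: "'a::complex_vector \<Rightarrow> 'b::complex_vector"
  shows "clinear g \<Longrightarrow> g (- x) = - g x"
  using clinear_scale[of g "-1" x] by simp

lemma clinear_diff:
  fixes g :: "'a::complex_vector \<Rightarrow> 'b::complex_vector"
  shows "clinear g \<Longrightarrow> g (x - y) = g x - g y"
  using clinear_add[of g x "- y"] by (simp add: clinear_minus)

lemma clinear_sum:
  fixes g :: "'a::complex_vector \<Rightarrow> 'b::complex_vector"
  assumes "clinear g"
  shows "g (\<Sum>x\<in>A. f x) = (\<Sum>x\<in>A. g (f x))"
  by (induction A rule: infinite_finite_induct) (simp_all add: assms clinear_0 clinear_add)

lemma clinear_ident: "clinear (\<lambda>x::'a::complex_vector. x)"
  by (simp add: clinear_iff)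

lemma clinear_scaleC: "clinear (\<lambda>x::'a::complex_vector. c *\<^sub>C x)"
  by (simp add: clinear_iff scaleC_add_right mult.commute)

lemma clinear_comp:
  fixes g :: "'a::complex_vector \<Rightarrow> 'b::complex_vector" and f :: "'c::complex_vector \<Rightarrow> 'a"
  shows "clinear g \<Longrightarrow> clinear f \<Longrightarrow> clinear (\<lambda>x. g (f x))"
  by (simp add: clinear_iff)

lemma clinear_sum_fun:
  fixes g :: "'i \<Rightarrow> 'a::complex_vector \<Rightarrow> 'b::complex_vector"
  assumes "\<And>i. i \<in> A \<Longrightarrow> clinear (g i)"
  shows "clinear (\<lambda>x. \<Sum>i\<in>A. g i x)"
  using assms by (auto simp: clinear_iff sum.distrib cvec.scale_sum_right intro!: sum.cong)

lemma clinear_Sum_any: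
  fixes g :: "'a::complex_vector \<Rightarrow> 'b::complex_vector"
  assumes g: "clinear g" and fin: "finite {x. f x \<noteq> 0}"
  shows "g (\<Sum>x. f x) = (\<Sum>x. g (f x))"
proof -
  have "(\<Sum>x. g (f x)) = (\<Sum>x\<in>{x. f x \<noteq> 0}. g (f x))"
    by (rule Sum_any.expand_superset[OF fin]) (auto simp: clinear_0[OF g])
  then show ?thesis by (simp add: Sum_any.expand_set clinear_sum[OF g])
qed

lemma Sum_any_minus:
  fixes f :: "'i \<Rightarrow> 'a::ab_group_add"
  shows "(\<Sum>x. - f x) = - (\<Sum>x. f x)"
  by (simp add: Sum_any.expand_set sum_negf)

lemma Sum_any_diff:
  fixes f g :: "'i \<Rightarrow> 'a::ab_group_add"
  assumes "finite {x. f x \<noteq> 0}" and "finite {x. g x \<noteq> 0}"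
  shows "(\<Sum>x. f x - g x) = (\<Sum>x. f x) - (\<Sum>x. g x)"
  using Sum_any.distrib[of f "\<lambda>x. - g x"] assms by (simp add: Sum_any_minus)

lemma Sum_any_bij:
  fixes f :: "'i \<Rightarrow> 'a::comm_monoid_add" and h :: "'j \<Rightarrow> 'i"
  assumes "bij h"
  shows "(\<Sum>x. f (h x)) = (\<Sum>x. f x)"
  by (rule sym, rule Sum_any.reindex_cong[OF assms]) (simp add: fun_eq_iff)

lemma Sum_any_prod:
  fixes f :: "'i \<Rightarrow> 'j \<Rightarrow> 'a::comm_monoid_add"
  assumes "finite {(x, y). f x y \<noteq> 0}"
  shows "(\<Sum>x. \<Sum>y. f x y) = (\<Sum>(x, y). f x y)"
proof (rule Sum_any.cartesian_product)
  let ?C = "{(x, y). f x y \<noteq> 0}"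
  show "finite (fst ` ?C \<times> snd ` ?C)" using assms by simp
  show "{x. \<exists>y. f x y \<noteq> 0} \<times> {y. \<exists>x. f x y \<noteq> 0} \<subseteq> fst ` ?C \<times> snd ` ?C"
    by force
qed

lemma Sum_any_swap:
  fixes f :: "'i \<Rightarrow> 'j \<Rightarrow> 'a::comm_monoid_add"
  assumes "finite {(x, y). f x y \<noteq> 0}"
  shows "(\<Sum>x. \<Sum>y. f x y) = (\<Sum>y. \<Sum>x. f x y)"
proof (rule Sum_any.swap)
  let ?C = "{(x, y). f x y \<noteq> 0}"
  show "finite (fst ` ?C \<times> snd ` ?C)" using assms by simp
  show "{x. \<exists>y. f x y \<noteq> 0} \<times> {y. \<exists>x. f x y \<noteq> 0} \<subseteq> fst ` ?C \<times> snd ` ?C"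
    by force
qed

section \<open>The three sums of the Borcherds identity\<close>

definition bsum :: "complex \<Rightarrow> (nat \<Rightarrow> 'a::complex_vector) \<Rightarrow> 'a" where
  "bsum x G = (\<Sum>i. (x gchoose i) *\<^sub>C G i)"

lemma bsum_add:
  assumes "finite {i. G i \<noteq> 0}" and "finite {i. H i \<noteq> 0}"
  shows "bsum x (\<lambda>i. G i + H i) = bsum x G + bsum x H"
  unfolding bsum_def scaleC_add_right
  by (rule Sum_any.distrib) (auto intro: finite_subset[OF _ assms(1)] finite_subset[OF _ assms(2)])

lemma bsum_minus: "bsum x (\<lambda>i. - G i) = - bsum x G"
  by (simp add: bsum_def Sum_any_minus)

lemma bsum_clinear:
  assumes "clinear g" and "finite {i. G i \<noteq> 0}"
  shows "g (bsum x G) = bsum x (\<lambda>i. g (G i))"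
proof -
  have "finite {i. (x gchoose i) *\<^sub>C G i \<noteq> 0}"
    by (rule finite_subset[OF _ assms(2)]) auto
  then show ?thesis
    by (simp add: bsum_def clinear_Sum_any[OF assms(1)] clinear_scale[OF assms(1)])
qed

lemma bsum_0: "bsum 0 G = G 0"
proof -
  have "(0 gchoose i :: complex) *\<^sub>C G i = (if i = 0 then G i else 0)" for i
    by (cases i) simp_all
  then show ?thesis by (simp add: bsum_def)
qed

text \<open>Pascal's rule. With T the shift of sequences, \<open>bsum x\<close> is evaluation of (1
  + T)^x at index 0, and (1 + T)^(x + 1) = (1 + T)^x + (1 + T)^x T.\<close>

lemma bsum_Suc_shift:
  fixes G :: "nat \<Rightarrow> 'a::complex_vector"
  assumes fin: "finite {i. G i \<noteq> 0}"
  shows "bsum (x + 1) G = bsum x G + bsum x (\<lambda>i. G (Suc i))"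
proof -
  obtain N where N: "\<And>i. i \<ge> N \<Longrightarrow> G i = 0"
  proof -
    obtain N where "\<forall>i\<in>{i. G i \<noteq> 0}. i < N"
      using fin finite_nat_set_iff_bounded by blast
    then show ?thesis using that[of N] by force
  qed
  have *: "bsum y H = (\<Sum>i<M. (y gchoose i) *\<^sub>C H i)" if "\<And>i. i \<ge> M \<Longrightarrow> H i = 0"
    for y and H :: "nat \<Rightarrow> 'a" and M
    unfolding bsum_def using that
    by (intro Sum_any.expand_superset) (auto simp: not_less intro: leI ccontr)
  have "bsum (x + 1) G = (\<Sum>i<Suc N. (x + 1 gchoose i) *\<^sub>C G i)"
    by (rule *) (simp add: N)
  also have "\<dots> = G 0 + (\<Sum>i<N. (x gchoose i) *\<^sub>C G (Suc i))
      + (\<Sum>i<N. (x gchoose Suc i) *\<^sub>C G (Suc i))"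
    unfolding sum.lessThan_Suc_shift gbinomial_Suc_Suc scaleC_add_left sum.distrib
    by simp
  also have "\<dots> = (\<Sum>i<Suc N. (x gchoose i) *\<^sub>C G i) + (\<Sum>i<N. (x gchoose i) *\<^sub>C G (Suc i))"
    unfolding sum.lessThan_Suc_shift by simp
  also have "(\<Sum>i<Suc N. (x gchoose i) *\<^sub>C G i) = bsum x G"
    by (rule *[symmetric]) (simp add: N)
  also have "(\<Sum>i<N. (x gchoose i) *\<^sub>C G (Suc i)) = bsum x (\<lambda>i. G (Suc i))"
    by (rule *[symmetric]) (simp add: N)
  finally show ?thesis .
qed

text \<open>With \<open>Z s t = (a\<^sub>s b)\<^sub>t w\<close>, \<open>X p q = a\<^sub>p b\<^sub>q w\<close> and \<open>W p q = b\<^sub>q a\<^sub>p w\<close>, the Borcherds identity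
  reads \<open>iterate_sum Z l m n = product_sum X l m n - opposite_sum W l m n\<close>.\<close>

definition iterate_sum :: "(int \<Rightarrow> int \<Rightarrow> 'a::complex_vector) \<Rightarrow> int \<Rightarrow> int \<Rightarrow> int \<Rightarrow> 'a" where
  "iterate_sum Z l m n = bsum (of_int m) (\<lambda>i. Z (l + int i) (m + n - int i))"

definition product_sum :: "(int \<Rightarrow> int \<Rightarrow> 'a::complex_vector) \<Rightarrow> int \<Rightarrow> int \<Rightarrow> int \<Rightarrow> 'a" where
  "product_sum X l m n = bsum (of_int l) (\<lambda>i. (-1) ^ i *\<^sub>C X (l + m - int i) (n + int i))"

definition opposite_sum :: "(int \<Rightarrow> int \<Rightarrow> 'a::complex_vector) \<Rightarrow> int \<Rightarrow> int \<Rightarrow> int \<Rightarrow> 'a" where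
  "opposite_sum W l m n =
     ((-1) powi l) *\<^sub>C bsum (of_int l) (\<lambda>i. (-1) ^ i *\<^sub>C W (m + int i) (l + n - int i))"

text \<open>The truncation shared by (a_s b)_t w and b_t a_s w: uniform in the first index, and for
  the second index depending on the first. The products a_s b_t w satisfy the mirrored condition
  \<open>bounded_snd\<close>.\<close>

definition bounded_fst :: "(int \<Rightarrow> int \<Rightarrow> 'a::zero) \<Rightarrow> bool" where
  "bounded_fst F \<longleftrightarrow> (\<exists>S. \<forall>s\<ge>S. \<forall>t. F s t = 0) \<and> (\<forall>s. \<exists>T. \<forall>t\<ge>T. F s t = 0)"

definition bounded_snd :: "(int \<Rightarrow> int \<Rightarrow> 'a::zero) \<Rightarrow> bool" where
  "bounded_snd F \<longleftrightarrow> (\<exists>T. \<forall>t\<ge>T. \<forall>s. F s t = 0) \<and> (\<forall>t. \<exists>S. \<forall>s\<ge>S. F s t = 0)"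

lemma bounded_snd_flip: "bounded_snd (\<lambda>s t. F t s) \<longleftrightarrow> bounded_fst F"
  by (simp add: bounded_snd_def bounded_fst_def)

lemma finite_nat_bounded:
  assumes "\<And>i::nat. int i \<ge> K \<Longrightarrow> f i = 0"
  shows "finite {i. f i \<noteq> 0}"
  by (rule finite_subset[of _ "{..nat K}"]) (use assms in \<open>force simp: not_le\<close>, simp)

lemma finite_support_fst:
  assumes "bounded_fst F"
  shows "finite {i. F (l + int i) (g i) \<noteq> 0}" and "finite {i. c i *\<^sub>C F (l + int i) (g i) \<noteq> 0}"
proof -
  obtain S where S: "\<And>s t. s \<ge> S \<Longrightarrow> F s t = 0"
    using assms unfolding bounded_fst_def by blast
  show *: "finite {i. F (l + int i) (g i) \<noteq> 0}"
    by (rule finite_nat_bounded[of "S - l"]) (simp add: S)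
  show "finite {i. c i *\<^sub>C F (l + int i) (g i) \<noteq> 0}"
    by (rule finite_subset[OF _ *]) auto
qed

lemma finite_support_snd:
  assumes "bounded_snd F"
  shows "finite {i. F (g i) (l + int i) \<noteq> 0}" and "finite {i. c i *\<^sub>C F (g i) (l + int i) \<noteq> 0}"
  using finite_support_fst[of "\<lambda>s t. F t s"] assms bounded_snd_flip[of "\<lambda>s t. F t s"] by auto

text \<open>All three recursions express multiplication by z - w. Here z = x + y and w = y, so the
  factor is x, which raises the first index of \<open>Z\<close>; Pascal's rule acts on the binomials
  in \<open>m\<close>. For the other two sums it acts on the binomials in \<open>l\<close>.\<close>

lemma iterate_sum_rec:
  assumes "bounded_fst Z"
  shows "iterate_sum Z (l + 1) m n = iterate_sum Z l (m + 1) n - iterate_sum Z l m (n + 1)"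
proof -
  have "iterate_sum Z l (m + 1) n = bsum (of_int m) (\<lambda>i. Z (l + int i) (m + 1 + n - int i))
      + bsum (of_int m) (\<lambda>i. Z (l + int (Suc i)) (m + 1 + n - int (Suc i)))"
    unfolding iterate_sum_def of_int_add of_int_1
    by (rule bsum_Suc_shift) (rule finite_support_fst[OF assms])
  then show ?thesis by (simp add: iterate_sum_def algebra_simps)
qed

lemma product_sum_rec:
  assumes "bounded_snd X"
  shows "product_sum X (l + 1) m n = product_sum X l (m + 1) n - product_sum X l m (n + 1)"
proof -
  have "product_sum X (l + 1) m n =
      bsum (of_int l) (\<lambda>i. (-1) ^ i *\<^sub>C X (l + 1 + m - int i) (n + int i))
      + bsum (of_int l) (\<lambda>i. (-1) ^ Suc i *\<^sub>C X (l + 1 + m - int (Suc i)) (n + int (Suc i)))"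
    unfolding product_sum_def of_int_add of_int_1
    by (rule bsum_Suc_shift) (rule finite_support_snd[OF assms])
  then show ?thesis
    by (simp add: product_sum_def algebra_simps bsum_minus)
qed

lemma opposite_sum_rec:
  assumes "bounded_fst W"
  shows "opposite_sum W (l + 1) m n = opposite_sum W l (m + 1) n - opposite_sum W l m (n + 1)"
proof -
  have "bsum (of_int (l + 1)) (\<lambda>i. (-1) ^ i *\<^sub>C W (m + int i) (l + 1 + n - int i)) =
      bsum (of_int l) (\<lambda>i. (-1) ^ i *\<^sub>C W (m + int i) (l + 1 + n - int i))
      + bsum (of_int l) (\<lambda>i. (-1) ^ Suc i *\<^sub>C W (m + int (Suc i)) (l + 1 + n - int (Suc i)))"
    unfolding of_int_add of_int_1
    by (rule bsum_Suc_shift) (rule finite_support_fst[OF assms])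
  then have "bsum (of_int (l + 1)) (\<lambda>i. (-1) ^ i *\<^sub>C W (m + int i) (l + 1 + n - int i)) =
      bsum (of_int l) (\<lambda>i. (-1) ^ i *\<^sub>C W (m + int i) (l + (n + 1) - int i))
      - bsum (of_int l) (\<lambda>i. (-1) ^ i *\<^sub>C W (m + 1 + int i) (l + n - int i))"
    by (simp add: algebra_simps bsum_minus)
  then show ?thesis
    unfolding opposite_sum_def
    by (simp add: power_int_add cvec.scale_right_diff_distrib)
qed

text \<open>Once the row m + 1 vanishes for all l and n, the recursion on row m reads D (l + 1) m n
  = - D l m (n + 1), so vanishing for large l propagates down to every l. The outer induction lowers
  m from M, the inner one lowers l from N.\<close>

lemma borcherds_by_descent:
  fixes D :: "int \<Rightarrow> int \<Rightarrow> int \<Rightarrow> 'a::ab_group_add"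
  assumes rec: "\<And>l m n. D (l + 1) m n = D l (m + 1) n - D l m (n + 1)"
    and l: "\<And>l m n. l \<ge> N \<Longrightarrow> D l m n = 0"
    and m: "\<And>l m n. m \<ge> M \<Longrightarrow> D l m n = 0"
  shows "D l m n = 0"
proof -
  have "\<forall>l n. D l (M - int j) n = 0" for j
  proof (induction j)
    case 0 then show ?case by (simp add: m)
  next
    case (Suc j)
    let ?m = "M - int (Suc j)"
    have "D (N - int i) ?m n = 0" for i n
    proof (induction i arbitrary: n)
      case 0 then show ?case by (simp add: l)
    next
      case (Suc i)
      have "D (N - int i) ?m (n - 1) = D (N - int (Suc i)) (M - int j) (n - 1) - D (N - int (Suc i)) ?m n"
        using rec[of "N - int (Suc i)" ?m "n - 1"] by (simp add: algebra_simps)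
      then show ?case using Suc[of "n - 1"] \<open>\<forall>l n. D l (M - int j) n = 0\<close> by simp
    qed
    then have *: "D (N - int i) ?m n = 0" for i n .
    show ?case
    proof (intro allI)
      fix l n
      show "D l ?m n = 0"
        by (cases "l \<ge> N") (use l *[of "nat (N - l)" n] in auto)
    qed
  qed
  then have *: "D l (M - int j) n = 0" for j l n by blast
  show ?thesis by (cases "m \<ge> M") (use m *[of l "nat (M - m)" n] in auto)
qed

text \<open>Multiplication by z + a w, where \<open>F m n\<close> is the coefficient of z^(-m-1)
  w^(-n-1).\<close>

definition step :: "complex \<Rightarrow> (int \<Rightarrow> int \<Rightarrow> 'a::complex_vector) \<Rightarrow> int \<Rightarrow> int \<Rightarrow> 'a" where
  "step a F = (\<lambda>m n. F (m + 1) n + a *\<^sub>C F m (n + 1))"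

text \<open>For a natural exponent (z - w)^l is a polynomial, and the sum is iterated multiplication
  by z - w. \<open>opposite_sum\<close> gives the same operator, so the two can be compared.\<close>

lemma product_sum_nat:
  assumes "bounded_snd X"
  shows "product_sum X (int l) = (step (-1) ^^ l) X"
proof (induction l)
  case 0
  then show ?case by (simp add: product_sum_def bsum_0 fun_eq_iff)
next
  case (Suc l)
  have "product_sum X (int (Suc l)) = step (-1) (product_sum X (int l))"
    using product_sum_rec[OF assms, of "int l"] by (simp add: step_def fun_eq_iff add.commute)
  then show ?case by (simp add: Suc)
qed

lemma opposite_sum_nat:
  assumes "bounded_fst W"
  shows "opposite_sum W (int l) = (step (-1) ^^ l) W"
proof (induction l)
  case 0
  then show ?case by (simp add: opposite_sum_def bsum_0 fun_eq_iff)
next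
  case (Suc l)
  have "opposite_sum W (int (Suc l)) = step (-1) (opposite_sum W (int l))"
    using opposite_sum_rec[OF assms, of "int l"] by (simp add: step_def fun_eq_iff add.commute)
  then show ?case by (simp add: Suc)
qed

lemma iterate_sum_nat:
  assumes "bounded_fst Z"
  shows "(\<lambda>l n. iterate_sum Z l (int m) n) = (step 1 ^^ m) Z"
proof (induction m)
  case 0
  then show ?case by (simp add: iterate_sum_def bsum_0 fun_eq_iff)
next
  case (Suc m)
  have "(\<lambda>l n. iterate_sum Z l (int (Suc m)) n) = step 1 (\<lambda>l n. iterate_sum Z l (int m) n)"
    using iterate_sum_rec[OF assms, of _ "int m"] by (simp add: step_def fun_eq_iff add.commute)
  then show ?case by (simp add: Suc)
qed

section \<open>Convolutions\<close>

lemma lookup_tensor: "lookup (tensor u w) b = lookup w b *\<^sub>C u"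
  by (simp add: tensor_def Poly_Mapping.map.rep_eq when_def)

lemma tensor_single: "tensor u (single b x) = single b (x *\<^sub>C u)"
  by (rule poly_mapping_eqI) (simp add: lookup_tensor lookup_single when_def)

lemma clinear_tensor_left: "clinear (\<lambda>u. tensor u w)"
  by (rule clinearI; rule poly_mapping_eqI)
    (simp_all add: lookup_tensor lookup_add lookup_scaleC scaleC_add_right mult.commute)

lemma clinear_tensor_right: "clinear (tensor u)"
  by (rule clinearI; rule poly_mapping_eqI)
    (simp_all add: lookup_tensor lookup_add lookup_scaleC scaleC_add_left scaleC_complex_def)

lemmas tensor_linear_simps =
  clinear_add[OF clinear_tensor_left] clinear_add[OF clinear_tensor_right]
  clinear_diff[OF clinear_tensor_left] clinear_diff[OF clinear_tensor_right]
  clinear_scale[OF clinear_tensor_left] clinear_scale[OF clinear_tensor_right]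

lemma tensor_0 [simp]: "tensor 0 w = 0" "tensor u 0 = 0"
  by (simp_all add: clinear_0[OF clinear_tensor_left] clinear_0[OF clinear_tensor_right])

text \<open>The coefficients of a product of two series in z and w. Since index m belongs to the
  exponent -m-1, the indices of the factors add up to m - 1.\<close>

definition conv ::
  "(int \<Rightarrow> int \<Rightarrow> 'a::complex_vector) \<Rightarrow> (int \<Rightarrow> int \<Rightarrow> pi_space) \<Rightarrow> int \<Rightarrow> int \<Rightarrow> 'a tensor_pi" where
  "conv F G m n = (\<Sum>(s, t). tensor (F s t) (G (m - 1 - s) (n - 1 - t)))"

definition convolvable ::
  "(int \<Rightarrow> int \<Rightarrow> 'a::zero) \<Rightarrow> (int \<Rightarrow> int \<Rightarrow> 'b::zero) \<Rightarrow> bool" where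
  "convolvable F G \<longleftrightarrow> (\<forall>m n. finite {(s, t). F s t \<noteq> 0 \<and> G (m - s) (n - t) \<noteq> 0})"

text \<open>The uniform bounds of both arrays confine the second index to an interval; for each of
  its finitely many values the remaining bounds confine the first index.\<close>

lemma convolvable_snd:
  assumes F: "bounded_snd F" and G: "bounded_snd G"
  shows "convolvable F G"
  unfolding convolvable_def
proof (intro allI)
  fix m n :: int
  obtain T where T: "\<And>s t. t \<ge> T \<Longrightarrow> F s t = 0"
    using F unfolding bounded_snd_def by blast
  obtain S where S: "\<And>s t. s \<ge> S t \<Longrightarrow> F s t = 0"
    using F unfolding bounded_snd_def by metis
  obtain T' where T': "\<And>s t. t \<ge> T' \<Longrightarrow> G s t = 0"
    using G unfolding bounded_snd_def by blast
  obtain S' where S': "\<And>s t. s \<ge> S' t \<Longrightarrow> G s t = 0"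
    using G unfolding bounded_snd_def by metis
  let ?B = "\<Union>t\<in>{n - T'<..<T}. {m - S' (n - t)<..<S t} \<times> {t}"
  have "{(s, t). F s t \<noteq> 0 \<and> G (m - s) (n - t) \<noteq> 0} \<subseteq> ?B"
  proof safe
    fix s t assume *: "F s t \<noteq> 0" "G (m - s) (n - t) \<noteq> 0"
    have "t < T" "s < S t" "n - t < T'" "m - s < S' (n - t)"
      using * T[of t s] S[of t s] T'[of "n - t" "m - s"] S'[of "n - t" "m - s"] by force+
    then show "(s, t) \<in> ?B" by auto
  qed
  then show "finite {(s, t). F s t \<noteq> 0 \<and> G (m - s) (n - t) \<noteq> 0}"
    by (rule finite_subset) auto
qed

lemma convolvable_fst:
  assumes F: "bounded_fst F" and G: "bounded_fst G"
  shows "convolvable F G"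
  unfolding convolvable_def
proof (intro allI)
  fix m n
  have "convolvable (\<lambda>s t. F t s) (\<lambda>s t. G t s)"
    by (rule convolvable_snd) (simp_all add: bounded_snd_flip F G)
  then have "finite {(s, t). F t s \<noteq> 0 \<and> G (m - t) (n - s) \<noteq> 0}"
    unfolding convolvable_def by blast
  then have "finite (prod.swap ` {(s, t). F t s \<noteq> 0 \<and> G (m - t) (n - s) \<noteq> 0})" by simp
  moreover have "{(s, t). F s t \<noteq> 0 \<and> G (m - s) (n - t) \<noteq> 0} \<subseteq>
      prod.swap ` {(s, t). F t s \<noteq> 0 \<and> G (m - t) (n - s) \<noteq> 0}"
    by (auto simp: image_iff)
  ultimately show "finite {(s, t). F s t \<noteq> 0 \<and> G (m - s) (n - t) \<noteq> 0}"
    by (rule rev_finite_subset)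
qed

lemma convolvable_finite:
  assumes "convolvable F G"
  shows "finite {(s, t). F (s + a) (t + b) \<noteq> 0 \<and> G (m - s) (n - t) \<noteq> 0}"
proof -
  have "finite ((\<lambda>(s, t). (s - a, t - b)) ` {(s, t). F s t \<noteq> 0 \<and> G (m + a - s) (n + b - t) \<noteq> 0})"
    using assms by (auto simp: convolvable_def)
  moreover have "{(s, t). F (s + a) (t + b) \<noteq> 0 \<and> G (m - s) (n - t) \<noteq> 0} \<subseteq>
      (\<lambda>(s, t). (s - a, t - b)) ` {(s, t). F s t \<noteq> 0 \<and> G (m + a - s) (n + b - t) \<noteq> 0}"
  proof safe
    fix s t assume "F (s + a) (t + b) \<noteq> 0" "G (m - s) (n - t) \<noteq> 0"
    then show "(s, t) \<in> (\<lambda>(s, t). (s - a, t - b)) ` {(s, t). F s t \<noteq> 0 \<and> G (m + a - s) (n + b - t) \<noteq> 0}"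
      by (intro image_eqI[of _ _ "(s + a, t + b)"]) auto
  qed
  ultimately show ?thesis by (rule rev_finite_subset)
qed

lemma conv_support:
  assumes "convolvable F G"
  shows "finite {z. (case z of (s, t) \<Rightarrow> tensor (F (s + a) (t + b)) (G (m - s) (n - t))) \<noteq> 0}"
  by (rule finite_subset[OF _ convolvable_finite[OF assms, of a b m n]]) auto

lemma convolvable_sym:
  assumes "convolvable F G"
  shows "convolvable G F"
  unfolding convolvable_def
proof (intro allI)
  fix m n
  have "finite ((\<lambda>(s, t). (m - s, n - t)) ` {(s, t). F s t \<noteq> 0 \<and> G (m - s) (n - t) \<noteq> 0})"
    using assms by (auto simp: convolvable_def)
  moreover have "{(s, t). G s t \<noteq> 0 \<and> F (m - s) (n - t) \<noteq> 0} \<subseteq>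
      (\<lambda>(s, t). (m - s, n - t)) ` {(s, t). F s t \<noteq> 0 \<and> G (m - s) (n - t) \<noteq> 0}"
    by (auto intro!: image_eqI[of _ _ "(m - _, n - _)"])
  ultimately show "finite {(s, t). G s t \<noteq> 0 \<and> F (m - s) (n - t) \<noteq> 0}"
    by (rule rev_finite_subset)
qed

lemma convolvable_comm: "convolvable F G \<longleftrightarrow> convolvable G F"
  using convolvable_sym[of F G] convolvable_sym[of G F] by blast

lemma convolvable_step:
  assumes "convolvable F G"
  shows "convolvable (step a F) G"
proof -
  have fin: "finite ({(s, t). F (s + 1) (t + 0) \<noteq> 0 \<and> G (m - s) (n - t) \<noteq> 0} \<union>
      {(s, t). F (s + 0) (t + 1) \<noteq> 0 \<and> G (m - s) (n - t) \<noteq> 0})" for m n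
    by (intro finite_UnI convolvable_finite assms)
  show ?thesis
    unfolding convolvable_def step_def by (intro allI finite_subset[OF _ fin]) auto
qed

lemma conv_shift:
  "(\<Sum>(s, t). tensor (F (s + a) (t + b)) (G (m - 1 - s) (n - 1 - t))) = conv F G (m + a) (n + b)"
proof -
  have "bij (\<lambda>(s, t). (s + a :: int, t + b :: int))"
    by (rule bij_betw_byWitness[where f' = "\<lambda>(s, t). (s - a, t - b)"]) auto
  from Sum_any_bij[OF this, of "\<lambda>(s, t). tensor (F s t) (G (m + a - 1 - s) (n + b - 1 - t))"]
  show ?thesis
    by (simp add: conv_def case_prod_unfold algebra_simps)
qed

lemma conv_step_left:
  assumes "convolvable F G"
  shows "conv (step a F) G = step a (conv F G)"
proof (intro ext)
  fix m n
  let ?f = "\<lambda>i j z. case z of (s, t) \<Rightarrow> tensor (F (s + i) (t + j)) (G (m - 1 - s) (n - 1 - t))"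
  have fin: "finite {z. ?f i j z \<noteq> 0}" for i j by (rule conv_support[OF assms])
  have fin': "finite {z. a *\<^sub>C ?f 0 1 z \<noteq> 0}" by (rule finite_subset[OF _ fin[of 0 1]]) auto
  have *: "(case z of (s, t) \<Rightarrow> tensor (F (s + 1) t + a *\<^sub>C F s (t + 1)) (G (m - 1 - s) (n - 1 - t))) =
      ?f 1 0 z + a *\<^sub>C ?f 0 1 z" for z
    by (cases z) (simp add: tensor_linear_simps)
  have "conv (step a F) G m n = (\<Sum>z. ?f 1 0 z) + a *\<^sub>C (\<Sum>z. ?f 0 1 z)"
    unfolding step_def conv_def[of "\<lambda>m n. F (m + 1) n + a *\<^sub>C F m (n + 1)"] *
      Sum_any.distrib[OF fin fin'] clinear_Sum_any[OF clinear_scaleC fin] ..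
  then show "conv (step a F) G m n = step a (conv F G) m n"
    unfolding conv_shift step_def by simp
qed

lemma conv_flip: "conv F G m n = (\<Sum>(s, t). tensor (F (m - 1 - s) (n - 1 - t)) (G s t))"
proof -
  have "bij (\<lambda>(s, t). (m - 1 - s :: int, n - 1 - t :: int))"
    by (rule bij_betw_byWitness[where f' = "\<lambda>(s, t). (m - 1 - s, n - 1 - t)"]) auto
  from Sum_any_bij[OF this, of "\<lambda>(s, t). tensor (F s t) (G (m - 1 - s) (n - 1 - t))"]
  show ?thesis
    by (simp add: conv_def case_prod_unfold)
qed

lemma conv_shift_right:
  "(\<Sum>(s, t). tensor (F (m - 1 - s) (n - 1 - t)) (G (s + a) (t + b))) = conv F G (m + a) (n + b)"
proof -
  have "bij (\<lambda>(s, t). (s + a :: int, t + b :: int))"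
    by (rule bij_betw_byWitness[where f' = "\<lambda>(s, t). (s - a, t - b)"]) auto
  from Sum_any_bij[OF this, of "\<lambda>(s, t). tensor (F (m + a - 1 - s) (n + b - 1 - t)) (G s t)"]
  show ?thesis
    by (simp add: conv_flip case_prod_unfold algebra_simps)
qed

lemma conv_support_right:
  assumes "convolvable F G"
  shows "finite {z. (case z of (s, t) \<Rightarrow> tensor (F (m - s) (n - t)) (G (s + a) (t + b))) \<noteq> 0}"
proof -
  have "convolvable G F" using assms convolvable_comm by blast
  from convolvable_finite[OF this, of a b m n] show ?thesis
    by (rule rev_finite_subset) auto
qed

lemma conv_step_right:
  assumes "convolvable F G"
  shows "conv F (step a G) = step a (conv F G)"
proof (intro ext)
  fix m n
  let ?f = "\<lambda>i j z. case z of (s, t) \<Rightarrow> tensor (F (m - 1 - s) (n - 1 - t)) (G (s + i) (t + j))"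
  have fin: "finite {z. ?f i j z \<noteq> 0}" for i j by (rule conv_support_right[OF assms])
  have fin': "finite {z. a *\<^sub>C ?f 0 1 z \<noteq> 0}" by (rule finite_subset[OF _ fin[of 0 1]]) auto
  have *: "(case z of (s, t) \<Rightarrow> tensor (F (m - 1 - s) (n - 1 - t)) (G (s + 1) t + a *\<^sub>C G s (t + 1))) =
      ?f 1 0 z + a *\<^sub>C ?f 0 1 z" for z
    by (cases z) (simp add: tensor_linear_simps)
  have "conv F (step a G) m n = (\<Sum>z. ?f 1 0 z) + a *\<^sub>C (\<Sum>z. ?f 0 1 z)"
    unfolding step_def conv_flip[of _ "\<lambda>m n. G (m + 1) n + a *\<^sub>C G m (n + 1)"] *
      Sum_any.distrib[OF fin fin'] clinear_Sum_any[OF clinear_scaleC fin] ..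
  then show "conv F (step a G) m n = step a (conv F G) m n"
    unfolding conv_shift_right step_def by simp
qed

text \<open>Multiplication by z + a w may be carried out on either factor of a product, so an
  exponent can be divided between the factors at will.\<close>

lemma conv_funpow_step:
  assumes "convolvable F G"
  shows "conv ((step a ^^ i) F) ((step a ^^ j) G) = (step a ^^ (i + j)) (conv F G)"
proof -
  have c: "convolvable ((step a ^^ i) F) G" for i
    by (induction i) (simp_all add: assms convolvable_step)
  have c': "convolvable ((step a ^^ i) F) ((step a ^^ j) G)" for i j
    using c[of i]
    by (induction j) (simp_all add: convolvable_comm[of "(step a ^^ i) F"] convolvable_step)
  have "conv ((step a ^^ i) F) G = (step a ^^ i) (conv F G)"
    by (induction i) (simp_all add: conv_step_left c)
  then show ?thesis
    by (induction j) (simp_all add: conv_step_right c')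
qed

section \<open>The substitution z = x + y in a product of series\<close>

lemma gbinomial_shifted_Vandermonde:
  fixes a b :: complex
  shows "(\<Sum>i\<le>k. (a + of_nat i gchoose i) * (b - a - of_nat i gchoose (k - i))) = (b + 1 gchoose k)"
proof -
  have "(\<Sum>i\<le>k. (a + of_nat i gchoose i) * (b - a - of_nat i gchoose (k - i))) =
      (\<Sum>i\<le>k. (-1) ^ k * ((- a - 1 gchoose i) * (of_nat k - b + a - 1 gchoose (k - i))))"
  proof (rule sum.cong[OF refl])
    fix i assume i: "i \<in> {..k}"
    \<comment> \<open>Upper negation removes \<open>i\<close> from both upper entries, so that the
      ordinary Vandermonde identity applies.\<close>
    have 1: "(a + of_nat i gchoose i) = (-1) ^ i * (- a - 1 gchoose i)"
      by (subst gbinomial_negated_upper) simp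
    have "of_nat (k - i) - (b - a - of_nat i) - 1 = of_nat k - b + a - 1"
      using i by (simp add: of_nat_diff)
    then have 2: "(b - a - of_nat i gchoose (k - i)) = (-1) ^ (k - i) * (of_nat k - b + a - 1 gchoose (k - i))"
      by (simp only: gbinomial_negated_upper[of "b - a - of_nat i"])
    have "(-1) ^ i * (-1) ^ (k - i) = ((-1) ^ k :: complex)"
      using i by (simp flip: power_add)
    then show "(a + of_nat i gchoose i) * (b - a - of_nat i gchoose (k - i)) =
        (-1) ^ k * ((- a - 1 gchoose i) * (of_nat k - b + a - 1 gchoose (k - i)))"
      unfolding 1 2 by (simp add: mult_ac)
  qed
  also have "\<dots> = (-1) ^ k * (- a - 1 + (of_nat k - b + a - 1) gchoose k)"
    by (simp add: gbinomial_Vandermonde flip: sum_distrib_left atLeast0AtMost)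
  also have "\<dots> = (b + 1 gchoose k)"
    by (subst gbinomial_negated_upper[of "b + 1"]) (simp add: algebra_simps)
  finally show ?thesis .
qed

lemma Sum_any_triangle:
  fixes g :: "nat \<Rightarrow> nat \<Rightarrow> 'a::comm_monoid_add"
  assumes "\<And>i j. i + j \<ge> N \<Longrightarrow> g i j = 0"
  shows "(\<Sum>(i, j). g i j) = (\<Sum>k. \<Sum>i\<le>k. g i (k - i))"
proof -
  have "finite {(i, j). i + j < N}"
    by (rule finite_subset[of _ "{..<N} \<times> {..<N}"]) auto
  then have "(\<Sum>(i, j). g i j) = (\<Sum>(i, j)\<in>{(i, j). i + j < N}. g i j)"
    by (rule Sum_any.expand_superset) (use assms in \<open>auto simp: not_less[symmetric]\<close>)
  also have "\<dots> = (\<Sum>k<N. \<Sum>i\<le>k. g i (k - i))"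
    by (rule sum.triangle_reindex)
  also have "\<dots> = (\<Sum>k. \<Sum>i\<le>k. g i (k - i))"
  proof (rule Sum_any.expand_superset[symmetric])
    show "{k. (\<Sum>i\<le>k. g i (k - i)) \<noteq> 0} \<subseteq> {..<N}"
    proof (rule subsetI, rule ccontr)
      fix k assume k: "k \<in> {k. (\<Sum>i\<le>k. g i (k - i)) \<noteq> 0}" "k \<notin> {..<N}"
      then have "(\<Sum>i\<le>k. g i (k - i)) = 0"
        by (intro sum.neutral) (auto intro: assms)
      with k show False by simp
    qed
  qed simp
  finally show ?thesis .
qed

lemma tensor_bsum:
  assumes G: "finite {i. G i \<noteq> 0}" and H: "finite {i. H i \<noteq> 0}"
  shows "tensor (bsum x G) (bsum y H) = (\<Sum>(i, j). ((x gchoose i) * (y gchoose j)) *\<^sub>C tensor (G i) (H j))"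
proof -
  have fin: "finite {(i, j). ((x gchoose i) * (y gchoose j)) *\<^sub>C tensor (G i) (H j) \<noteq> 0}"
    by (rule finite_subset[of _ "{i. G i \<noteq> 0} \<times> {j. H j \<noteq> 0}"]) (auto simp: G H)
  have "tensor (bsum x G) (bsum y H) = (\<Sum>i. (x gchoose i) *\<^sub>C (\<Sum>j. (y gchoose j) *\<^sub>C tensor (G i) (H j)))"
    unfolding bsum_clinear[OF clinear_tensor_left G]
    unfolding bsum_clinear[OF clinear_tensor_right H]
    unfolding bsum_def ..
  also have "\<dots> = (\<Sum>i. \<Sum>j. ((x gchoose i) * (y gchoose j)) *\<^sub>C tensor (G i) (H j))"
  proof (rule Sum_any.cong)
    fix i
    have "finite {j. (y gchoose j) *\<^sub>C tensor (G i) (H j) \<noteq> 0}"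
      by (rule finite_subset[OF _ H]) auto
    then show "(x gchoose i) *\<^sub>C (\<Sum>j. (y gchoose j) *\<^sub>C tensor (G i) (H j)) =
        (\<Sum>j. ((x gchoose i) * (y gchoose j)) *\<^sub>C tensor (G i) (H j))"
      by (simp add: clinear_Sum_any[OF clinear_scaleC])
  qed
  also have "\<dots> = (\<Sum>(i, j). ((x gchoose i) * (y gchoose j)) *\<^sub>C tensor (G i) (H j))"
    by (rule Sum_any_prod[OF fin])
  finally show ?thesis .
qed

text \<open>The substitution p = s + m - i, q = t + i mixes the two pairs of indices, so both
  iterated sums are flattened to sums over quadruples. Finiteness is given for \<open>G\<close> and
  reaches \<open>F\<close> through the bijection.\<close>

lemma Sum_any_shear:
  fixes F G :: "int \<Rightarrow> int \<Rightarrow> nat \<Rightarrow> nat \<Rightarrow> 'a::comm_monoid_add"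
  assumes FG: "\<And>p q i j. F (p - m + int i) (q - int i) i j = G p q i j"
    and fin: "finite {((p, q), (i, j)). G p q i j \<noteq> 0}"
  shows "(\<Sum>(s, t). \<Sum>(i, j). F s t i j) = (\<Sum>(p, q). \<Sum>(i, j). G p q i j)"
proof -
  define h where "h = (\<lambda>((p, q), (i, j)). ((p - m + int i, q - int i), (i :: nat, j :: nat)))"
  define f where "f = (\<lambda>((s, t), (i, j)). F s t i j)"
  define g where "g = (\<lambda>((p, q), (i, j)). G p q i j)"
  have h: "bij h"
    unfolding h_def
    by (rule bij_betw_byWitness[where f' = "\<lambda>((s, t), (i, j)). ((s + m - int i, t + int i), (i, j))"]) auto
  have fh: "f (h z) = g z" for z
    by (auto simp: f_def g_def h_def FG split: prod.splits)
  have fin_g: "finite {z. g z \<noteq> 0}"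
    by (rule finite_subset[OF _ fin]) (auto simp: g_def split: prod.splits)
  have "{z. f z \<noteq> 0} \<subseteq> h ` {z. g z \<noteq> 0}"
  proof
    fix y assume y: "y \<in> {z. f z \<noteq> 0}"
    obtain z where "y = h z" using bij_is_surj[OF h] by (rule surjE)
    with y show "y \<in> h ` {z. g z \<noteq> 0}" by (simp add: fh)
  qed
  then have fin_f: "finite {z. f z \<noteq> 0}"
    using fin_g by (meson finite_imageI finite_subset)
  have pair: "(\<Sum>(s, t). \<Sum>(i, j). H s t i j) = (\<Sum>z. k z)"
    if "k = (\<lambda>((s, t), (i, j)). H s t i j)" and "finite {z. k z \<noteq> 0}"
    for H :: "int \<Rightarrow> int \<Rightarrow> nat \<Rightarrow> nat \<Rightarrow> 'a" and k
  proof -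
    have "(\<Sum>(s, t). \<Sum>(i, j). H s t i j) = (\<Sum>x. \<Sum>y. k (x, y))"
      by (intro Sum_any.cong) (simp add: that(1) case_prod_unfold)
    also have "\<dots> = (\<Sum>(x, y). k (x, y))"
      by (rule Sum_any_prod, rule finite_subset[OF _ that(2)]) auto
    finally show ?thesis by simp
  qed
  have "(\<Sum>(s, t). \<Sum>(i, j). F s t i j) = (\<Sum>z. f z)"
    by (rule pair[OF f_def fin_f])
  also have "\<dots> = (\<Sum>z. f (h z))" by (rule Sum_any_bij[OF h, symmetric])
  also have "\<dots> = (\<Sum>(p, q). \<Sum>(i, j). G p q i j)"
    unfolding fh by (rule pair[OF g_def fin_g, symmetric])
  finally show ?thesis .
qed

text \<open>\<open>product_sum X l m n\<close> is the coefficient of \<open>x^(-l-1) y^(-n-1)\<close> in \<open>z^m X(z, y)\<close> after the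
  substitution \<open>z = x + y\<close>, expanded in nonnegative powers of \<open>y\<close>; the substitution is multiplicative,
  by Vandermonde's identity.\<close>

lemma product_sum_conv:
  assumes X: "bounded_snd X" and Y: "bounded_snd Y"
  shows "conv (\<lambda>s t. product_sum X s m1 t) (\<lambda>s t. product_sum Y s m2 t) l n =
    product_sum (conv X Y) l (m1 + m2) n"
proof -
  \<comment> \<open>After the substitution p = s + m1 - i, q = t + i the tensors depend on
    \<open>i\<close> and \<open>j\<close> only through k = i + j; the remaining dependence is in the
    binomial coefficients.\<close>
  define V where "V = (\<lambda>p q k. tensor (X p q) (Y (l + (m1 + m2) - int k - 1 - p) (n + int k - 1 - q)))"
  define c :: "int \<Rightarrow> nat \<Rightarrow> nat \<Rightarrow> complex" where
    "c = (\<lambda>s i j. (of_int s gchoose i) * (of_int (l - 1 - s) gchoose j) * (-1) ^ (i + j))"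
  define F where "F = (\<lambda>s t i j. c s i j *\<^sub>C
    tensor (X (s + m1 - int i) (t + int i)) (Y (l - 1 - s + m2 - int j) (n - 1 - t + int j)))"
  define G where "G = (\<lambda>p q i j. c (p - m1 + int i) i j *\<^sub>C V p q (i + j))"
  obtain T where T: "\<And>s t. t \<ge> T \<Longrightarrow> X s t = 0"
    using X unfolding bounded_snd_def by blast
  obtain T' where T': "\<And>s t. t \<ge> T' \<Longrightarrow> Y s t = 0"
    using Y unfolding bounded_snd_def by blast
  \<comment> \<open>If k \<ge> K, then q \<ge> T or n + k - 1 - q \<ge> T', and one of the two
    tensor factors vanishes.\<close>
  define K where "K = nat (T + T' - n + 1)"
  have V0: "V p q k = 0" if "k \<ge> K" for p q k
  proof (cases "q \<ge> T")
    case False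
    then have "n + int k - 1 - q \<ge> T'" using that unfolding K_def by linarith
    then show ?thesis by (simp add: V_def T')
  qed (simp add: V_def T)
  have finV: "finite {(p, q). V p q k \<noteq> 0}" for k
    by (rule finite_subset[OF _ convolvable_finite[OF convolvable_snd[OF X Y], of 0 0
            "l + (m1 + m2) - int k - 1" "n + int k - 1"]]) (auto simp: V_def)
  define B where "B = (\<Union>k\<in>{..<K}. {(p, q). V p q k \<noteq> 0})"
  have finB: "finite B" unfolding B_def using finV by blast
  have B: "k < K" "(p, q) \<in> B" if "V p q k \<noteq> 0" for p q k
  proof -
    show "k < K" using V0[of k p q] that not_less by blast
    then show "(p, q) \<in> B" using that by (auto simp: B_def)
  qed
  have finG: "finite {((p, q), (i, j)). G p q i j \<noteq> 0}"
  proof (rule finite_subset)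
    show "{((p, q), (i, j)). G p q i j \<noteq> 0} \<subseteq> B \<times> ({..<K} \<times> {..<K})"
    proof safe
      fix p q i j assume "G p q i j \<noteq> 0"
      then have "V p q (i + j) \<noteq> 0" by (auto simp: G_def)
      from B[OF this] show "i < K" "j < K" "(p, q) \<in> B" by simp_all
    qed
    show "finite (B \<times> ({..<K} \<times> {..<K}))" using finB by simp
  qed
  have FG: "F (p - m1 + int i) (q - int i) i j = G p q i j" for p q i j
  proof -
    have e: "p - m1 + int i + m1 - int i = p" "q - int i + int i = q"
      "l - 1 - (p - m1 + int i) + m2 - int j = l + (m1 + m2) - int (i + j) - 1 - p"
      "n - 1 - (q - int i) + int j = n + int (i + j) - 1 - q"
      by simp_all
    show ?thesis unfolding F_def G_def V_def e ..
  qed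
  have "conv (\<lambda>s t. product_sum X s m1 t) (\<lambda>s t. product_sum Y s m2 t) l n =
      (\<Sum>(s, t). \<Sum>(i, j). F s t i j)"
    unfolding conv_def product_sum_def
  proof (intro Sum_any.cong)
    fix z :: "int \<times> int"
    obtain s t where z: "z = (s, t)" by (cases z)
    have "tensor (bsum (of_int s) (\<lambda>i. (-1) ^ i *\<^sub>C X (s + m1 - int i) (t + int i)))
        (bsum (of_int (l - 1 - s)) (\<lambda>j. (-1) ^ j *\<^sub>C Y (l - 1 - s + m2 - int j) (n - 1 - t + int j))) =
      (\<Sum>(i, j). F s t i j)"
      unfolding tensor_bsum[OF finite_support_snd(2)[OF X] finite_support_snd(2)[OF Y]]
    proof (intro Sum_any.cong)
      fix ij :: "nat \<times> nat"
      show "(case ij of (i, j) \<Rightarrow> ((of_int s gchoose i) * (of_int (l - 1 - s) gchoose j)) *\<^sub>C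
          tensor ((-1) ^ i *\<^sub>C X (s + m1 - int i) (t + int i))
            ((-1) ^ j *\<^sub>C Y (l - 1 - s + m2 - int j) (n - 1 - t + int j))) =
        (case ij of (i, j) \<Rightarrow> F s t i j)"
        by (cases ij) (simp add: F_def c_def tensor_linear_simps power_add mult_ac)
    qed
    then show "(case z of (s, t) \<Rightarrow> tensor
        (bsum (of_int s) (\<lambda>i. (-1) ^ i *\<^sub>C X (s + m1 - int i) (t + int i)))
        (bsum (of_int (l - 1 - s)) (\<lambda>i. (-1) ^ i *\<^sub>C Y (l - 1 - s + m2 - int i) (n - 1 - t + int i)))) =
      (case z of (s, t) \<Rightarrow> \<Sum>(i, j). F s t i j)"
      by (simp only: z prod.case)
  qed
  also have "\<dots> = (\<Sum>(p, q). \<Sum>(i, j). G p q i j)"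
    by (rule Sum_any_shear[OF FG finG])
  also have "\<dots> = (\<Sum>pq. \<Sum>k. ((of_int l gchoose k) * (-1) ^ k) *\<^sub>C (case pq of (p, q) \<Rightarrow> V p q k))"
  proof (intro Sum_any.cong)
    fix pq :: "int \<times> int"
    obtain p q where pq: "pq = (p, q)" by (cases pq)
    have "(\<Sum>ij. case ij of (i, j) \<Rightarrow> G p q i j) = (\<Sum>k. \<Sum>i\<le>k. G p q i (k - i))"
      by (rule Sum_any_triangle[of K]) (simp add: G_def V0)
    also have "\<dots> = (\<Sum>k. ((of_int l gchoose k) * (-1) ^ k) *\<^sub>C V p q k)"
    proof (intro Sum_any.cong)
      fix k
      have "(\<Sum>i\<le>k. G p q i (k - i)) = (\<Sum>i\<le>k. c (p - m1 + int i) i (k - i)) *\<^sub>C V p q k"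
        by (simp add: G_def cvec.scale_sum_left)
      \<comment> \<open>The two upper entries add up to l - 1 for every i, so the shifted
        Vandermonde identity yields the binomial coefficient with upper entry l, independent of
        p.\<close>
      also have "(\<Sum>i\<le>k. c (p - m1 + int i) i (k - i)) =
          (\<Sum>i\<le>k. (of_int (p - m1) + of_nat i gchoose i) *
            (of_int (l - 1) - of_int (p - m1) - of_nat i gchoose (k - i))) * (-1) ^ k"
        unfolding sum_distrib_right by (intro sum.cong) (auto simp: c_def algebra_simps)
      also have "\<dots> = (of_int l gchoose k) * (-1) ^ k"
        unfolding gbinomial_shifted_Vandermonde by simp
      finally show "(\<Sum>i\<le>k. G p q i (k - i)) = ((of_int l gchoose k) * (-1) ^ k) *\<^sub>C V p q k" .
    qed
    finally show "(case pq of (p, q) \<Rightarrow> \<Sum>(i, j). G p q i j) =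
        (\<Sum>k. ((of_int l gchoose k) * (-1) ^ k) *\<^sub>C (case pq of (p, q) \<Rightarrow> V p q k))"
      by (simp add: pq)
  qed
  also have "\<dots> = (\<Sum>k. \<Sum>pq. ((of_int l gchoose k) * (-1) ^ k) *\<^sub>C (case pq of (p, q) \<Rightarrow> V p q k))"
  proof (rule Sum_any_swap, rule finite_subset)
    show "{(pq, k). ((of_int l gchoose k) * (-1) ^ k) *\<^sub>C (case pq of (p, q) \<Rightarrow> V p q k) \<noteq> 0} \<subseteq>
        B \<times> {..<K}"
    proof safe
      fix p q k assume "((of_int l gchoose k) * (-1) ^ k) *\<^sub>C V p q k \<noteq> 0"
      then have "V p q k \<noteq> 0" by auto
      from B[OF this] show "k < K" "(p, q) \<in> B" .
    qed
    show "finite (B \<times> {..<K})" using finB by simp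
  qed
  also have "\<dots> = (\<Sum>k. ((of_int l gchoose k) * (-1) ^ k) *\<^sub>C conv X Y (l + (m1 + m2) - int k) (n + int k))"
  proof (intro Sum_any.cong)
    fix k
    have "finite {z. (case z of (p, q) \<Rightarrow> V p q k) \<noteq> 0}"
      by (rule finite_subset[OF _ finV]) auto
    from clinear_Sum_any[OF clinear_scaleC this]
    show "(\<Sum>pq. ((of_int l gchoose k) * (-1) ^ k) *\<^sub>C (case pq of (p, q) \<Rightarrow> V p q k)) =
        ((of_int l gchoose k) * (-1) ^ k) *\<^sub>C conv X Y (l + (m1 + m2) - int k) (n + int k)"
      by (simp only: conv_def V_def)
  qed
  also have "\<dots> = product_sum (conv X Y) l (m1 + m2) n"
    by (simp add: product_sum_def bsum_def)
  finally show ?thesis .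
qed

lemma iterate_sum_eventually_0:
  assumes "bounded_fst Z"
  shows "\<exists>N::nat. \<forall>l\<ge>int N. \<forall>m n. iterate_sum Z l m n = 0"
proof -
  obtain S where S: "\<And>s t. s \<ge> S \<Longrightarrow> Z s t = 0"
    using assms unfolding bounded_fst_def by blast
  have "iterate_sum Z l m n = 0" if "l \<ge> int (nat S)" for l m n
  proof -
    have "l \<ge> S" using that by linarith
    then show ?thesis by (simp add: iterate_sum_def bsum_def S)
  qed
  then show ?thesis by blast
qed

lemma opposite_sum_eventually_0:
  assumes "bounded_fst W"
  shows "\<exists>N::nat. \<forall>m\<ge>int N. \<forall>l n. opposite_sum W l m n = 0"
proof -
  obtain S where S: "\<And>s t. s \<ge> S \<Longrightarrow> W s t = 0"
    using assms unfolding bounded_fst_def by blast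
  have "opposite_sum W l m n = 0" if "m \<ge> int (nat S)" for l m n
  proof -
    have "m \<ge> S" using that by linarith
    then show ?thesis by (simp add: opposite_sum_def bsum_def S)
  qed
  then show ?thesis by blast
qed

lemma conv_borcherds:
  assumes bZ: "bounded_fst Z" "bounded_fst Z'" "bounded_fst (conv Z Z')"
    and bX: "bounded_snd X" "bounded_snd X'" "bounded_snd (conv X X')"
    and bW: "bounded_fst W" "bounded_fst W'" "bounded_fst (conv W W')"
    and B: "\<And>l m n. iterate_sum Z l m n = product_sum X l m n - opposite_sum W l m n"
    and B': "\<And>l m n. iterate_sum Z' l m n = product_sum X' l m n - opposite_sum W' l m n"
  shows "iterate_sum (conv Z Z') l m n =
    product_sum (conv X X') l m n - opposite_sum (conv W W') l m n"
proof -
  define D where "D = (\<lambda>l m n. iterate_sum (conv Z Z') l m n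
    - (product_sum (conv X X') l m n - opposite_sum (conv W W') l m n))"
  have rec: "D (l + 1) m n = D l (m + 1) n - D l m (n + 1)" for l m n
    unfolding D_def iterate_sum_rec[OF bZ(3)] product_sum_rec[OF bX(3)] opposite_sum_rec[OF bW(3)]
    by (simp add: algebra_simps)
  obtain N where N: "\<And>l m n. l \<ge> int N \<Longrightarrow> iterate_sum Z l m n = 0"
    using iterate_sum_eventually_0[OF bZ(1)] by blast
  obtain N' where N': "\<And>l m n. l \<ge> int N' \<Longrightarrow> iterate_sum Z' l m n = 0"
    using iterate_sum_eventually_0[OF bZ(2)] by blast
  obtain N'' where N'': "\<And>l m n. l \<ge> int N'' \<Longrightarrow> iterate_sum (conv Z Z') l m n = 0"
    using iterate_sum_eventually_0[OF bZ(3)] by blast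
  obtain M where M: "\<And>l m n. m \<ge> int M \<Longrightarrow> opposite_sum W l m n = 0"
    using opposite_sum_eventually_0[OF bW(1)] by blast
  obtain M' where M': "\<And>l m n. m \<ge> int M' \<Longrightarrow> opposite_sum W' l m n = 0"
    using opposite_sum_eventually_0[OF bW(2)] by blast
  obtain M'' where M'': "\<And>l m n. m \<ge> int M'' \<Longrightarrow> opposite_sum (conv W W') l m n = 0"
    using opposite_sum_eventually_0[OF bW(3)] by blast
  \<comment> \<open>At exponent N the iterate sum vanishes, and the Borcherds identity becomes
    locality of the two fields.\<close>
  have loc: "(step (-1) ^^ N) X = (step (-1) ^^ N) W"
    using B[of "int N"] N[of "int N"]
    by (simp add: fun_eq_iff flip: product_sum_nat[OF bX(1)] opposite_sum_nat[OF bW(1)])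
  have loc': "(step (-1) ^^ N') X' = (step (-1) ^^ N') W'"
    using B'[of "int N'"] N'[of "int N'"]
    by (simp add: fun_eq_iff flip: product_sum_nat[OF bX(2)] opposite_sum_nat[OF bW(2)])
  \<comment> \<open>The power (z - w)^(N + N') is divided as N on the first factor and N' on the
    second; the surplus j multiplies the resulting equality. The bound N'' removes the iterate sum
    of the convolution.\<close>
  have D_l: "D l m n = 0" if l: "l \<ge> int (max (N + N') N'')" for l m n
  proof -
    obtain j where j: "l = int (j + (N + N'))"
    proof
      show "l = int (nat (l - int (N + N')) + (N + N'))" using l by simp
    qed
    have "(step (-1) ^^ (N + N')) (conv X X') = (step (-1) ^^ (N + N')) (conv W W')"
      unfolding conv_funpow_step[OF convolvable_snd[OF bX(1,2)], symmetric]
        conv_funpow_step[OF convolvable_fst[OF bW(1,2)], symmetric] loc loc' ..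
    then have "(step (-1) ^^ (j + (N + N'))) (conv X X') = (step (-1) ^^ (j + (N + N'))) (conv W W')"
      by (simp only: funpow_add[of j] o_apply)
    then have "product_sum (conv X X') l = opposite_sum (conv W W') l"
      by (simp only: j product_sum_nat[OF bX(3)] opposite_sum_nat[OF bW(3)])
    then show ?thesis using l by (simp add: D_def N'')
  qed
  \<comment> \<open>For exponents at least M and M' the opposite sums of the factors vanish, so each
    identity reads iterate = product. The exponent M' goes to the second factor and all the rest of
    \<open>m\<close> to the first.\<close>
  have D_m: "D l m n = 0" if m: "m \<ge> int (max (M + M') M'')" for l m n
  proof -
    obtain j where j: "m = int (j + M')" "j \<ge> M"
    proof
      show "m = int (nat (m - int M') + M')" "nat (m - int M') \<ge> M" using m by simp_all
    qed
    have assoc: "(step 1 ^^ j) Z = (\<lambda>l n. product_sum X l (int j) n)"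
      unfolding iterate_sum_nat[OF bZ(1), symmetric] B using j by (simp add: M)
    have assoc': "(step 1 ^^ M') Z' = (\<lambda>l n. product_sum X' l (int M') n)"
      unfolding iterate_sum_nat[OF bZ(2), symmetric] B' by (simp add: M')
    have "(\<lambda>l n. iterate_sum (conv Z Z') l m n) = conv ((step 1 ^^ j) Z) ((step 1 ^^ M') Z')"
      by (simp only: j(1) iterate_sum_nat[OF bZ(3)] conv_funpow_step[OF convolvable_fst[OF bZ(1,2)]])
    also have "\<dots> = (\<lambda>l n. product_sum (conv X X') l m n)"
      unfolding assoc assoc' j(1) of_nat_add
      by (intro ext product_sum_conv bX)
    finally have "iterate_sum (conv Z Z') l m n = product_sum (conv X X') l m n"
      by (rule fun_cong[OF fun_cong])
    then show ?thesis using m by (simp add: D_def M'')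
  qed
  have "D l m n = 0" by (rule borcherds_by_descent[of D, OF rec D_l D_m])
  then show ?thesis by (simp add: D_def)
qed

section \<open>Tensor products of modules\<close>

text \<open>The axioms of a state-field map that mention neither the vacuum nor the Borcherds
  identity, for possibly different spaces. They pass to tensor products and make the sums over modes
  finite.\<close>

definition modes :: "('a::complex_vector \<Rightarrow> int \<Rightarrow> 'b::complex_vector \<Rightarrow> 'c::complex_vector) \<Rightarrow> bool" where
  "modes Y \<longleftrightarrow> (\<forall>n b. clinear (\<lambda>a. Y a n b)) \<and> (\<forall>a n. clinear (Y a n)) \<and>
     (\<forall>a b. \<exists>N. \<forall>n\<ge>N. Y a n b = 0)"

lemma
  assumes "modes Y"
  shows modes_left: "clinear (\<lambda>a. Y a n b)" and modes_right: "clinear (Y a n)"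
    and modes_trunc: "\<exists>N. \<forall>n\<ge>N. Y a n b = 0"
  using assms by (auto simp: modes_def)

lemma modes_0:
  assumes "modes Y"
  shows "Y 0 n b = 0" and "Y a n 0 = 0"
  using clinear_0[OF modes_left[OF assms]] clinear_0[OF modes_right[OF assms]] by auto

lemma bounded_iterate:
  assumes "modes Y" and "modes YM"
  shows "bounded_fst (\<lambda>s t. YM (Y a s b) t w)"
  unfolding bounded_fst_def
proof (intro conjI allI)
  obtain S where "\<And>s. s \<ge> S \<Longrightarrow> Y a s b = 0" using modes_trunc[OF assms(1)] by blast
  then show "\<exists>S. \<forall>s\<ge>S. \<forall>t. YM (Y a s b) t w = 0"
    by (intro exI[of _ S]) (simp add: modes_0[OF assms(2)])
qed (rule modes_trunc[OF assms(2)])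

lemma bounded_product:
  assumes "modes YM"
  shows "bounded_snd (\<lambda>p q. YM a p (YM b q w))"
  unfolding bounded_snd_def
proof (intro conjI allI)
  obtain T where "\<And>t. t \<ge> T \<Longrightarrow> YM b t w = 0" using modes_trunc[OF assms] by blast
  then show "\<exists>T. \<forall>t\<ge>T. \<forall>s. YM a s (YM b t w) = 0"
    by (intro exI[of _ T]) (simp add: modes_0[OF assms])
qed (rule modes_trunc[OF assms])

lemma bounded_opposite:
  assumes "modes YM"
  shows "bounded_fst (\<lambda>p q. YM b q (YM a p w))"
  using bounded_product[OF assms, of b a w] bounded_snd_flip[of "\<lambda>p q. YM b q (YM a p w)"] by simp

text \<open>The vectors are fixed and only the exponents quantified, so that the identity can be
  proved by induction on each of the three vectors.\<close>

definition borcherds_identity ::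
  "('a \<Rightarrow> int \<Rightarrow> 'a \<Rightarrow> 'a) \<Rightarrow> ('a::complex_vector \<Rightarrow> int \<Rightarrow> 'm \<Rightarrow> 'm::complex_vector) \<Rightarrow>
   'a \<Rightarrow> 'a \<Rightarrow> 'm \<Rightarrow> bool" where
  "borcherds_identity Y YM a b w \<longleftrightarrow> (\<forall>l m n.
     (\<Sum>i::nat. (of_int m gchoose i) *\<^sub>C YM (Y a (l + int i) b) (m + n - int i) w) =
     (\<Sum>i::nat. ((-1) ^ i * (of_int l gchoose i)) *\<^sub>C
        (YM a (l + m - int i) (YM b (n + int i) w)
         - ((-1) powi l) *\<^sub>C YM b (l + n - int i) (YM a (m + int i) w))))"

text \<open>Separating the two parts of the difference is legitimate because truncation gives each
  part finite support.\<close>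

lemma borcherds_identity_iff:
  assumes "modes YM"
  shows "borcherds_identity Y YM a b w \<longleftrightarrow> (\<forall>l m n.
    iterate_sum (\<lambda>s t. YM (Y a s b) t w) l m n =
    product_sum (\<lambda>p q. YM a p (YM b q w)) l m n - opposite_sum (\<lambda>p q. YM b q (YM a p w)) l m n)"
proof -
  have "(\<Sum>i::nat. ((-1) ^ i * (of_int l gchoose i)) *\<^sub>C
        (YM a (l + m - int i) (YM b (n + int i) w)
         - ((-1) powi l) *\<^sub>C YM b (l + n - int i) (YM a (m + int i) w))) =
    product_sum (\<lambda>p q. YM a p (YM b q w)) l m n - opposite_sum (\<lambda>p q. YM b q (YM a p w)) l m n"
    for l m n
  proof -
    let ?X = "\<lambda>i. ((-1) ^ i * (of_int l gchoose i)) *\<^sub>C YM a (l + m - int i) (YM b (n + int i) w)"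
    let ?W = "\<lambda>i. ((-1) ^ i * (of_int l gchoose i)) *\<^sub>C YM b (l + n - int i) (YM a (m + int i) w)"
    have finX: "finite {i. ?X i \<noteq> 0}"
      by (rule finite_support_snd(2)[OF bounded_product[OF assms, of a b w]])
    have finW: "finite {i. ?W i \<noteq> 0}"
      by (rule finite_support_fst(2)[OF bounded_opposite[OF assms, of b a w]])
    have finW': "finite {i. ((-1) powi l) *\<^sub>C ?W i \<noteq> 0}"
      by (rule finite_subset[OF _ finW]) auto
    have "(\<Sum>i::nat. ((-1) ^ i * (of_int l gchoose i)) *\<^sub>C
        (YM a (l + m - int i) (YM b (n + int i) w)
         - ((-1) powi l) *\<^sub>C YM b (l + n - int i) (YM a (m + int i) w))) =
      (\<Sum>i. ?X i - ((-1) powi l) *\<^sub>C ?W i)"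
      by (intro Sum_any.cong) (simp add: cvec.scale_right_diff_distrib mult_ac)
    also have "\<dots> = (\<Sum>i. ?X i) - ((-1) powi l) *\<^sub>C (\<Sum>i. ?W i)"
      unfolding Sum_any_diff[OF finX finW'] clinear_Sum_any[OF clinear_scaleC finW] ..
    also have "\<dots> = product_sum (\<lambda>p q. YM a p (YM b q w)) l m n
        - opposite_sum (\<lambda>p q. YM b q (YM a p w)) l m n"
      by (simp add: product_sum_def opposite_sum_def bsum_def mult.commute)
    finally show ?thesis .
  qed
  then show ?thesis
    by (simp add: borcherds_identity_def iterate_sum_def bsum_def)
qed

lemma iterate_sum_add:
  assumes "bounded_fst F" and "bounded_fst G"
  shows "iterate_sum (\<lambda>s t. F s t + G s t) l m n = iterate_sum F l m n + iterate_sum G l m n"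
  unfolding iterate_sum_def
  by (rule bsum_add[OF finite_support_fst(1)[OF assms(1)] finite_support_fst(1)[OF assms(2)]])

lemma product_sum_add:
  assumes "bounded_snd F" and "bounded_snd G"
  shows "product_sum (\<lambda>s t. F s t + G s t) l m n = product_sum F l m n + product_sum G l m n"
  unfolding product_sum_def scaleC_add_right
  by (rule bsum_add[OF finite_support_snd(2)[OF assms(1)] finite_support_snd(2)[OF assms(2)]])

lemma opposite_sum_add:
  assumes "bounded_fst F" and "bounded_fst G"
  shows "opposite_sum (\<lambda>s t. F s t + G s t) l m n = opposite_sum F l m n + opposite_sum G l m n"
  unfolding opposite_sum_def scaleC_add_right
  unfolding bsum_add[OF finite_support_fst(2)[OF assms(1)] finite_support_fst(2)[OF assms(2)]]
  by (rule scaleC_add_right)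

lemma borcherds_identity_add:
  assumes Y: "modes Y" and YM: "modes YM"
  shows "borcherds_identity Y YM a b w \<Longrightarrow> borcherds_identity Y YM a' b w \<Longrightarrow>
      borcherds_identity Y YM (a + a') b w"
    and "borcherds_identity Y YM a b w \<Longrightarrow> borcherds_identity Y YM a b' w \<Longrightarrow>
      borcherds_identity Y YM a (b + b') w"
    and "borcherds_identity Y YM a b w \<Longrightarrow> borcherds_identity Y YM a b w' \<Longrightarrow>
      borcherds_identity Y YM a b (w + w')"
  unfolding borcherds_identity_iff[OF YM]
  by (simp_all add: clinear_add[OF modes_left[OF Y]] clinear_add[OF modes_right[OF Y]]
      clinear_add[OF modes_left[OF YM]] clinear_add[OF modes_right[OF YM]]
      iterate_sum_add product_sum_add opposite_sum_add
      bounded_iterate[OF Y YM] bounded_product[OF YM] bounded_opposite[OF YM])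

lemma borcherds_identity_0:
  assumes Y: "modes Y" and YM: "modes YM"
  shows "borcherds_identity Y YM 0 b w" and "borcherds_identity Y YM a 0 w"
    and "borcherds_identity Y YM a b 0"
  unfolding borcherds_identity_iff[OF YM]
  by (simp_all add: modes_0[OF Y] modes_0[OF YM] iterate_sum_def product_sum_def opposite_sum_def bsum_def)

section \<open>Modes on pure tensors\<close>

lemma poly_mapping_expand: "p = (\<Sum>b\<in>keys p. single b (lookup p b))"
  by (rule poly_mapping_eqI)
    (auto simp: lookup_sum lookup_single when_def in_keys_iff sum.delta)

lemma poly_mapping_add_induct [case_names zero single add]:
  fixes p :: "'b \<Rightarrow>\<^sub>0 'c::comm_monoid_add"
  assumes "P 0" and "\<And>b x. P (single b x)" and "\<And>p q. P p \<Longrightarrow> P q \<Longrightarrow> P (p + q)"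
  shows "P p"
proof -
  have "P (\<Sum>b\<in>A. single b (lookup p b))" for A
    by (induction A rule: infinite_finite_induct) (simp_all add: assms)
  then show ?thesis using poly_mapping_expand[of p] by metis
qed

lemma clinear_lookup_sum:
  fixes g :: "'b \<Rightarrow> 'c::complex_vector \<Rightarrow> 'd::complex_vector"
  assumes g: "\<And>b. clinear (g b)"
  shows "clinear (\<lambda>u. \<Sum>b\<in>keys u. g b (lookup u b))"
proof (rule clinearI)
  fix u v :: "'b \<Rightarrow>\<^sub>0 'c"
  show "(\<Sum>b\<in>keys (u + v). g b (lookup (u + v) b)) =
      (\<Sum>b\<in>keys u. g b (lookup u b))
      + (\<Sum>b\<in>keys v. g b (lookup v b))"
    by (rule setsum_keys_plus_distrib) (simp_all add: clinear_0[OF g] clinear_add[OF g])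
next
  fix a and u :: "'b \<Rightarrow>\<^sub>0 'c"
  have "(\<Sum>b\<in>keys (a *\<^sub>C u). g b (lookup (a *\<^sub>C u) b)) =
      (\<Sum>b\<in>keys u. g b (lookup (a *\<^sub>C u) b))"
    by (rule sum.mono_neutral_left)
      (auto simp: in_keys_iff lookup_scaleC clinear_0[OF g])
  then show "(\<Sum>b\<in>keys (a *\<^sub>C u). g b (lookup (a *\<^sub>C u) b)) =
      a *\<^sub>C (\<Sum>b\<in>keys u. g b (lookup u b))"
    by (simp add: lookup_scaleC clinear_scale[OF g] cvec.scale_sum_right)
qed

lemma pi_ext:
  fixes g g' :: "pi_space \<Rightarrow> 'd::complex_vector"
  assumes "clinear g" and "clinear g'"
    and "\<And>b. g (single b 1) = g' (single b 1)"
  shows "g w = g' w"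
proof (induction w rule: poly_mapping_add_induct)
  case (single b x)
  have "single b x = x *\<^sub>C single b (1 :: complex)"
    by (rule poly_mapping_eqI) (simp add: lookup_scaleC lookup_single when_def scaleC_complex_def)
  then show ?case by (simp add: clinear_scale assms)
qed (simp_all add: assms(1,2) clinear_0 clinear_add)

text \<open>The value of a tensor mode with arbitrary vectors of the lattice factor, whereas
  \<open>tensor_Y\<close> is defined by expansion into basis vectors.\<close>

definition pure_mode ::
  "('a::complex_vector \<Rightarrow> int \<Rightarrow> 'm::complex_vector \<Rightarrow> 'm) \<Rightarrow> (pi_space \<Rightarrow> int \<Rightarrow> pi_space \<Rightarrow> pi_space) \<Rightarrow>
   'a \<Rightarrow> pi_space \<Rightarrow> int \<Rightarrow> 'm \<Rightarrow> pi_space \<Rightarrow> 'm tensor_pi" where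
  "pure_mode YA YB a b n x y = (\<Sum>i. tensor (YA a i x) (YB b (n - 1 - i) y))"

context
  fixes YA :: "'a::complex_vector \<Rightarrow> int \<Rightarrow> 'm::complex_vector \<Rightarrow> 'm"
    and YB :: "pi_space \<Rightarrow> int \<Rightarrow> pi_space \<Rightarrow> pi_space"
  assumes YA: "modes YA" and YB: "modes YB"
begin

lemma pure_mode_support: "finite {i. tensor (YA a i x) (YB b (n - i) y) \<noteq> 0}"
proof -
  obtain N where N: "\<And>i. i \<ge> N \<Longrightarrow> YA a i x = 0" using modes_trunc[OF YA] by blast
  obtain N' where N': "\<And>i. i \<ge> N' \<Longrightarrow> YB b i y = 0" using modes_trunc[OF YB] by blast
  have "{i. tensor (YA a i x) (YB b (n - i) y) \<noteq> 0} \<subseteq> {n - N'..N}"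
  proof
    fix i assume i: "i \<in> {i. tensor (YA a i x) (YB b (n - i) y) \<noteq> 0}"
    then have "i < N" "n - i < N'"
      using N[of i] N'[of "n - i"] by (force intro: ccontr)+
    then show "i \<in> {n - N'..N}" by simp
  qed
  then show ?thesis by (rule finite_subset) simp
qed

lemma clinear_pure_mode_gen:
  assumes g: "\<And>z i. tensor (YA (a z) i (x z)) (YB (b z) (n - 1 - i) (y z)) = h i z"
    and h: "\<And>i. clinear (h i)"
  shows "clinear (\<lambda>z. pure_mode YA YB (a z) (b z) n (x z) (y z))"
proof -
  have fin: "finite {i. h i z \<noteq> 0}" for z
    using pure_mode_support[of "a z" "x z" "b z" "n - 1" "y z"] by (simp add: g)
  show ?thesis
    unfolding pure_mode_def g
    by (rule clinearI) (simp_all add: clinear_add[OF h] clinear_scale[OF h] Sum_any.distrib[OF fin fin]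
        clinear_Sum_any[OF clinear_scaleC fin])
qed

lemma clinear_pure_mode:
  shows "clinear (\<lambda>a. pure_mode YA YB a b n x y)" and "clinear (\<lambda>b. pure_mode YA YB a b n x y)"
    and "clinear (\<lambda>x. pure_mode YA YB a b n x y)" and "clinear (\<lambda>y. pure_mode YA YB a b n x y)"
  by (rule clinear_pure_mode_gen[OF refl], rule clinear_comp[OF clinear_tensor_left] clinear_comp[OF clinear_tensor_right],
      rule modes_left[OF YA] modes_left[OF YB] modes_right[OF YA] modes_right[OF YB])+

lemma tensor_Y_eq:
  "tensor_Y YA YB u n w = (\<Sum>b\<in>keys u. \<Sum>b'\<in>keys w.
     pure_mode YA YB (lookup u b) (single b 1) n
       (lookup w b') (single b' 1))"
  by (simp add: tensor_Y_def pure_mode_def)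

lemma clinear_tensor_Y_left: "clinear (\<lambda>u. tensor_Y YA YB u n w)"
  unfolding tensor_Y_eq
  by (intro clinear_lookup_sum clinear_sum_fun clinear_pure_mode)

lemma clinear_tensor_Y_right: "clinear (tensor_Y YA YB u n)"
proof -
  have "tensor_Y YA YB u n = (\<lambda>w. \<Sum>b'\<in>keys w. \<Sum>b\<in>keys u.
     pure_mode YA YB (lookup u b) (single b 1) n
       (lookup w b') (single b' 1))"
    unfolding tensor_Y_eq by (intro ext sum.swap)
  then show ?thesis
    by (simp only:) (intro clinear_lookup_sum clinear_sum_fun clinear_pure_mode)
qed

lemma tensor_Y_pure: "tensor_Y YA YB (tensor a b) n (tensor x y) = pure_mode YA YB a b n x y"
proof (rule pi_ext[where w = b])
  show "clinear (\<lambda>b. tensor_Y YA YB (tensor a b) n (tensor x y))"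
    by (rule clinear_comp[OF clinear_tensor_Y_left clinear_tensor_right])
  show "clinear (\<lambda>b. pure_mode YA YB a b n x y)" by (rule clinear_pure_mode)
  fix \<beta>
  show "tensor_Y YA YB (tensor a (single \<beta> 1)) n (tensor x y) =
      pure_mode YA YB a (single \<beta> 1) n x y"
  proof (rule pi_ext[where w = y])
    show "clinear (\<lambda>y. tensor_Y YA YB (tensor a (single \<beta> 1)) n (tensor x y))"
      by (rule clinear_comp[OF clinear_tensor_Y_right clinear_tensor_right])
    show "clinear (\<lambda>y. pure_mode YA YB a (single \<beta> 1) n x y)" by (rule clinear_pure_mode)
    fix \<gamma>
    show "tensor_Y YA YB (tensor a (single \<beta> 1)) n (tensor x (single \<gamma> 1)) =
        pure_mode YA YB a (single \<beta> 1) n x (single \<gamma> 1)"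
      \<comment> \<open>A zero first factor leaves a family with empty support, where both sides
        vanish; otherwise the support is a single index.\<close>
      by (cases "a = 0"; cases "x = 0")
        (simp_all add: tensor_single scaleC_one tensor_Y_eq clinear_0[OF clinear_pure_mode(1)]
          clinear_0[OF clinear_pure_mode(3)])
  qed
qed

lemma tensor_Y_truncation: "\<exists>N. \<forall>n\<ge>N. tensor_Y YA YB u n w = 0"
proof (induction u rule: poly_mapping_add_induct)
  case zero
  then show ?case by (simp add: clinear_0[OF clinear_tensor_Y_left])
next
  case (add u u')
  then obtain N N' where "\<forall>n\<ge>N. tensor_Y YA YB u n w = 0" "\<forall>n\<ge>N'. tensor_Y YA YB u' n w = 0"
    by blast
  then show ?case
    by (intro exI[of _ "max N N'"]) (simp add: clinear_add[OF clinear_tensor_Y_left])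
next
  case (single b a)
  show ?case
  proof (induction w rule: poly_mapping_add_induct)
    case zero
    then show ?case by (simp add: clinear_0[OF clinear_tensor_Y_right])
  next
    case (add w w')
    then obtain N N' where "\<forall>n\<ge>N. tensor_Y YA YB (single b a) n w = 0"
        "\<forall>n\<ge>N'. tensor_Y YA YB (single b a) n w' = 0"
      by blast
    then show ?case
      by (intro exI[of _ "max N N'"]) (simp add: clinear_add[OF clinear_tensor_Y_right])
  next
    case (single b' x)
    let ?y = "single b (1 :: complex)" and ?y' = "single b' (1 :: complex)"
    obtain N where N: "\<And>i. i \<ge> N \<Longrightarrow> YA a i x = 0" using modes_trunc[OF YA] by blast
    obtain N' where N': "\<And>i. i \<ge> N' \<Longrightarrow> YB ?y i ?y' = 0" using modes_trunc[OF YB] by blast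
    have "pure_mode YA YB a ?y n x ?y' = 0" if "n \<ge> N + N' + 1" for n
    proof -
      have "tensor (YA a i x) (YB ?y (n - 1 - i) ?y') = 0" for i
        by (cases "i \<ge> N") (use that in \<open>simp_all add: N N'\<close>)
      then show ?thesis by (simp add: pure_mode_def)
    qed
    then show ?case
      using tensor_Y_pure[of a ?y _ x ?y'] by (auto simp: tensor_single)
  qed
qed

lemma modes_tensor_Y: "modes (tensor_Y YA YB)"
  by (simp add: modes_def clinear_tensor_Y_left clinear_tensor_Y_right tensor_Y_truncation)

end

lemma (in vertex_algebra) modes_Y: "modes Y"
  by (simp add: modes_def linear_left linear_right truncation)

lemma (in va_module) modes_YM: "modes YM"
  by (simp add: modes_def mod_linear_left mod_linear_right mod_truncation)

lemma (in va_module) borcherds_identity_YM: "borcherds_identity Y YM a b w"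
  unfolding borcherds_identity_def using mod_borcherds by blast

text \<open>By additivity in each of the three vectors it suffices to treat families supported at
  one index, which are pure tensors. There the arrays of iterated modes are convolutions of the
  arrays of the two factors.\<close>

lemma tensor_borcherds:
  fixes vacA :: "'a::complex_vector" and YM :: "'a \<Rightarrow> int \<Rightarrow> 'm::complex_vector \<Rightarrow> 'm"
  assumes A: "va_module vacA YA YM" and B: "va_module vacB YB YW"
  shows "borcherds_identity (tensor_Y YA YB) (tensor_Y YM YW) u u' w"
proof -
  have YA: "modes YA" and YM: "modes YM" and YB: "modes YB" and YW: "modes YW"
    using vertex_algebra.modes_Y[OF va_module.axioms(1)[OF A]] va_module.modes_YM[OF A]
      vertex_algebra.modes_Y[OF va_module.axioms(1)[OF B]] va_module.modes_YM[OF B] by blast+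
  note T = modes_tensor_Y[OF YA YB] and TM = modes_tensor_Y[OF YM YW]
  have pure: "borcherds_identity (tensor_Y YA YB) (tensor_Y YM YW) (tensor a b) (tensor a' b') (tensor x y)"
    for a b a' b' x y
  proof -
    have iter: "tensor_Y YM YW (tensor_Y YA YB (tensor a b) s (tensor a' b')) t (tensor x y) =
        conv (\<lambda>s t. YM (YA a s a') t x) (\<lambda>s t. YW (YB b s b') t y) s t" for s t
    proof -
      let ?f = "\<lambda>i j. tensor (YM (YA a i a') j x) (YW (YB b (s - 1 - i) b') (t - 1 - j) y)"
      have "tensor_Y YM YW (tensor_Y YA YB (tensor a b) s (tensor a' b')) t (tensor x y) =
          (\<Sum>i. tensor_Y YM YW (tensor (YA a i a') (YB b (s - 1 - i) b')) t (tensor x y))"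
        unfolding tensor_Y_pure[OF YA YB] pure_mode_def
        by (rule clinear_Sum_any[OF clinear_tensor_Y_left[OF YM YW] pure_mode_support[OF YA YB]])
      also have "\<dots> = (\<Sum>i. \<Sum>j. ?f i j)"
        unfolding tensor_Y_pure[OF YM YW] pure_mode_def ..
      also have "\<dots> = (\<Sum>(i, j). ?f i j)"
      proof (rule Sum_any_prod)
        have "finite {(i, j). YM (YA a (i + 0) a') (j + 0) x \<noteq> 0 \<and>
              YW (YB b (s - 1 - i) b') (t - 1 - j) y \<noteq> 0}"
          by (rule convolvable_finite[OF convolvable_fst[OF bounded_iterate[OF YA YM] bounded_iterate[OF YB YW]]])
        then show "finite {(i, j). ?f i j \<noteq> 0}" by (rule rev_finite_subset) auto
      qed
      finally show ?thesis by (simp add: conv_def)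
    qed
    have comp: "tensor_Y YM YW (tensor c d) s (tensor_Y YM YW (tensor c' d') t (tensor x y)) =
        conv (\<lambda>s t. YM c s (YM c' t x)) (\<lambda>s t. YW d s (YW d' t y)) s t" for c d c' d' s t
    proof -
      let ?f = "\<lambda>j i. tensor (YM c i (YM c' j x)) (YW d (s - 1 - i) (YW d' (t - 1 - j) y))"
      have fin0: "finite {(i, j). YM c (i + 0) (YM c' (j + 0) x) \<noteq> 0 \<and>
            YW d (s - 1 - i) (YW d' (t - 1 - j) y) \<noteq> 0}"
        by (rule convolvable_finite[OF convolvable_snd[OF bounded_product[OF YM] bounded_product[OF YW]]])
      then have "finite (prod.swap ` {(i, j). YM c (i + 0) (YM c' (j + 0) x) \<noteq> 0 \<and>
            YW d (s - 1 - i) (YW d' (t - 1 - j) y) \<noteq> 0})"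
        by (rule finite_imageI)
      then have fin: "finite {(j, i). ?f j i \<noteq> 0}"
        by (rule rev_finite_subset) (auto simp: image_iff)
      have "tensor_Y YM YW (tensor c d) s (tensor_Y YM YW (tensor c' d') t (tensor x y)) =
          (\<Sum>j. tensor_Y YM YW (tensor c d) s (tensor (YM c' j x) (YW d' (t - 1 - j) y)))"
        unfolding tensor_Y_pure[OF YM YW, of c' d'] pure_mode_def
        by (rule clinear_Sum_any[OF clinear_tensor_Y_right[OF YM YW] pure_mode_support[OF YM YW]])
      also have "\<dots> = (\<Sum>j. \<Sum>i. ?f j i)"
        unfolding tensor_Y_pure[OF YM YW] pure_mode_def ..
      also have "\<dots> = (\<Sum>i. \<Sum>j. ?f j i)"
        by (rule Sum_any_swap[OF fin])
      also have "\<dots> = (\<Sum>(i, j). ?f j i)"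
        by (rule Sum_any_prod, rule finite_subset[OF _ fin0]) auto
      finally show ?thesis by (simp add: conv_def)
    qed
    show ?thesis
      unfolding borcherds_identity_iff[OF TM]
    proof (intro allI)
      fix l m n
      have BA: "borcherds_identity YA YM a a' x" and BB: "borcherds_identity YB YW b b' y"
        using A B by (simp_all add: va_module.borcherds_identity_YM)
      show "iterate_sum (\<lambda>s t. tensor_Y YM YW (tensor_Y YA YB (tensor a b) s (tensor a' b')) t (tensor x y)) l m n =
          product_sum (\<lambda>p q. tensor_Y YM YW (tensor a b) p (tensor_Y YM YW (tensor a' b') q (tensor x y))) l m n
          - opposite_sum (\<lambda>p q. tensor_Y YM YW (tensor a' b') q (tensor_Y YM YW (tensor a b) p (tensor x y))) l m n"
      proof -
        \<comment> \<open>The first index belongs to the operator that acts first, so the composite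
          formula is used with its pair of summation indices swapped.\<close>
        have opp: "tensor_Y YM YW (tensor a' b') q (tensor_Y YM YW (tensor a b) p (tensor x y)) =
            conv (\<lambda>s t. YM a' t (YM a s x)) (\<lambda>s t. YW b' t (YW b s y)) p q" for p q
        proof -
          have "bij (prod.swap :: int \<times> int \<Rightarrow> int \<times> int)" by (rule bij_swap)
          from Sum_any_bij[OF this, of "\<lambda>(i, j). tensor (YM a' j (YM a i x))
              (YW b' (q - 1 - j) (YW b (p - 1 - i) y))"]
          show ?thesis by (simp add: comp conv_def case_prod_unfold)
        qed
        \<comment> \<open>Boundedness of the convolutions is read off from the truncation of the
          tensor modes whose arrays they are.\<close>
        have b1: "bounded_fst (conv (\<lambda>s t. YM (YA a s a') t x) (\<lambda>s t. YW (YB b s b') t y))"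
          using bounded_iterate[OF T TM, of "tensor a b" "tensor a' b'" "tensor x y"] by (simp add: iter)
        have b2: "bounded_snd (conv (\<lambda>s t. YM a s (YM a' t x)) (\<lambda>s t. YW b s (YW b' t y)))"
          using bounded_product[OF TM, of "tensor a b" "tensor a' b'" "tensor x y"] by (simp add: comp)
        have b3: "bounded_fst (conv (\<lambda>s t. YM a' t (YM a s x)) (\<lambda>s t. YW b' t (YW b s y)))"
          using bounded_opposite[OF TM, of "tensor a' b'" "tensor a b" "tensor x y"] by (simp add: opp)
        note BA' = BA[unfolded borcherds_identity_iff[OF YM], rule_format]
          and BB' = BB[unfolded borcherds_identity_iff[OF YW], rule_format]
        show ?thesis
          unfolding iter opp
          unfolding comp
          by (rule conv_borcherds[OF _ _ b1 _ _ b2 _ _ b3 BA' BB'])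
            (rule bounded_iterate bounded_product bounded_opposite YA YM YB YW)+
      qed
    qed
  qed
  show ?thesis
  proof (induction u rule: poly_mapping_add_induct)
    case zero
    show ?case by (rule borcherds_identity_0[OF T TM])
  next
    case (single b a)
    show ?case
    proof (induction u' rule: poly_mapping_add_induct)
      case zero
      show ?case by (rule borcherds_identity_0[OF T TM])
    next
      case (single b' a')
      show ?case
      proof (induction w rule: poly_mapping_add_induct)
        case zero
        show ?case by (rule borcherds_identity_0[OF T TM])
      next
        case (single b'' x)
        then show ?case
          using pure[of a "single b 1" a' "single b' 1" x "single b'' 1"]
          by (simp add: tensor_single)
      qed (rule borcherds_identity_add[OF T TM])
    qed (rule borcherds_identity_add[OF T TM])
  qed (rule borcherds_identity_add[OF T TM])
qed

text \<open>\<open>Phi\<close> turns modes of \<open>YV\<close> into tensor modes of the images, so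
  the Borcherds identity is pulled back along it. The vacuum goes to the tensor product of the
  vacua, which acts as the identity.\<close>

lemma tensor_module:
  fixes vacV :: "'v::complex_vector" and vacA :: "'a::complex_vector"
    and YM :: "'a \<Rightarrow> int \<Rightarrow> 'm::complex_vector \<Rightarrow> 'm"
  assumes V: "vertex_algebra vacV YV"
    and A: "va_module vacA YA YM" and B: "va_module vacB YB YW"
    and hom: "va_hom vacV YV (tensor vacA vacB) (tensor_Y YA YB) Phi"
  shows "va_module vacV YV (\<lambda>a. tensor_Y YM YW (Phi a))"
proof -
  interpret vertex_algebra vacV YV by (rule V)
  have YM: "modes YM" and YW: "modes YW"
    using va_module.modes_YM[OF A] va_module.modes_YM[OF B] by blast+
  note TM = modes_tensor_Y[OF YM YW]
  have Phi: "clinear Phi" "Phi vacV = tensor vacA vacB" "\<And>a n b. Phi (YV a n b) = tensor_Y YA YB (Phi a) n (Phi b)"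
    using hom by (simp_all add: va_hom_def)
  show ?thesis
    unfolding va_module_def va_module_axioms_def
  proof (intro conjI allI V)
    fix n w
    show "clinear (\<lambda>a. tensor_Y YM YW (Phi a) n w)"
      by (rule clinear_comp[OF modes_left[OF TM] Phi(1)])
  next
    fix a n show "clinear (tensor_Y YM YW (Phi a) n)" by (rule modes_right[OF TM])
  next
    fix a w show "\<exists>N. \<forall>n\<ge>N. tensor_Y YM YW (Phi a) n w = 0" by (rule modes_trunc[OF TM])
  next
    fix n w
    show "tensor_Y YM YW (Phi vacV) n w = (if n = - 1 then w else 0)"
    proof (induction w rule: poly_mapping_add_induct)
      case (single b x)
      have "tensor_Y YM YW (Phi vacV) n (tensor x (single b 1)) =
          (\<Sum>i::int. if i = -1 then if n = -1 then single b x else 0 else 0)"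
        unfolding Phi(2) tensor_Y_pure[OF YM YW] pure_mode_def
        by (intro Sum_any.cong)
          (simp add: va_module.mod_vacuum[OF A] va_module.mod_vacuum[OF B] tensor_single)
      then show ?case by (simp add: tensor_single)
    qed (simp_all add: modes_0[OF TM] clinear_add[OF modes_right[OF TM]])
  next
    fix m l n a b w
    show "(\<Sum>i. (of_int m gchoose i) *\<^sub>C tensor_Y YM YW (Phi (YV a (l + int i) b)) (m + n - int i) w) =
       (\<Sum>i. ((- 1) ^ i * (of_int l gchoose i)) *\<^sub>C
         (tensor_Y YM YW (Phi a) (l + m - int i) (tensor_Y YM YW (Phi b) (n + int i) w) -
          (- 1) powi l *\<^sub>C tensor_Y YM YW (Phi b) (l + n - int i) (tensor_Y YM YW (Phi a) (m + int i) w)))"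
      using tensor_borcherds[OF A B, of "Phi a" "Phi b" w]
      unfolding borcherds_identity_def Phi(3) by blast
  qed
qed

section \<open>Consequences of the Borcherds identity\<close>

context va_module
begin

text \<open>The Borcherds identity at l = 0, where the binomials of 0 leave only the term i = 0 on
  the right.\<close>

lemma commutator:
  "YM a m (YM b n w) - YM b n (YM a m w) = bsum (of_int m) (\<lambda>i. YM (Y a (int i) b) (m + n - int i) w)"
proof -
  have "(\<Sum>i::nat. ((-1) ^ i * (of_int 0 gchoose i)) *\<^sub>C
          (YM a (0 + m - int i) (YM b (n + int i) w)
           - ((-1) powi 0) *\<^sub>C YM b (0 + n - int i) (YM a (m + int i) w))) =
      (\<Sum>i::nat. if i = 0 then YM a m (YM b n w) - YM b n (YM a m w) else 0)"
  proof (intro Sum_any.cong)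
    fix i :: nat
    show "((-1) ^ i * (of_int 0 gchoose i)) *\<^sub>C
          (YM a (0 + m - int i) (YM b (n + int i) w)
           - ((-1) powi 0) *\<^sub>C YM b (0 + n - int i) (YM a (m + int i) w)) =
      (if i = 0 then YM a m (YM b n w) - YM b n (YM a m w) else 0)"
      by (cases i) simp_all
  qed
  then show ?thesis
    using mod_borcherds[of m a 0 b n w] by (simp add: bsum_def)
qed

lemma commutator_0: "YM a 0 (YM b n w) - YM b n (YM a 0 w) = YM (Y a 0 b) n w"
  using commutator[of a 0 b n w] by (simp add: bsum_0)

text \<open>The Borcherds identity at m = 0, where only the term i = 0 remains on the left.\<close>

lemma iterate:
  "YM (Y a l b) n w = (\<Sum>i::nat. ((-1) ^ i * (of_int l gchoose i)) *\<^sub>C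
     (YM a (l - int i) (YM b (n + int i) w) - ((-1) powi l) *\<^sub>C YM b (l + n - int i) (YM a (int i) w)))"
  using mod_borcherds[of 0 a l b n w] bsum_0[of "\<lambda>i. YM (Y a (l + int i) b) (n - int i) w"]
  by (simp add: bsum_def)

text \<open>At l = -1 all coefficients (-1)^i (-1 gchoose i) equal 1, and the minus sign in front of
  the opposite terms becomes a plus.\<close>

lemma normal_product:
  "YM (Y a (-1) b) n w = (\<Sum>i::nat. YM a (-1 - int i) (YM b (n + int i) w) + YM b (n - 1 - int i) (YM a (int i) w))"
proof -
  have "(-1) ^ i * (-1 gchoose i) = (1 :: complex)" for i
    by (subst gbinomial_minus) (simp add: binomial_gbinomial[symmetric])
  then show ?thesis
    unfolding iterate by (simp add: algebra_simps)
qed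

text \<open>Four terms suffice in both applications: for currents acting on currents, where modes
  above 1 vanish, and on the top component, where positive modes vanish.\<close>

lemma normal_product_2:
  assumes "\<And>i. i \<ge> 2 \<Longrightarrow> YM b (n + i) w = 0" and "\<And>i. i \<ge> 2 \<Longrightarrow> YM a i w = 0"
  shows "YM (Y a (-1) b) n w = YM a (-1) (YM b n w) + YM a (-2) (YM b (n + 1) w)
    + YM b (n - 1) (YM a 0 w) + YM b (n - 2) (YM a 1 w)"
proof -
  have "YM (Y a (-1) b) n w =
      (\<Sum>i\<in>{0, 1}. YM a (-1 - int i) (YM b (n + int i) w) + YM b (n - 1 - int i) (YM a (int i) w))"
    unfolding normal_product
  proof (rule Sum_any.expand_superset)
    show "{i. YM a (-1 - int i) (YM b (n + int i) w) + YM b (n - 1 - int i) (YM a (int i) w) \<noteq> 0} \<subseteq> {0, 1}"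
    proof
      fix i assume i: "i \<in> {i. YM a (-1 - int i) (YM b (n + int i) w) + YM b (n - 1 - int i) (YM a (int i) w) \<noteq> 0}"
      have "\<not> i \<ge> 2"
        using i assms[of "int i"] by (auto simp: clinear_0[OF mod_linear_right])
      then show "i \<in> {0, 1}" by auto
    qed
  qed simp
  then show ?thesis by (simp add: algebra_simps)
qed

text \<open>With T a = a_(-2)1, this is the coefficient form of Y(T a, z) = d/dz Y(a, z), obtained
  from \<open>iterate\<close> at l = -2 with the vacuum as second vector.\<close>

lemma translation: "YM (Y a (-2) vac) n w = (- of_int n) *\<^sub>C YM a (n - 1) w"
proof -
  have coeff: "(-1) ^ i * (-2 gchoose i) = (of_nat (Suc i) :: complex)" for i
    by (subst gbinomial_minus) (simp add: binomial_gbinomial[symmetric] flip: of_nat_Suc)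
  have "YM (Y a (-2) vac) n w = (\<Sum>i::nat. of_nat (Suc i) *\<^sub>C
     ((if n + int i = - 1 then YM a (-2 - int i) w else 0) - (if n - int i = 1 then YM a (int i) w else 0)))"
    unfolding iterate
    by (intro Sum_any.cong)
      (simp add: coeff mod_vacuum clinear_0[OF mod_linear_right] flip: of_nat_Suc
        if_distrib[of "YM a _"] cong: if_cong)
  \<comment> \<open>The first part contributes only for n < 0, at i = -1 - n; the second only for n
    > 0, at i = n - 1. For n = 0 neither contributes, and the factor n makes the chosen value
    zero.\<close>
  also have "\<dots> = (\<Sum>i::nat. if i = nat (if n < 0 then - 1 - n else n - 1) then (- of_int n) *\<^sub>C YM a (n - 1) w else 0)"
  proof (intro Sum_any.cong)
    fix i :: nat
    show "of_nat (Suc i) *\<^sub>C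
     ((if n + int i = - 1 then YM a (-2 - int i) w else 0) - (if n - int i = 1 then YM a (int i) w else 0)) =
     (if i = nat (if n < 0 then - 1 - n else n - 1) then (- of_int n) *\<^sub>C YM a (n - 1) w else 0)"
    proof (cases "n + int i = -1")
      case True
      then have n: "n = - 1 - int i" by simp
      show ?thesis by (simp add: n)
    next
      case F: False
      show ?thesis
      proof (cases "n - int i = 1")
        case True
        then have n: "n = 1 + int i" by simp
        show ?thesis by (simp add: n scaleC_add_left cvec.scale_left_diff_distrib)
      next
        case False
        then have "i = nat (if n < 0 then - 1 - n else n - 1) \<Longrightarrow> n = 0" using F by (auto split: if_splits)
        then show ?thesis using F False by auto
      qed
    qed
  qed
  finally show ?thesis by simp
qed

end

section \<open>Translation and conformal weights\<close>

lemma (in vertex_algebra) va_module_self: "va_module vac Y Y"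
  unfolding va_module_def va_module_axioms_def
  by (intro conjI allI) (rule vertex_algebra_axioms linear_left linear_right truncation vacuum_left borcherds)+

text \<open>Apply \<open>iterate\<close> to the vacuum: creation kills the opposite terms and leaves
  b_(-2)1 at i = 0 and b_(-1)1 = b at i = 1. This is T(a_n b) = a_n T b - n a_(n-1) b.\<close>

lemma (in vertex_algebra) translation_mode:
  "Y (Y a n b) (-2) vac = Y a n (Y b (-2) vac) - of_int n *\<^sub>C Y a (n - 1) b"
proof -
  interpret M: va_module vac Y Y by (rule va_module_self)
  have 0: "Y c m 0 = 0" for c m by (rule clinear_0[OF linear_right])
  let ?f = "\<lambda>i::nat. ((-1) ^ i * (of_int n gchoose i)) *\<^sub>C
     (Y a (n - int i) (Y b (-2 + int i) vac) - ((-1) powi n) *\<^sub>C Y b (n + (-2) - int i) (Y a (int i) vac))"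
  have "Y (Y a n b) (-2) vac = (\<Sum>i. ?f i)" by (rule M.iterate)
  also have "\<dots> = (\<Sum>i\<in>{0, 1}. ?f i)"
  proof (rule Sum_any.expand_superset)
    show "{i. ?f i \<noteq> 0} \<subseteq> {0, 1}"
    proof
      fix i assume i: "i \<in> {i. ?f i \<noteq> 0}"
      have "?f i = 0" if "i \<ge> 2"
      proof -
        have "Y b (-2 + int i) vac = 0" "Y a (int i) vac = 0"
          by (rule creation_nonneg, use that in simp)+
        then show ?thesis by (simp only: 0 cvec.scale_zero_right diff_self)
      qed
      with i have "\<not> i \<ge> 2" by blast
      then show "i \<in> {0, 1}" by auto
    qed
  qed simp
  also have "\<dots> = ?f 0 + ?f 1" by simp
  also have "?f 0 = Y a n (Y b (-2) vac)"
    by (simp add: creation_nonneg 0)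
  also have "?f 1 = - (of_int n *\<^sub>C Y a (n - 1) b)"
    by (simp add: creation_nonneg creation 0)
  finally show ?thesis by simp
qed

text \<open>Both om_0 and T act as derivations on the product x_n w, so their agreement on the two
  factors passes to the product.\<close>

lemma (in vertex_algebra) translation_closed:
  assumes "Y om 0 x = Y x (-2) vac" and "Y om 0 w = Y w (-2) vac"
  shows "Y om 0 (Y x n w) = Y (Y x n w) (-2) vac"
proof -
  interpret M: va_module vac Y Y by (rule va_module_self)
  have "Y om 0 (Y x n w) = Y x n (Y w (-2) vac) + Y (Y x (-2) vac) n w"
    using M.commutator_0[of om x n w] unfolding assms by (metis add.commute diff_eq_eq)
  also have "\<dots> = Y (Y x n w) (-2) vac"
    using translation_mode[of x n w] M.translation[of x n w] by simp
  finally show ?thesis .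
qed

text \<open>The binomials of 1 vanish beyond i = 1, so the commutator involves only om_0 a and om_1
  a. The former is T a by hypothesis, and its mode m + 1 is -(m + 1) a_m.\<close>

lemma (in va_module) conformal_commutator:
  assumes "Y om 0 a = Y a (-2) vac"
  shows "YM om 1 (YM a m w) = YM a m (YM om 1 w) + YM (Y om 1 a) m w - (of_int m + 1) *\<^sub>C YM a m w"
proof -
  let ?f = "\<lambda>i. (1 gchoose i :: complex) *\<^sub>C YM (Y om (int i) a) (1 + m - int i) w"
  have "bsum 1 (\<lambda>i. YM (Y om (int i) a) (1 + m - int i) w) = (\<Sum>i\<in>{0, 1}. ?f i)"
    unfolding bsum_def
  proof (rule Sum_any.expand_superset)
    show "{i. ?f i \<noteq> 0} \<subseteq> {0, 1}"
    proof
      fix i assume i: "i \<in> {i. ?f i \<noteq> 0}"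
      have "(1 gchoose i :: complex) = of_nat (1 choose i)" by (simp add: binomial_gbinomial)
      then have "\<not> i \<ge> 2" using i by (auto simp: binomial_eq_0)
      then show "i \<in> {0, 1}" by auto
    qed
  qed simp
  also have "\<dots> = YM (Y om 1 a) m w - (of_int m + 1) *\<^sub>C YM a m w"
    by (simp add: assms translation scaleC_add_left cvec.scale_left_diff_distrib)
  finally show ?thesis
    using commutator[of om 1 a m w] by (simp add: algebra_simps)
qed

lemma (in va_module) eigenspace_mode:
  assumes "Y om 0 a = Y a (-2) vac" and "a \<in> eigenspace (Y om 1) x" and "w \<in> eigenspace (YM om 1) y"
  shows "YM a m w \<in> eigenspace (YM om 1) (y + x - of_int m - 1)"
  using assms
  by (simp add: eigenspace_def conformal_commutator clinear_scale[OF mod_linear_right]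
      clinear_scale[OF mod_linear_left] scaleC_add_left cvec.scale_left_diff_distrib algebra_simps)

section \<open>The Sugawara vector\<close>

locale affine_sl2 = vertex_algebra vac Y
  for vac :: "'a::complex_vector" and Y +
  fixes k e h f
  assumes rel: "affine_sl2_relations k (Y e) (Y h) (Y f)"
    and gen: "\<And>S. cvec.subspace S \<Longrightarrow> vac \<in> S \<Longrightarrow>
      (\<And>n w. w \<in> S \<Longrightarrow> Y e n w \<in> S \<and> Y h n w \<in> S \<and> Y f n w \<in> S) \<Longrightarrow> S = UNIV"
    and level: "k + 2 \<noteq> 0"
begin

lemma level_cancel: "(1 / (2 * (k + 2))) * (2 * (k + 2)) = 1"
proof -
  have "1 / (2 * q) * (2 * q) = 1" if "q \<noteq> 0" for q :: complex using that by simp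
  then show ?thesis using level by blast
qed

lemma relations:
  shows "Y e m (Y e n w) = Y e n (Y e m w)"
    and "Y f m (Y f n w) = Y f n (Y f m w)"
    and "Y h m (Y e n w) = Y e n (Y h m w) + 2 *\<^sub>C Y e (m + n) w"
    and "Y h m (Y f n w) = Y f n (Y h m w) - 2 *\<^sub>C Y f (m + n) w"
    and "Y h m (Y h n w) = Y h n (Y h m w) + (if m + n = 0 then 2 * of_int m * k else 0) *\<^sub>C w"
    and "Y e m (Y f n w) = Y f n (Y e m w) + Y h (m + n) w + (if m + n = 0 then of_int m * k else 0) *\<^sub>C w"
proof -
  have R: "Y e m (Y e n w) - Y e n (Y e m w) = 0"
    "Y f m (Y f n w) - Y f n (Y f m w) = 0"
    "Y h m (Y e n w) - Y e n (Y h m w) = 2 *\<^sub>C Y e (m + n) w"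
    "Y h m (Y f n w) - Y f n (Y h m w) = (- 2) *\<^sub>C Y f (m + n) w"
    "Y h m (Y h n w) - Y h n (Y h m w) = (if m + n = 0 then 2 * of_int m * k else 0) *\<^sub>C w"
    "Y e m (Y f n w) - Y f n (Y e m w) = Y h (m + n) w + (if m + n = 0 then of_int m * k else 0) *\<^sub>C w"
    using rel unfolding affine_sl2_relations_def by blast+
  show "Y e m (Y e n w) = Y e n (Y e m w)" using R(1) by simp
  show "Y f m (Y f n w) = Y f n (Y f m w)" using R(2) by simp
  show "Y h m (Y e n w) = Y e n (Y h m w) + 2 *\<^sub>C Y e (m + n) w"
    using R(3) by (simp only: diff_eq_eq add.commute)
  show "Y h m (Y f n w) = Y f n (Y h m w) - 2 *\<^sub>C Y f (m + n) w"
    using R(4) by (simp only: diff_eq_eq cvec.scale_minus_left) simp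
  show "Y h m (Y h n w) = Y h n (Y h m w) + (if m + n = 0 then 2 * of_int m * k else 0) *\<^sub>C w"
    using R(5) by (simp only: diff_eq_eq add.commute)
  show "Y e m (Y f n w) = Y f n (Y e m w) + Y h (m + n) w + (if m + n = 0 then of_int m * k else 0) *\<^sub>C w"
    using R(6) by (simp only: diff_eq_eq ac_simps)
qed

lemma generator_products:
  assumes "m \<ge> 0"
  shows "Y e m e = 0" and "Y f m f = 0"
    and "Y h m e = (if m = 0 then 2 *\<^sub>C e else 0)"
    and "Y h m f = (if m = 0 then (-2) *\<^sub>C f else 0)"
    and "Y h m h = (if m = 1 then (2 * k) *\<^sub>C vac else 0)"
    and "Y e m f = (if m = 0 then h else if m = 1 then k *\<^sub>C vac else 0)"
    and "Y f m e = (if m = 0 then - h else if m = 1 then k *\<^sub>C vac else 0)"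
    and "Y e m h = (if m = 0 then (-2) *\<^sub>C e else 0)"
    and "Y f m h = (if m = 0 then 2 *\<^sub>C f else 0)"
proof -
  have 0: "Y a n 0 = 0" for a n by (rule clinear_0[OF linear_right])
  note c = creation creation_nonneg[OF assms] 0
  have nn: "Y a (m - 1) vac = (if m = 0 then a else 0)" for a
    using assms by (cases "m = 0") (auto simp: creation creation_nonneg)
  have nn': "Y a (-1 + m) vac = (if m = 0 then a else 0)" for a
    using nn[of a] by (simp add: add.commute)
  show "Y e m e = 0" using relations(1)[of m "-1" vac] by (simp add: c)
  show "Y f m f = 0" using relations(2)[of m "-1" vac] by (simp add: c)
  show "Y h m e = (if m = 0 then 2 *\<^sub>C e else 0)"
    using relations(3)[of m "-1" vac] by (simp add: c nn)
  show "Y h m f = (if m = 0 then (-2) *\<^sub>C f else 0)"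
    using relations(4)[of m "-1" vac] by (simp add: c nn)
  show "Y h m h = (if m = 1 then (2 * k) *\<^sub>C vac else 0)"
    using relations(5)[of m "-1" vac] by (simp add: c)
  have "Y e m f = (if m = 0 then h else 0) + (if m = 1 then k else 0) *\<^sub>C vac"
    using relations(6)[of m "-1" vac] by (simp add: c nn cong: if_cong)
  then show "Y e m f = (if m = 0 then h else if m = 1 then k *\<^sub>C vac else 0)"
    by (cases "m = 0"; cases "m = 1") simp_all
  \<comment> \<open>Here the modes -1 and m are exchanged. The left-hand side e_(-1) f_m 1 vanishes
    since m \<ge> 0, which yields the product in the opposite order.\<close>
  have "0 = Y f m e + (if m = 0 then h else 0) + (if -1 + m = 0 then of_int (-1) * k else 0) *\<^sub>C vac"
    using relations(6)[of "-1" m vac] by (simp only: c nn')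
  then show "Y f m e = (if m = 0 then - h else if m = 1 then k *\<^sub>C vac else 0)"
    by (cases "m = 0"; cases "m = 1") (simp_all add: eq_neg_iff_add_eq_0)
  have "0 = Y e m h + 2 *\<^sub>C (if m = 0 then e else 0)"
    using relations(3)[of "-1" m vac] by (simp only: c nn')
  then show "Y e m h = (if m = 0 then (-2) *\<^sub>C e else 0)"
    by (cases "m = 0") (simp_all add: eq_neg_iff_add_eq_0)
  have "0 = Y f m h - 2 *\<^sub>C (if m = 0 then f else 0)"
    using relations(4)[of "-1" m vac] by (simp only: c nn')
  then show "Y f m h = (if m = 0 then 2 *\<^sub>C f else 0)"
    by (cases "m = 0") simp_all
qed

abbreviation om where "om \<equiv> sugawara k Y e h f"

lemma sugawara_mode:
  assumes "va_module vac Y YM"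
  shows "YM om n w = (1 / (2 * (k + 2))) *\<^sub>C
    (YM (Y e (-1) f) n w + YM (Y f (-1) e) n w + (1 / 2) *\<^sub>C YM (Y h (-1) h) n w)"
  unfolding sugawara_def
  by (simp add: clinear_scale[OF va_module.mod_linear_left[OF assms]]
      clinear_add[OF va_module.mod_linear_left[OF assms]])

text \<open>On each generator the four-term formula leaves multiples of its translate together with
  products of currents. Reordering these products cancels them and contributes 4 T, in addition to
  2k T from the central terms; the total 2(k + 2) is the denominator of the Sugawara vector. Closure
  of om_0 = T under products then extends it to the algebra generated.\<close>

lemma sugawara_translation: "Y om 0 w = Y w (-2) vac"
proof -
  interpret M: va_module vac Y Y by (rule va_module_self)
  have k: "(1 / (2 * (k + 2))) *\<^sub>C ((2 * (k + 2)) *\<^sub>C x) = x" for x :: 'a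
    by (simp only: scaleC_scaleC level_cancel scaleC_one)
  note z = clinear_0[OF linear_right] and sc = clinear_scale[OF linear_right]
    and mn = clinear_minus[OF linear_right]
  note products = generator_products z sc mn
  have two: "2 *\<^sub>C x = x + x" "(k * 2) *\<^sub>C x = k *\<^sub>C x + k *\<^sub>C x" for x :: 'a
    by (simp only: one_add_one[symmetric] scaleC_add_left scaleC_one)
      (simp only: mult_2_right scaleC_add_left)
  have four: "4 *\<^sub>C x = 2 *\<^sub>C x + 2 *\<^sub>C x" for x :: 'a
  proof -
    have "(4 :: complex) = 2 + 2" by simp
    then show ?thesis by (simp only: scaleC_add_left)
  qed
  have e: "Y om 0 e = Y e (-2) vac"
  proof -
    have s1: "Y (Y e (-1) f) 0 e = k *\<^sub>C Y e (-2) vac - Y e (-1) h"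
      by (subst M.normal_product_2) (simp_all add: products)
    have s2: "Y (Y f (-1) e) 0 e = k *\<^sub>C Y e (-2) vac - Y e (-1) h"
      by (subst M.normal_product_2) (simp_all add: products)
    have "Y (Y h (-1) h) 0 e = 2 *\<^sub>C Y h (-1) e + 2 *\<^sub>C Y h (-1) e"
      by (subst M.normal_product_2) (simp_all add: products)
    then have s3: "(1 / 2) *\<^sub>C Y (Y h (-1) h) 0 e = Y h (-1) e + Y h (-1) e"
      by (simp add: scaleC_add_right cvec.scale_right_diff_distrib)
    have s4: "Y h (-1) e = Y e (-1) h + 2 *\<^sub>C Y e (-2) vac"
      using relations(3)[of "-1" "-1" vac] by (simp add: creation)
    have "Y (Y e (-1) f) 0 e + Y (Y f (-1) e) 0 e + (1 / 2) *\<^sub>C Y (Y h (-1) h) 0 e =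
        (2 * (k + 2)) *\<^sub>C Y e (-2) vac"
      unfolding s1 s2 s3
      unfolding s4
      by (simp add: scaleC_add_left scaleC_add_right cvec.scale_right_diff_distrib two four algebra_simps)
    then show ?thesis by (simp only: sugawara_mode[OF va_module_self] k)
  qed
  have f: "Y om 0 f = Y f (-2) vac"
  proof -
    have s1: "Y (Y e (-1) f) 0 f = k *\<^sub>C Y f (-2) vac + Y f (-1) h"
      by (subst M.normal_product_2) (simp_all add: products)
    have s2: "Y (Y f (-1) e) 0 f = k *\<^sub>C Y f (-2) vac + Y f (-1) h"
      by (subst M.normal_product_2) (simp_all add: products)
    have "Y (Y h (-1) h) 0 f = (-2) *\<^sub>C Y h (-1) f + (-2) *\<^sub>C Y h (-1) f"
      by (subst M.normal_product_2) (simp_all add: products)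
    then have s3: "(1 / 2) *\<^sub>C Y (Y h (-1) h) 0 f = - Y h (-1) f - Y h (-1) f"
      by (simp add: scaleC_add_right cvec.scale_right_diff_distrib)
    have s4: "Y h (-1) f = Y f (-1) h - 2 *\<^sub>C Y f (-2) vac"
      using relations(4)[of "-1" "-1" vac] by (simp add: creation)
    have "Y (Y e (-1) f) 0 f + Y (Y f (-1) e) 0 f + (1 / 2) *\<^sub>C Y (Y h (-1) h) 0 f =
        (2 * (k + 2)) *\<^sub>C Y f (-2) vac"
      unfolding s1 s2 s3
      unfolding s4
      by (simp add: scaleC_add_left scaleC_add_right cvec.scale_right_diff_distrib two four algebra_simps)
    then show ?thesis by (simp only: sugawara_mode[OF va_module_self] k)
  qed
  have h: "Y om 0 h = Y h (-2) vac"
  proof -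
    have s1: "Y (Y e (-1) f) 0 h = 2 *\<^sub>C Y e (-1) f - 2 *\<^sub>C Y f (-1) e"
      by (subst M.normal_product_2) (simp_all add: products)
    have s2: "Y (Y f (-1) e) 0 h = 2 *\<^sub>C Y e (-1) f - 2 *\<^sub>C Y f (-1) e"
      by (subst M.normal_product_2) (simp_all add: products)
    have "Y (Y h (-1) h) 0 h = (2 * k) *\<^sub>C Y h (-2) vac + (2 * k) *\<^sub>C Y h (-2) vac"
      by (subst M.normal_product_2) (simp_all add: products)
    then have s3: "(1 / 2) *\<^sub>C Y (Y h (-1) h) 0 h = k *\<^sub>C Y h (-2) vac + k *\<^sub>C Y h (-2) vac"
      by (simp add: scaleC_add_right cvec.scale_right_diff_distrib)
    have s4: "Y e (-1) f = Y f (-1) e + Y h (-2) vac"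
      using relations(6)[of "-1" "-1" vac] by (simp add: creation)
    have "Y (Y e (-1) f) 0 h + Y (Y f (-1) e) 0 h + (1 / 2) *\<^sub>C Y (Y h (-1) h) 0 h =
        (2 * (k + 2)) *\<^sub>C Y h (-2) vac"
      unfolding s1 s2 s3
      unfolding s4
      by (simp add: scaleC_add_left scaleC_add_right cvec.scale_right_diff_distrib two four algebra_simps)
    then show ?thesis by (simp only: sugawara_mode[OF va_module_self] k)
  qed
  let ?S = "{w. Y om 0 w = Y w (-2) vac}"
  have "?S = UNIV"
  proof (rule gen)
    show "cvec.subspace ?S"
      unfolding cvec.subspace_def
      by (auto simp: clinear_0[OF linear_left] z clinear_add[OF linear_left] clinear_add[OF linear_right]
          clinear_scale[OF linear_left] sc)
    show "vac \<in> ?S" by (simp add: creation_nonneg vacuum_left)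
    show "Y e n w \<in> ?S \<and> Y h n w \<in> ?S \<and> Y f n w \<in> ?S" if "w \<in> ?S" for n w
      using that e h f by (auto intro: translation_closed)
  qed
  then show ?thesis by blast
qed

end

section \<open>Diagonalizable operators\<close>

lemma eigenspace_subspace:
  assumes T: "clinear T"
  shows "cvec.subspace (eigenspace T x)"
  unfolding cvec.subspace_def eigenspace_def
proof (intro conjI ballI allI)
  show "0 \<in> {w. T w = x *\<^sub>C w}" by (simp add: clinear_0[OF T])
  fix a b assume "a \<in> {w. T w = x *\<^sub>C w}" "b \<in> {w. T w = x *\<^sub>C w}"
  then show "a + b \<in> {w. T w = x *\<^sub>C w}" by (simp add: clinear_add[OF T] scaleC_add_right)
next
  fix c a assume "a \<in> {w. T w = x *\<^sub>C w}"
  then show "c *\<^sub>C a \<in> {w. T w = x *\<^sub>C w}" by (simp add: clinear_scale[OF T] mult.commute)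
qed

text \<open>Applying T - ev j to the relation removes u j and multiplies the other vectors by
  nonzero numbers.\<close>

lemma eigenvectors_independent:
  fixes T :: "'a::complex_vector \<Rightarrow> 'a"
  assumes T: "clinear T" and "finite I" and "inj_on ev I"
    and "\<And>i. i \<in> I \<Longrightarrow> u i \<in> eigenspace T (ev i)" and "(\<Sum>i\<in>I. u i) = 0"
  shows "\<forall>i\<in>I. u i = 0"
  using assms(2-)
proof (induction I arbitrary: u rule: finite_induct)
  case (insert j I)
  have u: "T (u i) = ev i *\<^sub>C u i" if "i \<in> insert j I" for i
    using insert.prems(2)[OF that] by (simp add: eigenspace_def)
  have sum: "u j + (\<Sum>i\<in>I. u i) = 0"
    using insert.hyps insert.prems(3) by simp
  have "(\<Sum>i\<in>I. (ev i - ev j) *\<^sub>C u i) = (\<Sum>i\<in>I. T (u i)) - ev j *\<^sub>C (\<Sum>i\<in>I. u i)"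
    by (simp add: u cvec.scale_sum_right cvec.scale_left_diff_distrib sum_subtractf)
  also have "\<dots> = T (u j + (\<Sum>i\<in>I. u i)) - ev j *\<^sub>C (u j + (\<Sum>i\<in>I. u i))"
    by (simp add: clinear_add[OF T] clinear_sum[OF T] u scaleC_add_right)
  also have "\<dots> = 0" by (simp add: sum clinear_0[OF T])
  finally have "(\<Sum>i\<in>I. (ev i - ev j) *\<^sub>C u i) = 0" .
  moreover have "(ev i - ev j) *\<^sub>C u i \<in> eigenspace T (ev i)" if "i \<in> I" for i
    using cvec.subspace_scale[OF eigenspace_subspace[OF T]] insert.prems(2) that by blast
  moreover have "inj_on ev I" using insert.prems(1) by simp
  ultimately have "\<forall>i\<in>I. (ev i - ev j) *\<^sub>C u i = 0"
    using insert.IH[of "\<lambda>i. (ev i - ev j) *\<^sub>C u i"] by blast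
  moreover have "ev i - ev j \<noteq> 0" if "i \<in> I" for i
    using insert.prems(1) insert.hyps(2) that by (auto simp: inj_on_def)
  ultimately have "\<forall>i\<in>I. u i = 0" by simp
  then show ?case using sum by simp
qed simp

definition total :: "('i \<Rightarrow>\<^sub>0 'a::complex_vector) \<Rightarrow> 'a" where
  "total p = (\<Sum>i\<in>keys p. lookup p i)"

lemma clinear_total: "clinear total"
  unfolding total_def by (rule clinear_lookup_sum[OF clinear_ident])

lemma total_single: "total (single i x) = x"
  by (simp add: total_def)

lemma span_Union_total:
  assumes G: "\<And>i. cvec.subspace (G i)" and w: "w \<in> cvec.span (\<Union>i. G i)"
  shows "\<exists>p. (\<forall>i. lookup p i \<in> G i) \<and> w = total p"
  using w
proof (induction rule: cvec.span_induct_alt)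
  case base
  show ?case
    by (rule exI[of _ 0]) (simp add: cvec.subspace_0[OF G] clinear_0[OF clinear_total])
next
  case (step c x y)
  then obtain p i where p: "\<forall>i. lookup p i \<in> G i" "y = total p" and x: "x \<in> G i"
    by blast
  show ?case
  proof (intro exI[of _ "single i (c *\<^sub>C x) + p"] conjI allI)
    show "c *\<^sub>C x + y = total (single i (c *\<^sub>C x) + p)"
      by (simp add: clinear_add[OF clinear_total] total_single p(2))
    show "lookup (single i (c *\<^sub>C x) + p) j \<in> G j" for j
      using p(1) x by (auto simp: lookup_add lookup_single when_def
          intro!: cvec.subspace_add[OF G] cvec.subspace_scale[OF G])
  qed
qed

lemma total_eq_0_iff:
  fixes T :: "'a::complex_vector \<Rightarrow> 'a"
  assumes T: "clinear T" and inj: "inj ev" and p: "\<And>i. lookup p i \<in> eigenspace T (ev i)"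
    and "total p = 0"
  shows "p = 0"
proof (rule poly_mapping_eqI)
  fix i
  have "\<forall>i\<in>keys p. lookup p i = 0"
    using assms(4) unfolding total_def
    by (intro eigenvectors_independent[OF T, where ev = ev] p inj_on_subset[OF inj]) simp_all
  then show "lookup p i = lookup 0 i"
    by (metis in_keys_iff lookup_zero)
qed

lemma direct_sum_eigenspaces:
  fixes T :: "'a::complex_vector \<Rightarrow> 'a"
  assumes T: "clinear T" and span: "cvec.span (\<Union>n. eigenspace T (x + of_nat n)) = UNIV"
  shows "direct_sum_decomposition (\<lambda>n. eigenspace T (x + of_nat n))"
  unfolding direct_sum_decomposition_def total_def[symmetric]
proof (intro conjI allI)
  show "cvec.subspace (eigenspace T (x + of_nat n))" for n
    by (rule eigenspace_subspace[OF T])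
  fix w
  obtain p :: "nat \<Rightarrow>\<^sub>0 'a" where p: "\<forall>n. lookup p n \<in> eigenspace T (x + of_nat n)" "w = total p"
    using span_Union_total[of "\<lambda>n. eigenspace T (x + of_nat n)" w] span eigenspace_subspace[OF T] by auto
  show "\<exists>!p. (\<forall>n. lookup p n \<in> eigenspace T (x + of_nat n)) \<and> w = total p"
  proof (intro ex1I[of _ p] conjI p)
    fix q assume q: "(\<forall>n. lookup q n \<in> eigenspace T (x + of_nat n)) \<and> w = total q"
    have "q - p = 0"
    proof (rule total_eq_0_iff[OF T])
      show "inj (\<lambda>n. x + of_nat n)" by (auto simp: inj_on_def)
      show "lookup (q - p) n \<in> eigenspace T (x + of_nat n)" for n
        using p(1) q by (simp add: lookup_minus cvec.subspace_diff[OF eigenspace_subspace[OF T]])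
      show "total (q - p) = 0"
        using p(2) q by (simp add: clinear_diff[OF clinear_total])
    qed
    then show "q = p" by simp
  qed
qed

text \<open>Expand w into eigenvectors and apply T - y: the result is zero, while each component is
  multiplied by a nonzero number.\<close>

lemma eigenspace_trivial:
  fixes T :: "'a::complex_vector \<Rightarrow> 'a"
  assumes T: "clinear T" and span: "cvec.span (\<Union>n. eigenspace T (x + of_nat n)) = UNIV"
    and y: "\<And>n. y \<noteq> x + of_nat n"
  shows "eigenspace T y = {0}"
proof -
  have "w = 0" if w: "w \<in> eigenspace T y" for w
  proof -
    obtain p :: "nat \<Rightarrow>\<^sub>0 'a" where p: "\<forall>n. lookup p n \<in> eigenspace T (x + of_nat n)" "w = total p"
      using span_Union_total[of "\<lambda>n. eigenspace T (x + of_nat n)" w] span eigenspace_subspace[OF T] by auto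
    have "(\<Sum>n\<in>keys p. (x + of_nat n - y) *\<^sub>C lookup p n) = T w - y *\<^sub>C w"
      using p(1) unfolding p(2) total_def
      by (simp add: clinear_sum[OF T] eigenspace_def cvec.scale_left_diff_distrib sum_subtractf
          cvec.scale_sum_right)
    also have "\<dots> = 0" using w by (simp add: eigenspace_def)
    finally have "\<forall>n\<in>keys p. (x + of_nat n - y) *\<^sub>C lookup p n = 0"
      using p(1) cvec.subspace_scale[OF eigenspace_subspace[OF T]]
      by (intro eigenvectors_independent[OF T, where ev = "\<lambda>n. x + of_nat n"]) (auto simp: inj_on_def)
    then have "\<forall>n\<in>keys p. lookup p n = 0" using y by fastforce
    then show ?thesis by (simp add: p(2) total_def)
  qed
  then show ?thesis by (auto simp: eigenspace_def clinear_0[OF T])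
qed

text \<open>The family only has to span; it may be dependent. An eigenvector w for y is a total of
  components in the spans for the various eigenvalues; subtracting w at y gives a family of
  eigenvectors with total zero, so w is its own component at y.\<close>

lemma eigenspace_of_family:
  fixes T :: "'a::complex_vector \<Rightarrow> 'a"
  assumes T: "clinear T" and b: "\<And>i. T (b i) = ev i *\<^sub>C b i" and span: "cvec.span (range b) = UNIV"
  shows "eigenspace T y = cvec.span (b ` {i. ev i = y})"
proof
  show "cvec.span (b ` {i. ev i = y}) \<subseteq> eigenspace T y"
    by (rule cvec.span_minimal[OF _ eigenspace_subspace[OF T]]) (auto simp: eigenspace_def b)
  let ?G = "\<lambda>y. cvec.span (b ` {i. ev i = y})"
  have "range b \<subseteq> (\<Union>y. ?G y)" by (auto intro: cvec.span_base)
  then have U: "cvec.span (\<Union>y. ?G y) = UNIV"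
    using cvec.span_mono span by blast
  show "eigenspace T y \<subseteq> ?G y"
  proof
    fix w assume w: "w \<in> eigenspace T y"
    obtain p where p: "\<forall>y. lookup p y \<in> ?G y" "w = total p"
      using span_Union_total[of ?G w] U cvec.subspace_span by auto
    have G: "?G z \<subseteq> eigenspace T z" for z
      by (rule cvec.span_minimal[OF _ eigenspace_subspace[OF T]]) (auto simp: eigenspace_def b)
    have "p - single y w = 0"
    proof (rule total_eq_0_iff[OF T])
      show "inj (\<lambda>y::complex. y)" by simp
      show "lookup (p - single y w) z \<in> eigenspace T z" for z
        using p(1) G w by (auto simp: lookup_minus lookup_single when_def
            intro!: cvec.subspace_diff[OF eigenspace_subspace[OF T]])
      show "total (p - single y w) = 0"
        by (simp add: clinear_diff[OF clinear_total] total_single p(2))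
    qed
    then have "lookup p y = w" by simp
    then show "w \<in> ?G y" using p(1) by metis
  qed
qed

section \<open>Irreducible highest weight modules of the Virasoro algebra\<close>

text \<open>The list \<open>[n\<^sub>1, n\<^sub>2, \<dots>]\<close> encodes \<open>L(-n\<^sub>1-1) L(-n\<^sub>2-1) \<dots> v\<close>.\<close>

fun vir_word :: "(int \<Rightarrow> 'a \<Rightarrow> 'a) \<Rightarrow> 'a \<Rightarrow> nat list \<Rightarrow> 'a" where
  "vir_word L v [] = v"
| "vir_word L v (n # ns) = L (- int (Suc n)) (vir_word L v ns)"

definition word_weight :: "nat list \<Rightarrow> nat" where
  "word_weight ns = sum_list (map Suc ns)"

text \<open>A letter n contributes n + 1, so the weight bounds both the letters and the length.
  Words are unordered, unlike in a PBW basis: spanning and this finiteness are what the dimension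
  bounds use.\<close>

lemma finite_word_weight: "finite {ns. word_weight ns = n}"
proof (rule finite_subset)
  show "{ns. word_weight ns = n} \<subseteq> {ns. set ns \<subseteq> {..n} \<and> length ns \<le> n}"
  proof safe
    fix ns assume n: "n = word_weight ns"
    show "length ns \<le> word_weight ns"
      unfolding word_weight_def by (induction ns) auto
    fix x assume "x \<in> set ns"
    then show "x \<le> word_weight ns"
      unfolding word_weight_def by (induction ns) auto
  qed
  show "finite {ns. set ns \<subseteq> {..n} \<and> length ns \<le> n}"
    by (rule finite_lists_length_le) simp
qed

locale virasoro_hw =
  fixes c h :: complex and L :: "int \<Rightarrow> 'a::complex_vector \<Rightarrow> 'a" and v :: 'a
  assumes irr: "irreducible_virasoro_hw c h L v"
begin

lemma rep: "virasoro_rep c L"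
  using irr by (simp add: irreducible_virasoro_hw_def)

lemma clinear_L: "clinear (L n)"
  by (rule rep[unfolded virasoro_rep_def, THEN conjunct1, rule_format])

lemma v_nonzero: "v \<noteq> 0"
  using irr by (simp add: irreducible_virasoro_hw_def)

lemma L_commute:
  "L m (L n w) = L n (L m w) + of_int (m - n) *\<^sub>C L (m + n) w
     + (if m + n = 0 then of_int (m ^ 3 - m) / 12 * c else 0) *\<^sub>C w"
proof -
  have *: "a = b + x + y" if "a - b = x + y" for a b x y :: 'a
    using that by (simp add: algebra_simps)
  show ?thesis
    by (rule *) (rule rep[unfolded virasoro_rep_def, THEN conjunct2, rule_format])
qed

lemma word_eigenvector: "L 0 (vir_word L v ns) = (h + of_nat (word_weight ns)) *\<^sub>C vir_word L v ns"
proof (induction ns)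
  case Nil
  then show ?case using irr by (simp add: irreducible_virasoro_hw_def word_weight_def)
next
  case (Cons n ns)
  have "L 0 (vir_word L v (n # ns)) = L (- int (Suc n)) (L 0 (vir_word L v ns))
      + of_nat (Suc n) *\<^sub>C vir_word L v (n # ns)"
    using L_commute[of 0 "- int (Suc n)" "vir_word L v ns"] by simp
  then show ?case
    by (simp add: Cons clinear_scale[OF clinear_L] clinear_add[OF clinear_L] word_weight_def scaleC_add_left algebra_simps)
qed

text \<open>The span is stable under every L m by induction on the word: commuting L m past the
  first letter leaves shorter words and a letter applied to a vector already in the span.
  Irreducibility then makes the nonzero stable span everything.\<close>

lemma span_words: "cvec.span (range (vir_word L v)) = UNIV"
proof -
  let ?S = "cvec.span (range (vir_word L v))"
  have sub: "L m w \<in> ?S" if "w \<in> ?S" and "\<And>ns. L m (vir_word L v ns) \<in> ?S" for m w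
    using that(1)
  proof (induction rule: cvec.span_induct_alt)
    case base then show ?case by (simp add: clinear_0[OF clinear_L] cvec.span_zero)
  next
    case (step a x y)
    then show ?case using that(2)
      by (auto simp: clinear_add[OF clinear_L] clinear_scale[OF clinear_L]
          intro!: cvec.span_add cvec.span_scale)
  qed
  have neg: "L (- int (Suc n)) (vir_word L v ns) \<in> ?S" for n ns
    by (rule cvec.span_base) (rule image_eqI[of _ _ "n # ns"], simp_all)
  have "L m (vir_word L v ns) \<in> ?S" for m ns
  proof (induction ns arbitrary: m)
    case Nil
    consider "m > 0" | "m = 0" | "m = - int (Suc (nat (- m - 1)))" by linarith
    then show ?case
    proof cases
      case 1
      then show ?thesis using irr by (simp add: irreducible_virasoro_hw_def cvec.span_zero)
    next
      case 2
      have "vir_word L v [] \<in> ?S" by (rule cvec.span_base) (rule rangeI)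
      then show ?thesis unfolding 2 word_eigenvector by (rule cvec.span_scale)
    next
      case 3
      then show ?thesis using neg[of "nat (- m - 1)" "[]"] by simp
    qed
  next
    case (Cons n ns)
    have "vir_word L v ns \<in> ?S" by (rule cvec.span_base) simp
    moreover have "L (- int (Suc n)) (L m (vir_word L v ns)) \<in> ?S"
      by (rule sub[OF Cons neg])
    ultimately show ?case
      unfolding vir_word.simps(2) L_commute[of m "- int (Suc n)"]
      by (intro cvec.span_add cvec.span_scale Cons)
  qed
  then have "\<forall>n. \<forall>w\<in>?S. L n w \<in> ?S" using sub by blast
  moreover have "v \<in> ?S" by (rule cvec.span_base) (rule image_eqI[of _ _ "[]"], simp_all)
  moreover have "?S = {0} \<or> ?S = UNIV" if "\<forall>n. \<forall>w\<in>?S. L n w \<in> ?S"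
  proof -
    have "\<forall>S. cvec.subspace S \<and> (\<forall>n. \<forall>w\<in>S. L n w \<in> S) \<longrightarrow> S = {0} \<or> S = UNIV"
      using irr[unfolded irreducible_virasoro_hw_def] by (elim conjE)
    from spec[OF this, of ?S] show ?thesis
      using that cvec.subspace_span by blast
  qed
  ultimately show ?thesis using v_nonzero by blast
qed

lemma eigenspace_words:
  "eigenspace (L 0) (h + of_nat n) = cvec.span (vir_word L v ` {ns. word_weight ns = n})"
  using eigenspace_of_family[OF clinear_L word_eigenvector span_words, of "h + of_nat n"] by simp

lemma finite_dimensional_eigenspace: "finite_dimensional (eigenspace (L 0) (h + of_nat n))"
  unfolding finite_dimensional_def eigenspace_words
  using finite_imageI[OF finite_word_weight] by blast

lemma eigenspace_lowest: "eigenspace (L 0) h = cvec.span {v}"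
proof -
  have "{ns. word_weight ns = 0} = {[]}"
    by (auto simp: word_weight_def neq_Nil_conv)
  then show ?thesis using eigenspace_words[of 0] by simp
qed

lemma span_eigenspaces: "cvec.span (\<Union>n. eigenspace (L 0) (h + of_nat n)) = UNIV"
proof -
  have "range (vir_word L v) \<subseteq> (\<Union>n. eigenspace (L 0) (h + of_nat n))"
  proof safe
    fix ns
    have "vir_word L v ns \<in> eigenspace (L 0) (h + of_nat (word_weight ns))"
      unfolding eigenspace_def by (simp only: mem_Collect_eq word_eigenvector)
    then show "vir_word L v ns \<in> (\<Union>n. eigenspace (L 0) (h + of_nat n))" by blast
  qed
  then show ?thesis using cvec.span_mono span_words by blast
qed

lemma eigenspace_empty: "(\<And>n. y \<noteq> h + of_nat n) \<Longrightarrow> eigenspace (L 0) y = {0}"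
  by (rule eigenspace_trivial[OF clinear_L span_eigenspaces])

end

section \<open>The lattice vertex algebra and its modules\<close>

lemma clinear_scaleC_left: "clinear (\<lambda>x::complex. x *\<^sub>C y)"
  by (rule clinearI) (simp_all add: scaleC_add_left scaleC_complex_def)

lemma clinear_pi_linext: "clinear (pi_linext g)"
  unfolding pi_linext_def by (rule clinear_lookup_sum[OF clinear_scaleC_left])

lemma pi_linext_single: "pi_linext g (single b x) = x *\<^sub>C g b"
  by (simp add: pi_linext_def)

lemma clinear_heis: "clinear (heis k r lam \<alpha> n)"
  unfolding heis_def by (rule clinear_pi_linext)

lemma scaleC_single: "a *\<^sub>C single b x = single b (a *\<^sub>C x)"
  by (rule poly_mapping_eqI) (simp add: lookup_scaleC lookup_single when_def)

lemma heis_creation: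
  "heis k r lam \<alpha> (- int (Suc n)) (single (j, M) x) =
     fst \<alpha> *\<^sub>C single (j, add_mset (Cgen, n) M) x
     + snd \<alpha> *\<^sub>C single (j, add_mset (Dgen, n) M) x"
  by (simp add: heis_def pi_linext_single heis_basis_def scaleC_add_right scaleC_single
      scaleC_complex_def mult.commute)

lemma heis_zero:
  "heis k r lam \<alpha> 0 (single (j, M) x) =
     cform \<alpha> (pi_weight k r lam j) *\<^sub>C single (j, M) x"
  by (simp add: heis_def pi_linext_single heis_basis_def scaleC_single scaleC_complex_def mult.commute)

lemma heis_annihilation:
  "heis k r lam \<alpha> (int (Suc n)) (single (j, M) x) =
     (of_nat (Suc n) * cform \<alpha> c_vec * of_nat (count M (Cgen, n))) *\<^sub>C
        single (j, M - {#(Cgen, n)#}) x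
     + (of_nat (Suc n) * cform \<alpha> d_vec * of_nat (count M (Dgen, n))) *\<^sub>C
        single (j, M - {#(Dgen, n)#}) x"
  by (simp add: heis_def pi_linext_single heis_basis_def scaleC_add_right scaleC_single
      scaleC_complex_def mult_ac)

lemma heis_annihilation_exp:
  assumes "n > 0"
  shows "heis k r lam \<alpha> n (pi_exp j) = 0"
  using heis_annihilation[of k r lam \<alpha> "nat n - 1" j "{#}" 1] assms by (simp add: pi_exp_def)

lemma pi_shift_exp: "pi_shift m (pi_exp j) = pi_exp (j + m)"
  by (simp add: pi_shift_def pi_exp_def pi_linext_single)

lemma exp_coeff_annihilated:
  assumes "\<And>i. i > 0 \<Longrightarrow> A i w = 0" and "\<And>i. A i 0 = 0"
  shows "exp_coeff A j w = (if j = 0 then w else 0)"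
proof (induction j rule: less_induct)
  case (less j)
  show ?case
  proof (cases j)
    case (Suc n)
    have "A (Suc i) (exp_coeff A (n - i) w) = 0" if "i \<le> n" for i
      using less[of "n - i"] assms Suc by simp
    then show ?thesis by (simp add: Suc)
  qed simp
qed

text \<open>The annihilation half of the vertex operator fixes the exponentials, so only the
  creation half and the shift by z^(m r) remain.\<close>

lemma lattice_mode_exp:
  "lattice_mode k r lam m n (pi_exp j) =
     (if - m * r - n - 1 < 0 then 0
      else exp_coeff (\<lambda>i u. of_int m *\<^sub>C heis k r lam c_vec (- int i) u) (nat (- m * r - n - 1)) (pi_exp (j + m)))"
proof -
  let ?A = "\<lambda>i u. (- of_int m) *\<^sub>C heis k r lam c_vec (int i) u"
  let ?B = "exp_coeff (\<lambda>i u. of_int m *\<^sub>C heis k r lam c_vec (- int i) u)"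
  have A: "exp_coeff ?A i (pi_exp (j + m)) = (if i = 0 then pi_exp (j + m) else 0)" for i
    by (rule exp_coeff_annihilated) (simp_all add: heis_annihilation_exp clinear_0[OF clinear_heis])
  have B: "?B i 0 = 0" for i
    by (subst exp_coeff_annihilated) (simp_all add: clinear_0[OF clinear_heis])
  have "lattice_mode k r lam m n (pi_exp j) =
      (\<Sum>i::nat. if i = 0 then (if - m * r - n - 1 < 0 then 0 else ?B (nat (- m * r - n - 1)) (pi_exp (j + m))) else 0)"
    unfolding lattice_mode_def pi_shift_exp A
    by (intro Sum_any.cong) (simp add: B)
  then show ?thesis by simp
qed

text \<open>The conformal vector \<open>\<omega>\<^sub>\<Pi>\<close> of \<open>\<Pi>(0)\<close>.\<close>

definition pi_conformal :: "complex \<Rightarrow> pi_space" where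
  "pi_conformal k = (1 / 2) *\<^sub>C heis k 0 0 c_vec (-1) (heis k 0 0 d_vec (-1) (pi_exp 0))
     - heis k 0 0 (nu_vec k) (-2) (pi_exp 0)"

lemma heis_vacuum_1:
  "heis k r lam \<alpha> (-1) (pi_exp j) = fst \<alpha> *\<^sub>C single (j, {#(Cgen, 0)#}) 1
     + snd \<alpha> *\<^sub>C single (j, {#(Dgen, 0)#}) 1"
  using heis_creation[of k r lam \<alpha> 0] by (simp add: pi_exp_def)

lemma heis_vacuum_2:
  "heis k r lam \<alpha> (-2) (pi_exp j) = fst \<alpha> *\<^sub>C single (j, {#(Cgen, 1)#}) 1
     + snd \<alpha> *\<^sub>C single (j, {#(Dgen, 1)#}) 1"
  using heis_creation[of k r lam \<alpha> 1] by (simp add: pi_exp_def)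

lemma heis_vacuum_11:
  "heis k r lam \<beta> (-1) (heis k r lam \<alpha> (-1) (pi_exp j)) =
     (fst \<alpha> * fst \<beta>) *\<^sub>C single (j, {#(Cgen, 0), (Cgen, 0)#}) 1
     + (fst \<alpha> * snd \<beta> + snd \<alpha> * fst \<beta>) *\<^sub>C single (j, {#(Cgen, 0), (Dgen, 0)#}) 1
     + (snd \<alpha> * snd \<beta>) *\<^sub>C single (j, {#(Dgen, 0), (Dgen, 0)#}) 1"
  using heis_creation[of k r lam \<beta> 0]
  by (simp add: heis_vacuum_1 clinear_add[OF clinear_heis] clinear_scale[OF clinear_heis]
      scaleC_add_right scaleC_add_left add_mset_commute add_ac)

section \<open>Products in Pi(0) that enter the Sugawara vector\<close>

locale lattice = vertex_algebra "pi_exp 0" Y for k :: complex and Y +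
  assumes lattice: "lattice_va k Y"
begin

lemma Y_heis: "Y (heis k 0 0 \<alpha> (-1) (pi_exp 0)) n = heis k 0 0 \<alpha> n"
  and Y_exp: "Y (pi_exp m) n = lattice_mode k 0 0 m n"
  using lattice unfolding lattice_va_def by blast+

text \<open>The only nonzero product of \<alpha>(-1)1 with e^c by a nonnegative mode is the zeroth
  one, the pairing of \<alpha> and c times e^c; that pairing is 2
  \<open>snd \<alpha>\<close>.\<close>

lemma exp_heis:
  "Y (pi_exp 1) n (heis k 0 0 \<alpha> m w) =
     heis k 0 0 \<alpha> m (Y (pi_exp 1) n w) - (2 * snd \<alpha>) *\<^sub>C Y (pi_exp 1) (m + n) w"
proof -
  interpret M: va_module "pi_exp 0" Y Y by (rule va_module_self)
  have "heis k 0 0 \<alpha> 0 (pi_exp 1) = (2 * snd \<alpha>) *\<^sub>C pi_exp 1"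
    by (simp add: pi_exp_def heis_zero pi_weight_def cform_def)
  then have i: "heis k 0 0 \<alpha> (int i) (pi_exp 1) = (if i = 0 then (2 * snd \<alpha>) *\<^sub>C pi_exp 1 else 0)" for i
    by (cases "i = 0") (simp_all add: heis_annihilation_exp)
  have "heis k 0 0 \<alpha> m (Y (pi_exp 1) n w) - Y (pi_exp 1) n (heis k 0 0 \<alpha> m w) =
      (\<Sum>i. if i = 0 then (2 * snd \<alpha>) *\<^sub>C Y (pi_exp 1) (m + n) w else 0)"
    using M.commutator[of "heis k 0 0 \<alpha> (-1) (pi_exp 0)" m "pi_exp 1" n w]
    unfolding Y_heis bsum_def i
    by (simp add: if_distrib[of "\<lambda>a. Y a _ _"] if_distrib[of "\<lambda>x. _ *\<^sub>C x"] clinear_0[OF linear_left]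
        clinear_scale[OF linear_left] cong: if_cong)
  then show ?thesis by (simp add: algebra_simps)
qed

text \<open>Since c pairs to zero with itself, Y(e^c, z) e^(-c) is the series exp(c(-1) z + c(-2)
  z^2 / 2 + ...) on the vacuum; these are its first three coefficients.\<close>

lemma exp_exp:
  shows "Y (pi_exp 1) (-1) (pi_exp (-1)) = pi_exp 0"
    and "Y (pi_exp 1) (-2) (pi_exp (-1)) = heis k 0 0 c_vec (-1) (pi_exp 0)"
    and "Y (pi_exp 1) (-3) (pi_exp (-1)) = (1 / 2) *\<^sub>C
      (heis k 0 0 c_vec (-1) (heis k 0 0 c_vec (-1) (pi_exp 0)) + heis k 0 0 c_vec (-2) (pi_exp 0))"
  by (simp_all add: Y_exp lattice_mode_exp numeral_2_eq_2)

text \<open>Moving mode -1 of e^c to the right past a mode of \<alpha> produces its modes -2 and -3,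
  whose values on e^(-c) are known.\<close>

lemma exp_phi_f:
  shows "Y (pi_exp 1) (-1) (heis k 0 0 \<alpha> (-1) (heis k 0 0 \<alpha> (-1) (pi_exp (-1)))) =
      heis k 0 0 \<alpha> (-1) (heis k 0 0 \<alpha> (-1) (pi_exp 0))
      - (4 * snd \<alpha>) *\<^sub>C heis k 0 0 \<alpha> (-1) (heis k 0 0 c_vec (-1) (pi_exp 0))
      + (2 * (snd \<alpha>)\<^sup>2) *\<^sub>C (heis k 0 0 c_vec (-1) (heis k 0 0 c_vec (-1) (pi_exp 0)) + heis k 0 0 c_vec (-2) (pi_exp 0))"
    and "Y (pi_exp 1) (-1) (heis k 0 0 \<alpha> (-2) (pi_exp (-1))) =
      heis k 0 0 \<alpha> (-2) (pi_exp 0)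
      - snd \<alpha> *\<^sub>C (heis k 0 0 c_vec (-1) (heis k 0 0 c_vec (-1) (pi_exp 0)) + heis k 0 0 c_vec (-2) (pi_exp 0))"
proof goal_cases
  case 1
  show ?case
    by (rule poly_mapping_eqI)
      (simp only: exp_heis exp_exp clinear_diff[OF clinear_heis] clinear_scale[OF clinear_heis]
        lookup_add lookup_minus lookup_scaleC scaleC_complex_def arith_simps,
        simp add: exp_exp clinear_diff[OF clinear_heis] clinear_scale[OF clinear_heis]
        lookup_add lookup_minus lookup_scaleC scaleC_complex_def power2_eq_square algebra_simps)
next
  case 2
  show ?case
    by (simp add: exp_heis exp_exp)
qed

text \<open>\<open>X\<close> is the lattice part of e_(-1)f, and the left-hand side is half the
  lattice part of e_(-1)f + f_(-1)e + h_(-1)h/2. The factor k + 1 in the image of f cancels the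
  square of c(-1), and the squares of mu and nu cancel that of d(-1).\<close>

lemma conformal_combination:
  assumes "k + 2 \<noteq> 0"
  defines "X \<equiv> - Y (pi_exp 1) (-1) (heis k 0 0 (nu_vec k) (-1) (heis k 0 0 (nu_vec k) (-1) (pi_exp (-1))))
    - (k + 1) *\<^sub>C Y (pi_exp 1) (-1) (heis k 0 0 (nu_vec k) (-2) (pi_exp (-1)))"
  shows "X - heis k 0 0 (mu_vec k) (-2) (pi_exp 0) + heis k 0 0 (mu_vec k) (-1) (heis k 0 0 (mu_vec k) (-1) (pi_exp 0)) =
    (k + 2) *\<^sub>C pi_conformal k"
proof (rule poly_mapping_eqI)
  fix b
  \<comment> \<open>The letters stand for the coefficients of the five monomials c(-1)^2,
    c(-1)d(-1), d(-1)^2, c(-2) and d(-2).\<close>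
  have atoms: "- ((k\<^sup>2 / 16) * cc + (- k / 4) * cd + (1 / 4) * dd - 2 * ((- k / 4) * cc + (1 / 2) * cd)
        + (1 / 2) * (cc + c2)) - (k + 1) * ((- k / 4) * c2 + (1 / 2) * d2 - (1 / 2) * (cc + c2))
      - ((k / 4) * c2 + (1 / 2) * d2) + ((k\<^sup>2 / 16) * cc + (k / 4) * cd + (1 / 4) * dd) =
      (k + 2) * ((1 / 2) * cd - ((- k / 4) * c2 + (1 / 2) * d2))" for cc cd dd c2 d2 :: complex
    by (simp add: field_simps power2_eq_square)
  show "lookup (X - heis k 0 0 (mu_vec k) (-2) (pi_exp 0)
        + heis k 0 0 (mu_vec k) (-1) (heis k 0 0 (mu_vec k) (-1) (pi_exp 0))) b =
      lookup ((k + 2) *\<^sub>C pi_conformal k) b"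
    using atoms[of "lookup (single (0, {#(Cgen, 0), (Cgen, 0)#}) 1) b"
        "lookup (single (0, {#(Cgen, 0), (Dgen, 0)#}) 1) b"
        "lookup (single (0, {#(Dgen, 0), (Dgen, 0)#}) 1) b"
        "lookup (single (0, {#(Cgen, 1)#}) 1) b"
        "lookup (single (0, {#(Dgen, 1)#}) 1) b"]
    unfolding X_def exp_phi_f pi_conformal_def
    unfolding heis_vacuum_11 heis_vacuum_2
    by (simp only: lookup_add lookup_minus lookup_uminus lookup_scaleC scaleC_complex_def
        mu_vec_def nu_vec_def c_vec_def d_vec_def fst_conv snd_conv)
      (simp add: power2_eq_square algebra_simps)
qed

end

section \<open>Weights of the lattice module\<close>

definition pi_degree :: "(hgen \<times> nat) multiset \<Rightarrow> nat" where
  "pi_degree M = (\<Sum>z\<in>#M. Suc (snd z))"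

lemma pi_degree_count:
  assumes "\<And>z. z \<in># M \<Longrightarrow> snd z < N"
  shows "(\<Sum>i<N. Suc i * (count M (Cgen, i) + count M (Dgen, i))) = pi_degree M"
  using assms
proof (induction M)
  case empty
  then show ?case by (simp add: pi_degree_def)
next
  case (add z M)
  obtain g i where z: "z = (g, i)" by (cases z)
  have i: "i < N" using add.prems[of z] by (simp add: z)
  have "(\<Sum>i<N. Suc i * (count (add_mset z M) (Cgen, i) + count (add_mset z M) (Dgen, i))) =
      (\<Sum>l<N. Suc l * (count M (Cgen, l) + count M (Dgen, l)) + (if l = i then Suc i else 0))"
    by (intro sum.cong refl) (cases g; auto simp: z)
  also have "\<dots> = pi_degree M + Suc i"
    using add.IH add.prems i by (simp add: sum.distrib sum.delta)
  finally show ?case by (simp add: pi_degree_def z)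
qed

locale lattice_module = lattice k YP + va_module "pi_exp 0" YP YW
  for k :: complex and YP YW +
  fixes lam :: complex
  assumes lattice_module: "lattice_va_module k (-1) lam YP YW"
begin

lemma YW_heis: "YW (heis k 0 0 \<alpha> (-1) (pi_exp 0)) n = heis k (-1) lam \<alpha> n"
  and YW_exp: "YW (pi_exp m) n = lattice_mode k (-1) lam m n"
  using lattice_module unfolding lattice_va_module_def by blast+

lemma YW_heis_2: "YW (heis k 0 0 \<alpha> (-2) (pi_exp 0)) 1 w = - heis k (-1) lam \<alpha> 0 w"
  using translation[of "heis k 0 0 \<alpha> (-1) (pi_exp 0)" 1 w]
  by (simp only: Y_heis YW_heis) simp

text \<open>For n > 0 the operators c(-n)d(n) and d(-n)c(n) are 2n times the number of factors c(-n)
  and d(-n) of the monomial, because the pairing of c and d is 2. The zero modes add the product of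
  the two charges.\<close>

lemma YW_cd:
  "YW (heis k 0 0 c_vec (-1) (heis k 0 0 d_vec (-1) (pi_exp 0))) 1 (single (j, M) 1) =
     (k / 2 - 2 * (lam + of_int j) + 2 * of_nat (pi_degree M)) *\<^sub>C single (j, M) 1"
proof -
  let ?w = "single (j, M) (1 :: complex)"
  obtain N where N: "\<And>z. z \<in># M \<Longrightarrow> snd z < N"
  proof
    show "z \<in># M \<Longrightarrow> snd z < Suc (Max (snd ` set_mset M))" for z
      by (simp add: less_Suc_eq_le)
  qed
  then have N0: "count M (g, i) = 0" if "i \<ge> N" for g i
    using that by (force simp: count_eq_zero_iff)
  let ?H = "\<lambda>\<alpha>. heis k (-1) lam \<alpha>"
  \<comment> \<open>\<open>a i\<close> is the eigenvalue of d(-i)c(i) and starts with the zero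
    modes, while \<open>b i\<close> is that of c(-i-1)d(i+1); hence the offset of one between
    them.\<close>
  define a where "a i = (if i = 0 then k / 2 - 2 * (lam + of_int j)
    else 2 * of_nat i * of_nat (count M (Dgen, i - 1)) :: complex)" for i
  define b where "b i = (2 * of_nat (Suc i) * of_nat (count M (Cgen, i)) :: complex)" for i
  have cd: "?H c_vec (-1 - int i) (?H d_vec (1 + int i) ?w) = b i *\<^sub>C ?w" for i
  proof -
    have e: "-1 - int i = - int (Suc i)" "1 + int i = int (Suc i)" by simp_all
    show ?thesis
      unfolding e heis_annihilation clinear_add[OF clinear_heis] clinear_scale[OF clinear_heis] heis_creation
      by (cases "count M (Cgen, i) = 0")
        (simp_all add: b_def cform_def c_vec_def d_vec_def mult_ac count_eq_zero_iff
          insert_DiffM)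
  qed
  have dc: "?H d_vec (1 - 1 - int i) (?H c_vec (int i) ?w) = a i *\<^sub>C ?w" for i
  proof (cases i)
    case 0
    have "cform c_vec (pi_weight k (-1) lam j) = -1"
      and "cform d_vec (pi_weight k (-1) lam j) = 2 * (lam + of_int j) - k / 2"
      by (simp_all add: cform_def c_vec_def d_vec_def pi_weight_def mu_vec_def)
    moreover have "1 - 1 - int i = 0" "int i = 0" using 0 by simp_all
    ultimately show ?thesis
      by (simp only: heis_zero clinear_scale[OF clinear_heis] scaleC_scaleC a_def 0 refl if_True)
        (simp add: algebra_simps)
  next
    case (Suc l)
    have e: "1 - 1 - int i = - int (Suc l)" using Suc by simp
    show ?thesis
      unfolding e
      unfolding Suc heis_annihilation clinear_add[OF clinear_heis] clinear_scale[OF clinear_heis] heis_creation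
      by (cases "count M (Dgen, l) = 0")
        (simp_all add: a_def cform_def c_vec_def d_vec_def mult_ac count_eq_zero_iff
          insert_DiffM)
  qed
  have "YW (heis k 0 0 c_vec (-1) (heis k 0 0 d_vec (-1) (pi_exp 0))) 1 ?w =
      (\<Sum>i. ?H c_vec (-1 - int i) (?H d_vec (1 + int i) ?w) + ?H d_vec (1 - 1 - int i) (?H c_vec (int i) ?w))"
    using normal_product[of "heis k 0 0 c_vec (-1) (pi_exp 0)" "heis k 0 0 d_vec (-1) (pi_exp 0)" 1 ?w]
    by (simp only: Y_heis YW_heis)
  also have "\<dots> = (\<Sum>i. (b i + a i) *\<^sub>C ?w)"
    by (simp only: cd dc scaleC_add_left)
  also have "\<dots> = (\<Sum>i<Suc N. (b i + a i) *\<^sub>C ?w)"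
  proof (rule Sum_any.expand_superset)
    show "{i. (b i + a i) *\<^sub>C ?w \<noteq> 0} \<subseteq> {..<Suc N}"
    proof (rule subsetI, rule ccontr)
      fix i assume i: "i \<in> {i. (b i + a i) *\<^sub>C ?w \<noteq> 0}" "i \<notin> {..<Suc N}"
      then have "b i = 0" "a i = 0" by (simp_all add: a_def b_def N0)
      with i show False by simp
    qed
  qed simp
  also have "\<dots> = (\<Sum>i<Suc N. b i + a i) *\<^sub>C ?w"
    by (rule cvec.scale_sum_left[symmetric])
  also have "(\<Sum>i<Suc N. b i + a i) = (\<Sum>i<N. b i) + b N + (a 0 + (\<Sum>i<N. a (Suc i)))"
    unfolding sum.distrib sum.lessThan_Suc_shift[of a] by simp
  also have "b N = 0" by (simp add: b_def N0)
  also have "(\<Sum>i<N. b i) + 0 + (a 0 + (\<Sum>i<N. a (Suc i))) =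
      a 0 + 2 * of_nat (\<Sum>i<N. Suc i * (count M (Cgen, i) + count M (Dgen, i)))"
    by (simp add: a_def b_def sum.distrib sum_distrib_left algebra_simps)
  also have "\<dots> = k / 2 - 2 * (lam + of_int j) + 2 * of_nat (pi_degree M)"
    by (simp only: pi_degree_count[OF N]) (simp add: a_def)
  finally show ?thesis .
qed

text \<open>The charges give k/4 - (\<lambda> + j), and mode 1 of -nu(-2) is nu(0), which gives
  \<lambda> + j. The sum no longer depends on j.\<close>

lemma YW_conformal:
  "YW (pi_conformal k) 1 (single (j, M) 1) =
     (k / 4 + of_nat (pi_degree M)) *\<^sub>C single (j, M) 1"
proof -
  let ?w = "single (j, M) (1 :: complex)"
  have "cform (nu_vec k) (pi_weight k (-1) lam j) = lam + of_int j"
    by (simp add: cform_def nu_vec_def pi_weight_def mu_vec_def field_simps)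
  then have "heis k (-1) lam (nu_vec k) 0 ?w = (lam + of_int j) *\<^sub>C ?w"
    by (simp only: heis_zero)
  then have "YW (pi_conformal k) 1 ?w =
      ((1 / 2) * (k / 2 - 2 * (lam + of_int j) + 2 * of_nat (pi_degree M)) + (lam + of_int j)) *\<^sub>C ?w"
    unfolding pi_conformal_def clinear_diff[OF mod_linear_left] clinear_scale[OF mod_linear_left]
      YW_cd YW_heis_2 scaleC_scaleC
    by (simp only: scaleC_add_left diff_minus_eq_add)
  also have "(1 / 2) * (k / 2 - 2 * (lam + of_int j) + 2 * of_nat (pi_degree M)) + (lam + of_int j) =
      k / 4 + of_nat (pi_degree M)"
    by (simp add: field_simps)
  finally show ?thesis .
qed

lemma YW_mu:
  "heis k (-1) lam (mu_vec k) 0 (single (j, M) 1) =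
     ((- k + 2 * lam + 2 * of_int j) / 2) *\<^sub>C single (j, M) 1"
proof -
  have "cform (mu_vec k) (pi_weight k (-1) lam j) = (- k + 2 * lam + 2 * of_int j) / 2"
    by (simp add: cform_def mu_vec_def pi_weight_def field_simps)
  then show ?thesis by (simp add: heis_zero)
qed

end

section \<open>The action of affine sl(2) on the tensor product\<close>

lemma tensor_Y_vacuum_left:
  assumes A: "va_module vacA YA YM" and YW: "modes YW"
  shows "tensor_Y YM YW (tensor vacA b) n (tensor x y) = tensor x (YW b n y)"
proof -
  have "tensor_Y YM YW (tensor vacA b) n (tensor x y) =
      (\<Sum>i::int. if i = -1 then tensor x (YW b n y) else 0)"
    unfolding tensor_Y_pure[OF va_module.modes_YM[OF A] YW] pure_mode_def
    by (intro Sum_any.cong) (simp add: va_module.mod_vacuum[OF A])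
  then show ?thesis by simp
qed

lemma tensor_Y_vacuum_right:
  assumes YM: "modes YM" and B: "va_module vacB YB YW"
  shows "tensor_Y YM YW (tensor a vacB) n (tensor x y) = tensor (YM a n x) y"
proof -
  have "tensor_Y YM YW (tensor a vacB) n (tensor x y) =
      (\<Sum>i::int. if i = n then tensor (YM a n x) y else 0)"
    unfolding tensor_Y_pure[OF YM va_module.modes_YM[OF B]] pure_mode_def
    by (intro Sum_any.cong) (auto simp: va_module.mod_vacuum[OF B])
  then show ?thesis by simp
qed

locale realization = V: affine_sl2 vacV YV k e h f + P: lattice_module k YP YW lam
    + L: va_module vacL YL YM
  for k lam :: complex and vacV e h f :: "'v::complex_vector" and YV
    and YP YW and vacL omL :: "'l::complex_vector" and YL
    and YM :: "'l \<Rightarrow> int \<Rightarrow> 'm::complex_vector \<Rightarrow> 'm" +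
  fixes Phi :: "'v \<Rightarrow> 'l tensor_pi"
  assumes hom: "va_hom vacV YV (tensor vacL (pi_exp 0)) (tensor_Y YL YP) Phi"
    and Phi_e: "Phi e = phi_e vacL" and Phi_h: "Phi h = phi_h k vacL"
    and Phi_f: "Phi f = phi_f k vacL omL"
begin

lemma Phi_linear: "clinear Phi" and Phi_vac: "Phi vacV = tensor vacL (pi_exp 0)"
  and Phi_Y: "Phi (YV a n b) = tensor_Y YL YP (Phi a) n (Phi b)"
  using hom by (simp_all add: va_hom_def)

abbreviation YE :: "'v \<Rightarrow> int \<Rightarrow> 'm tensor_pi \<Rightarrow> 'm tensor_pi" where
  "YE \<equiv> \<lambda>a. tensor_Y YM YW (Phi a)"

lemma tensor_va_module: "va_module vacV YV YE"
  by (rule tensor_module[OF V.vertex_algebra_axioms L.va_module_axioms P.va_module_axioms hom])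

lemma tensor_Y_L:
  "tensor_Y YL YP (tensor vacL b) n (tensor x y) = tensor x (YP b n y)"
  by (rule tensor_Y_vacuum_left[OF L.va_module_self P.modes_Y])

lemma clinear_tensor_va: "clinear (\<lambda>u. tensor_Y YL YP u n w)" "clinear (tensor_Y YL YP u n)"
  by (rule clinear_tensor_Y_left[OF L.modes_Y P.modes_Y] clinear_tensor_Y_right[OF L.modes_Y P.modes_Y])+

lemma clinear_tensor_mod: "clinear (\<lambda>u. tensor_Y YM YW u n w)" "clinear (tensor_Y YM YW u n)"
  by (rule clinear_tensor_Y_left[OF L.modes_YM P.modes_YM] clinear_tensor_Y_right[OF L.modes_YM P.modes_YM])+

text \<open>Only e_(-1)f and h_(-1)h are computed. The Virasoro part of f is multiplied by e^c_(-1)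
  e^(-c) = 1, and the two orders together give 2(k + 2) times \<omega>, matching the
  normalization.\<close>

lemma Phi_sugawara: "Phi (sugawara k YV e h f) = tensor omL (pi_exp 0) + tensor vacL (pi_conformal k)"
proof -
  define X where "X = - YP (pi_exp 1) (-1) (heis k 0 0 (nu_vec k) (-1) (heis k 0 0 (nu_vec k) (-1) (pi_exp (-1))))
    - (k + 1) *\<^sub>C YP (pi_exp 1) (-1) (heis k 0 0 (nu_vec k) (-2) (pi_exp (-1)))"
  define m2 where "m2 = heis k 0 0 (mu_vec k) (-2) (pi_exp 0)"
  define m11 where "m11 = heis k 0 0 (mu_vec k) (-1) (heis k 0 0 (mu_vec k) (-1) (pi_exp 0))"
  have ef: "Phi (YV e (-1) f) = (k + 2) *\<^sub>C tensor omL (pi_exp 0) + tensor vacL X"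
    unfolding Phi_Y Phi_e Phi_f phi_e_def phi_f_def X_def
      clinear_diff[OF clinear_tensor_va(2)] clinear_scale[OF clinear_tensor_va(2)] tensor_Y_L P.exp_exp
    by (simp add: tensor_linear_simps clinear_minus[OF clinear_tensor_right])
  have h: "Phi h = tensor vacL (2 *\<^sub>C heis k 0 0 (mu_vec k) (-1) (pi_exp 0))"
    by (simp add: Phi_h phi_h_def tensor_linear_simps)
  have h2: "Phi (YV h (-2) vacV) = tensor vacL (2 *\<^sub>C m2)"
    unfolding Phi_Y h Phi_vac tensor_Y_L clinear_scale[OF P.linear_left] P.Y_heis m2_def ..
  have hh: "Phi (YV h (-1) h) = tensor vacL (4 *\<^sub>C m11)"
    unfolding Phi_Y h tensor_Y_L clinear_scale[OF P.linear_left] P.Y_heis m11_def clinear_scale[OF clinear_heis]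
    by simp
  \<comment> \<open>This relation holds in V_k(sl(2)) and spares the modes of the image of
    f.\<close>
  have "YV f (-1) e = YV e (-1) f - YV h (-2) vacV"
    using V.relations(6)[of "-1" "-1" vacV] by (simp add: V.creation)
  then have fe: "Phi (YV f (-1) e) = (k + 2) *\<^sub>C tensor omL (pi_exp 0) + tensor vacL (X - 2 *\<^sub>C m2)"
    by (simp add: clinear_diff[OF Phi_linear] ef h2 tensor_linear_simps)
  have comb: "X - m2 + m11 = (k + 2) *\<^sub>C pi_conformal k"
    unfolding X_def m2_def m11_def by (rule P.conformal_combination[OF V.level])
  have double: "(2 * (k + 2)) *\<^sub>C T = (k + 2) *\<^sub>C T + (k + 2) *\<^sub>C T" for T :: "'l tensor_pi"
    by (simp only: mult_2 scaleC_add_left)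
  have "(1 / 2) *\<^sub>C Phi (YV h (-1) h) = tensor vacL (2 *\<^sub>C m11)"
    unfolding hh clinear_scale[OF clinear_tensor_right] scaleC_scaleC by simp
  then have "Phi (YV e (-1) f + YV f (-1) e + (1 / 2) *\<^sub>C YV h (-1) h) =
      (2 * (k + 2)) *\<^sub>C tensor omL (pi_exp 0) + tensor vacL (X + (X - 2 *\<^sub>C m2) + 2 *\<^sub>C m11)"
    by (simp only: clinear_add[OF Phi_linear] clinear_scale[OF Phi_linear] ef fe double
        clinear_add[OF clinear_tensor_right] add_ac)
  also have "X + (X - 2 *\<^sub>C m2) + 2 *\<^sub>C m11 = 2 *\<^sub>C (X - m2 + m11)"
    by (rule poly_mapping_eqI)
      (simp only: lookup_add lookup_minus lookup_scaleC scaleC_complex_def, simp add: algebra_simps)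
  also have "\<dots> = (2 * (k + 2)) *\<^sub>C pi_conformal k"
    unfolding comb by (simp only: scaleC_scaleC)
  finally have "Phi (sugawara k YV e h f) = (1 / (2 * (k + 2))) *\<^sub>C
      ((2 * (k + 2)) *\<^sub>C (tensor omL (pi_exp 0) + tensor vacL (pi_conformal k)))"
    unfolding sugawara_def clinear_scale[OF Phi_linear]
    by (simp only: tensor_linear_simps scaleC_add_right)
  then show ?thesis by (simp only: scaleC_scaleC V.level_cancel scaleC_one)
qed

abbreviation "L0 \<equiv> YE (sugawara k YV e h f) 1"
abbreviation "h0 \<equiv> YE h 0"

lemma L0_lookup:
  "lookup (L0 w) (j, M) =
     YM omL 1 (lookup w (j, M)) + (k / 4 + of_nat (pi_degree M)) *\<^sub>C lookup w (j, M)"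
proof (induction w rule: poly_mapping_add_induct)
  case zero
  then show ?case by (simp add: clinear_0[OF clinear_tensor_mod(2)] clinear_0[OF L.mod_linear_right])
next
  case (add u w)
  then show ?case
    by (simp add: clinear_add[OF clinear_tensor_mod(2)] clinear_add[OF L.mod_linear_right] lookup_add
        scaleC_add_right algebra_simps)
next
  case (single b x)
  obtain i N where b: "b = (i, N)" by (cases b)
  have "L0 (tensor x (single b 1)) =
      single b (YM omL 1 x) + (k / 4 + of_nat (pi_degree N)) *\<^sub>C single b x"
    unfolding Phi_sugawara clinear_add[OF clinear_tensor_mod(1)]
      tensor_Y_vacuum_left[OF L.va_module_axioms P.modes_YM]
      tensor_Y_vacuum_right[OF L.modes_YM P.va_module_axioms] b P.YW_conformal
    by (simp only: tensor_linear_simps tensor_single scaleC_one)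
  then show ?case
    by (simp add: tensor_single lookup_add lookup_scaleC b lookup_single when_def clinear_0[OF L.mod_linear_right])
qed

abbreviation h_wt :: "int \<Rightarrow> complex" where
  "h_wt j \<equiv> - k + 2 * lam + 2 * of_int j"

lemma h0_lookup:
  "lookup (h0 w) (j, M) = h_wt j *\<^sub>C lookup w (j, M)"
proof (induction w rule: poly_mapping_add_induct)
  case zero
  then show ?case by (simp add: clinear_0[OF clinear_tensor_mod(2)])
next
  case (add u w)
  then show ?case
    by (simp add: clinear_add[OF clinear_tensor_mod(2)] lookup_add scaleC_add_right)
next
  case (single b x)
  obtain i N where b: "b = (i, N)" by (cases b)
  have "h0 (tensor x (single b 1)) =
      2 *\<^sub>C tensor x ((h_wt i / 2) *\<^sub>C single b 1)"
    unfolding Phi_h phi_h_def clinear_scale[OF clinear_tensor_mod(1)]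
      tensor_Y_vacuum_left[OF L.va_module_axioms P.modes_YM] P.YW_heis b P.YW_mu ..
  also have "\<dots> = h_wt i *\<^sub>C single b x"
    by (simp only: tensor_linear_simps tensor_single scaleC_scaleC scaleC_one) simp
  finally show ?case
    by (simp add: tensor_single lookup_scaleC b lookup_single when_def)
qed

text \<open>With m = 1, r = -1 and n = 0 the exponent -m r - n - 1 is 0: the zero mode picks the
  constant term of the creation half, a pure shift.\<close>

lemma e_top: "YE e 0 (tensor x (pi_exp j)) = tensor x (pi_exp (j + 1))"
  unfolding Phi_e phi_e_def tensor_Y_vacuum_left[OF L.va_module_axioms P.modes_YM] P.YW_exp lattice_mode_exp
  by simp

end

text \<open>For each current the three products contribute multiples adding up to 2(k + 2), where
  h_(-1)h counts half.\<close>

lemma (in affine_sl2) sugawara_weight_1: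
  assumes "x \<in> {e, h, f}"
  shows "x \<in> eigenspace (Y om 1) 1"
proof -
  interpret M: va_module vac Y Y by (rule va_module_self)
  have k: "(1 / (2 * (k + 2))) *\<^sub>C ((2 * (k + 2)) *\<^sub>C x) = x" for x :: 'a
    by (simp only: scaleC_scaleC level_cancel scaleC_one)
  note z = clinear_0[OF linear_right] and sc = clinear_scale[OF linear_right]
    and mn = clinear_minus[OF linear_right]
  note products = generator_products z sc mn
  have collect: "a *\<^sub>C y + b *\<^sub>C y + (1 / 2) *\<^sub>C (c *\<^sub>C y) = (a + b + c / 2) *\<^sub>C y" for a b c and y :: 'a
    by (simp add: scaleC_add_left)
  have e: "Y om 1 e = e"
  proof -
    have "Y (Y e (-1) f) 1 e = k *\<^sub>C e"
      by (subst M.normal_product_2) (simp_all add: products creation)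
    moreover have "Y (Y f (-1) e) 1 e = (2 + k) *\<^sub>C e"
      by (subst M.normal_product_2) (simp_all add: products creation scaleC_add_left)
    moreover have "Y (Y h (-1) h) 1 e = 4 *\<^sub>C e"
      by (subst M.normal_product_2) (simp_all add: products creation)
    moreover have "k + (2 + k) + 4 / 2 = 2 * (k + 2)" by simp
    ultimately show ?thesis by (simp only: sugawara_mode[OF va_module_self] collect k)
  qed
  have f: "Y om 1 f = f"
  proof -
    have "Y (Y e (-1) f) 1 f = (2 + k) *\<^sub>C f"
      by (subst M.normal_product_2) (simp_all add: products creation scaleC_add_left)
    moreover have "Y (Y f (-1) e) 1 f = k *\<^sub>C f"
      by (subst M.normal_product_2) (simp_all add: products creation)
    moreover have "Y (Y h (-1) h) 1 f = 4 *\<^sub>C f"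
      by (subst M.normal_product_2) (simp_all add: products creation)
    moreover have "(2 + k) + k + 4 / 2 = 2 * (k + 2)" by simp
    ultimately show ?thesis by (simp only: sugawara_mode[OF va_module_self] collect k)
  qed
  have h: "Y om 1 h = h"
  proof -
    have "Y (Y e (-1) f) 1 h = 2 *\<^sub>C h"
      by (subst M.normal_product_2) (simp_all add: products creation)
    moreover have "Y (Y f (-1) e) 1 h = 2 *\<^sub>C h"
      by (subst M.normal_product_2) (simp_all add: products creation)
    moreover have "Y (Y h (-1) h) 1 h = (2 * k) *\<^sub>C h + (2 * k) *\<^sub>C h"
      by (subst M.normal_product_2) (simp_all add: products creation)
    then have "Y (Y h (-1) h) 1 h = (2 * k + 2 * k) *\<^sub>C h"
      by (simp only: scaleC_add_left)
    moreover have "2 + 2 + (2 * k + 2 * k) / 2 = 2 * (k + 2)" by simp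
    ultimately show ?thesis by (simp only: sugawara_mode[OF va_module_self] collect k)
  qed
  show ?thesis using assms e f h by (auto simp: eigenspace_def)
qed

section \<open>Weight modules of \<open>sl(2)\<close> with simple weights\<close>

lemma span_range_combination:
  fixes E :: "'i \<Rightarrow> 'a::complex_vector"
  assumes "w \<in> cvec.span (range E)"
  shows "\<exists>c J. finite J \<and> w = (\<Sum>j\<in>J. c j *\<^sub>C E j)"
proof -
  have lin: "clinear (\<lambda>p :: 'i \<Rightarrow>\<^sub>0 complex. \<Sum>j\<in>keys p. lookup p j *\<^sub>C E j)"
    by (rule clinear_lookup_sum[OF clinear_scaleC_left])
  have "\<exists>p :: 'i \<Rightarrow>\<^sub>0 complex. w = (\<Sum>j\<in>keys p. lookup p j *\<^sub>C E j)"
    using assms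
  proof (induction rule: cvec.span_induct_alt)
    case base
    show ?case by (rule exI[of _ 0]) simp
  next
    case (step a x y)
    then obtain j and p :: "'i \<Rightarrow>\<^sub>0 complex" where "x = E j"
      and p: "y = (\<Sum>j\<in>keys p. lookup p j *\<^sub>C E j)" by blast
    then show ?case
      by (intro exI[of _ "single j a + p"]) (simp add: clinear_add[OF lin])
  qed
  then show ?thesis using finite_keys by metis
qed

text \<open>Subtracting the weight of one term from h removes this term and keeps the other
  coefficients nonzero, since the weights are distinct. The combination shrinks until a multiple of
  one E j is left.\<close>

lemma weight_vector_in_submodule:
  fixes E :: "int \<Rightarrow> 'a::complex_vector"
  assumes U: "cvec.subspace U" and h: "clinear h" "\<And>w. w \<in> U \<Longrightarrow> h w \<in> U"
    and hE: "\<And>j. h (E j) = (x + 2 * of_int j) *\<^sub>C E j"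
    and "finite J" and "(\<Sum>j\<in>J. c j *\<^sub>C E j) \<in> U" and "\<exists>j\<in>J. c j \<noteq> 0"
  shows "\<exists>j. E j \<in> U"
  using assms(5-)
proof (induction J arbitrary: c rule: finite_induct)
  case (insert i J)
  let ?u = "\<Sum>j\<in>insert i J. c j *\<^sub>C E j"
  have u: "?u = c i *\<^sub>C E i + (\<Sum>j\<in>J. c j *\<^sub>C E j)" using insert.hyps by simp
  show ?case
  proof (cases "\<exists>j\<in>J. c j \<noteq> 0")
    case True
    have "h ?u - (x + 2 * of_int i) *\<^sub>C ?u \<in> U"
      using insert.prems(1) h(2) by (intro cvec.subspace_diff[OF U] cvec.subspace_scale[OF U])
    also have "h ?u - (x + 2 * of_int i) *\<^sub>C ?u = (\<Sum>j\<in>J. (2 * of_int (j - i) * c j) *\<^sub>C E j)"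
    proof -
      have "h ?u - (x + 2 * of_int i) *\<^sub>C ?u =
          (\<Sum>j\<in>insert i J. h (c j *\<^sub>C E j) - (x + 2 * of_int i) *\<^sub>C (c j *\<^sub>C E j))"
        by (simp only: clinear_sum[OF h(1)] cvec.scale_sum_right sum_subtractf)
      also have "\<dots> = (\<Sum>j\<in>insert i J. (2 * of_int (j - i) * c j) *\<^sub>C E j)"
        by (intro sum.cong refl, simp only: clinear_scale[OF h(1)] hE scaleC_scaleC
            cvec.scale_left_diff_distrib[symmetric]) (simp add: algebra_simps)
      also have "\<dots> = (\<Sum>j\<in>J. (2 * of_int (j - i) * c j) *\<^sub>C E j)"
        using insert.hyps by simp
      finally show ?thesis .
    qed
    finally have *: "(\<Sum>j\<in>J. (2 * of_int (j - i) * c j) *\<^sub>C E j) \<in> U" .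
    show ?thesis
    proof (rule insert.IH[OF *])
      obtain j where "j \<in> J" "c j \<noteq> 0" using True by blast
      moreover from this have "j \<noteq> i" using insert.hyps by blast
      ultimately show "\<exists>j\<in>J. 2 * of_int (j - i) * c j \<noteq> (0 :: complex)"
        by (intro bexI[of _ j]) simp_all
    qed
  next
    case False
    then have "(\<Sum>j\<in>J. c j *\<^sub>C E j) = 0" by (intro sum.neutral) simp
    then have "c i *\<^sub>C E i \<in> U" using insert.prems(1) u by simp
    then have "inverse (c i) *\<^sub>C (c i *\<^sub>C E i) \<in> U" by (rule cvec.subspace_scale[OF U])
    moreover have "c i \<noteq> 0" using insert.prems(2) False by blast
    ultimately show ?thesis by auto
  qed
qed simp

text \<open>A nonzero submodule contains some E i; e reaches all higher ones, and f all lower ones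
  because no b j vanishes.\<close>

lemma irreducible_weight_module:
  fixes E :: "int \<Rightarrow> 'a::complex_vector"
  assumes S: "sl2_module (cvec.span (range E)) e h f" and E0: "E 0 \<noteq> 0"
    and e: "\<And>j. e (E j) = E (j + 1)"
    and hE: "\<And>j. h (E j) = (x + 2 * of_int j) *\<^sub>C E j"
    and f: "\<And>j. f (E (j + 1)) = b j *\<^sub>C E j" and b: "\<And>j. b j \<noteq> 0"
  shows "irreducible_sl2_module (cvec.span (range E)) e h f"
  unfolding irreducible_sl2_module_def
proof (intro conjI S allI impI)
  have "E 0 \<in> cvec.span (range E)" by (rule cvec.span_base) simp
  then show "cvec.span (range E) \<noteq> {0}" using E0 by blast
  fix U assume U: "U \<subseteq> cvec.span (range E) \<and> sl2_module U e h f"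
  then have sub: "cvec.subspace U" and h: "clinear h" and inv: "\<And>w. w \<in> U \<Longrightarrow> e w \<in> U \<and> h w \<in> U \<and> f w \<in> U"
    by (auto simp: sl2_module_def)
  show "U = {0} \<or> U = cvec.span (range E)"
  proof (cases "U = {0}")
    case False
    then obtain u where u: "u \<in> U" "u \<noteq> 0" using cvec.subspace_0[OF sub] by blast
    obtain c J where J: "finite J" "u = (\<Sum>j\<in>J. c j *\<^sub>C E j)"
      using span_range_combination U u(1) by blast
    have "\<exists>j\<in>J. c j \<noteq> 0"
    proof (rule ccontr)
      assume "\<not> ?thesis"
      then have "u = 0" unfolding J(2) by (intro sum.neutral) simp
      with u(2) show False ..
    qed
    then obtain i where i: "E i \<in> U"
      using weight_vector_in_submodule[OF sub h _ hE J(1), of c] inv u(1) J(2) by blast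
    have down: "E (j - 1) \<in> U" if "E j \<in> U" for j
    proof -
      have "b (j - 1) *\<^sub>C E (j - 1) \<in> U"
        using inv[OF that] f[of "j - 1"] by simp
      then have "inverse (b (j - 1)) *\<^sub>C (b (j - 1) *\<^sub>C E (j - 1)) \<in> U"
        by (rule cvec.subspace_scale[OF sub])
      then show ?thesis using b by simp
    qed
    have "E j \<in> U" for j
    proof (induction j rule: int_induct[of _ i])
      case base then show ?case by (rule i)
    next
      case (step1 j) then show ?case using inv[of "E j"] e by simp
    next
      case (step2 j) then show ?case by (intro down)
    qed
    then have "cvec.span (range E) \<subseteq> U"
      by (intro cvec.span_minimal sub) blast
    then show ?thesis using U by blast
  qed simp
qed

section \<open>The top component\<close>

lemma pi_degree_eq_0_iff: "pi_degree M = 0 \<longleftrightarrow> M = {#}"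
  by (cases M) (auto simp: pi_degree_def)

lemma eigenvalue_shift: "a + c *\<^sub>C x = y *\<^sub>C x \<longleftrightarrow> a = (y - c) *\<^sub>C x"
  by (simp only: cvec.scale_left_diff_distrib eq_diff_eq)

lemma solve_twice: "p = a + (b + a) + q \<Longrightarrow> a + a = p - b - q" for a b p q :: "'a::ab_group_add"
  by (simp add: algebra_simps)

lemma span_eq_UNIV_if_singles:
  fixes S :: "('i \<Rightarrow>\<^sub>0 'a::complex_vector) set"
  assumes X: "cvec.span X = UNIV" and S: "\<And>b x. x \<in> X \<Longrightarrow> single b x \<in> S"
  shows "cvec.span S = UNIV"
proof -
  have single: "single b x \<in> cvec.span S" for b x
  proof -
    have "x \<in> cvec.span X" using X by blast
    then show ?thesis
    proof (induction rule: cvec.span_induct_alt)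
      case base then show ?case by (simp add: cvec.span_zero)
    next
      case (step a x y)
      have "single b x \<in> cvec.span S" using step(1) by (intro cvec.span_base S)
      then have "a *\<^sub>C single b x + single b y \<in> cvec.span S"
        using step(2) by (intro cvec.span_add cvec.span_scale)
      then show ?case by (simp add: scaleC_single single_add)
    qed
  qed
  have "w \<in> cvec.span S" for w
    by (induction w rule: poly_mapping_add_induct) (simp_all add: single cvec.span_zero cvec.span_add)
  then show ?thesis by blast
qed

locale realization_hw = realization +
  fixes c hw :: complex and v
  assumes irr: "irreducible_virasoro_hw c hw (\<lambda>n. YM omL (n + 1)) v"
begin

sublocale W: virasoro_hw c hw "\<lambda>n. YM omL (n + 1)" v
  by unfold_locales (rule irr)

lemma vir_lowest: "eigenspace (YM omL 1) hw = cvec.span {v}"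
  and vir_span: "cvec.span (\<Union>n. eigenspace (YM omL 1) (hw + of_nat n)) = UNIV"
  and vir_trivial: "(\<And>n. y \<noteq> hw + of_nat n) \<Longrightarrow> eigenspace (YM omL 1) y = {0}"
  and vir_finite: "finite_dimensional (eigenspace (YM omL 1) (hw + of_nat n))"
  using W.eigenspace_lowest W.span_eigenspaces W.eigenspace_empty[of y] W.finite_dimensional_eigenspace[of n]
  by simp_all

lemma eigenspace_L0:
  "eigenspace L0 y = {w. \<forall>j M. lookup w (j, M) \<in>
     eigenspace (YM omL 1) (y - k / 4 - of_nat (pi_degree M))}"
proof -
  have "w \<in> eigenspace L0 y \<longleftrightarrow> (\<forall>j M. lookup (L0 w) (j, M) = lookup (y *\<^sub>C w) (j, M))" for w
    unfolding eigenspace_def mem_Collect_eq by (metis (no_types) poly_mapping_eqI surj_pair)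
  then show ?thesis
    unfolding L0_lookup lookup_scaleC eigenvalue_shift diff_diff_eq[symmetric]
    by (simp only: set_eq_iff eigenspace_def mem_Collect_eq simp_thms)
qed

abbreviation "top_wt \<equiv> k / 4 + hw"

lemma L0_trivial:
  assumes "\<And>n. y \<noteq> top_wt + of_nat n"
  shows "eigenspace L0 y = {0}"
proof -
  have "eigenspace (YM omL 1) (y - k / 4 - of_nat d) = {0}" for d
  proof (rule vir_trivial, rule notI)
    fix n assume "y - k / 4 - of_nat d = hw + of_nat n"
    then have "y = top_wt + of_nat (n + d)" by (simp add: algebra_simps)
    then show False using assms by blast
  qed
  then show ?thesis
    unfolding eigenspace_L0 by (auto intro!: poly_mapping_eqI)
qed

lemma clinear_L0: "clinear L0"
  by (rule clinear_tensor_mod)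

lemma single_eigenvector:
  assumes "x \<in> eigenspace (YM omL 1) (hw + of_nat n)"
  shows "single (j, M) x \<in> eigenspace L0 (top_wt + of_nat (n + pi_degree M))"
  unfolding eigenspace_L0
  using assms cvec.subspace_0[OF eigenspace_subspace[OF L.mod_linear_right]]
  by (auto simp: lookup_single when_def algebra_simps)

lemma L0_span: "cvec.span (\<Union>n. eigenspace L0 (top_wt + of_nat n)) = UNIV"
proof (rule span_eq_UNIV_if_singles[OF vir_span])
  fix b :: pi_index and x
  assume "x \<in> (\<Union>n. eigenspace (YM omL 1) (hw + of_nat n))"
  then obtain n where "x \<in> eigenspace (YM omL 1) (hw + of_nat n)" by blast
  from single_eigenvector[OF this, of "fst b" "snd b"]
  show "single b x \<in> (\<Union>n. eigenspace L0 (top_wt + of_nat n))"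
    unfolding prod.collapse by blast
qed

abbreviation "E j \<equiv> tensor v (pi_exp j)"

lemma E_single: "E j = single (j, {#}) v"
  by (simp add: pi_exp_def tensor_single)

lemma E_nonzero: "E j \<noteq> 0"
  using W.v_nonzero by (metis E_single lookup_single_eq lookup_zero)

lemma v_lowest: "v \<in> eigenspace (YM omL 1) hw"
  unfolding vir_lowest by (simp add: cvec.span_base)

lemma E_top: "E j \<in> eigenspace L0 top_wt"
  using single_eigenvector[of v 0 j "{#}"] v_lowest by (simp add: E_single pi_degree_def)

text \<open>Two lowest weights differ by a natural number in each direction and so coincide, which
  makes the definite description meaningful.\<close>

lemma top_weight_L0: "top_weight L0 = top_wt"
  unfolding top_weight_def
proof (rule the_equality)
  have "eigenspace L0 top_wt \<noteq> {0}" using E_top E_nonzero by blast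
  moreover have "\<exists>n::nat. x = top_wt + of_nat n" if "eigenspace L0 x \<noteq> {0}" for x
    using L0_trivial that by blast
  ultimately show "eigenspace L0 top_wt \<noteq> {0} \<and> (\<forall>x. eigenspace L0 x \<noteq> {0} \<longrightarrow> (\<exists>n::nat. x = top_wt + of_nat n))"
    by blast
  fix D assume D: "eigenspace L0 D \<noteq> {0} \<and> (\<forall>x. eigenspace L0 x \<noteq> {0} \<longrightarrow> (\<exists>n::nat. x = D + of_nat n))"
  then obtain n where n: "D = top_wt + of_nat n" using L0_trivial by blast
  obtain m where "top_wt = D + of_nat m" using D \<open>eigenspace L0 top_wt \<noteq> {0}\<close> by blast
  then have "of_nat (n + m) = (0 :: complex)" using n by simp
  then have "n = 0" by (metis add_eq_0_iff_both_eq_0 of_nat_eq_0_iff)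
  then show "D = top_wt" using n by simp
qed

text \<open>A component at a monomial of positive degree would have Virasoro weight below the
  highest weight \<open>hw\<close>, the minimum of the spectrum. At M = 1 the component lies in the
  line of v.\<close>

lemma L0_top: "eigenspace L0 top_wt = cvec.span (range E)"
proof
  show "cvec.span (range E) \<subseteq> eigenspace L0 top_wt"
    by (rule cvec.span_minimal[OF _ eigenspace_subspace[OF clinear_L0]]) (use E_top in blast)
  show "eigenspace L0 top_wt \<subseteq> cvec.span (range E)"
  proof
    fix w assume w: "w \<in> eigenspace L0 top_wt"
    have "single (j, M) (lookup w (j, M)) \<in> cvec.span (range E)" for j M
    proof (cases "M = {#}")
      case True
      have "lookup w (j, M) \<in> eigenspace (YM omL 1) (top_wt - k / 4 - of_nat (pi_degree M))"
        using w unfolding eigenspace_L0 by blast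
      then have "lookup w (j, M) \<in> cvec.span {v}"
        by (simp add: True pi_degree_def vir_lowest)
      then obtain a where "lookup w (j, M) = a *\<^sub>C v"
        by (auto simp: cvec.span_singleton)
      then have "single (j, M) (lookup w (j, M)) = a *\<^sub>C E j"
        by (simp add: True E_single scaleC_single)
      then show ?thesis by (simp add: cvec.span_scale cvec.span_base)
    next
      case False
      have "lookup w (j, M) \<in> eigenspace (YM omL 1) (top_wt - k / 4 - of_nat (pi_degree M))"
        using w unfolding eigenspace_L0 by blast
      moreover have "eigenspace (YM omL 1) (top_wt - k / 4 - of_nat (pi_degree M)) = {0}"
      proof (rule vir_trivial, rule notI)
        fix n assume "top_wt - k / 4 - of_nat (pi_degree M) = hw + of_nat n"
        then have "of_nat (n + pi_degree M) = (0 :: complex)" by (simp add: algebra_simps)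
        then have "pi_degree M = 0" by (metis add_eq_0_iff_both_eq_0 of_nat_eq_0_iff)
        then show False using False by (simp add: pi_degree_eq_0_iff)
      qed
      ultimately show ?thesis by (simp add: cvec.span_zero)
    qed
    then have "(\<Sum>b\<in>keys w. single b (lookup w b)) \<in> cvec.span (range E)"
      by (intro cvec.span_sum) (metis surj_pair)
    then show "w \<in> cvec.span (range E)" using poly_mapping_expand[of w] by simp
  qed
qed

sublocale T: va_module vacV YV YE
  by (rule tensor_va_module)

text \<open>A mode m of a vector of weight N shifts the eigenvalue by N - m - 1. If the resulting
  degree is negative, the eigenvalue lies below \<open>top_wt\<close>, where there is no
  eigenvector.\<close>

lemma mode_degree:
  fixes N m :: int
  assumes a: "a \<in> eigenspace (YV (sugawara k YV e h f) 1) (of_int N)"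
    and w: "w \<in> eigenspace L0 (top_wt + of_nat n)"
  shows "YE a m w \<in> (if int n + N - m - 1 \<ge> 0
    then eigenspace L0 (top_wt + of_nat (nat (int n + N - m - 1))) else {0})"
proof -
  let ?d = "int n + N - m - 1"
  have "top_wt + of_nat n + of_int N - of_int m - 1 = top_wt + of_int ?d"
    by simp
  then have mem: "YE a m w \<in> eigenspace L0 (top_wt + of_int ?d)"
    using T.eigenspace_mode[OF V.sugawara_translation a w, of m] by (simp only:)
  show ?thesis
  proof (cases "?d \<ge> 0")
    case True
    then have "(of_int ?d :: complex) = of_nat (nat ?d)" by simp
    then show ?thesis using mem True by (simp only: if_True)
  next
    case False
    have "eigenspace L0 (top_wt + of_int ?d) = {0}"
    proof (rule L0_trivial, rule notI)
      fix l assume "top_wt + of_int ?d = top_wt + of_nat l"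
      then have "(of_int ?d :: complex) = of_int (int l)" by simp
      then have "?d = int l" by (simp only: of_int_eq_iff)
      then show False using False by simp
    qed
    then show ?thesis using mem False by (simp only: if_False)
  qed
qed

lemma graded:
  "nonneg_graded_module vacV YV (sugawara k YV e h f) YE (\<lambda>n. eigenspace L0 (top_wt + of_nat n))"
  unfolding nonneg_graded_module_def
  using tensor_va_module direct_sum_eigenspaces[OF clinear_L0 L0_span] mode_degree by blast

lemma top_mode:
  assumes x: "x \<in> {e, h, f}" and w: "w \<in> eigenspace L0 top_wt"
  shows "n > 0 \<Longrightarrow> YE x n w = 0" and "YE x 0 w \<in> eigenspace L0 top_wt"
proof -
  have x': "x \<in> eigenspace (YV (sugawara k YV e h f) 1) (of_int 1)"
    using V.sugawara_weight_1[OF x] by (simp only: of_int_1)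
  have w': "w \<in> eigenspace L0 (top_wt + of_nat 0)" using w by (simp only: of_nat_0 add_0_right)
  show "YE x n w = 0" if "n > 0" using mode_degree[OF x' w', of n] that by simp
  show "YE x 0 w \<in> eigenspace L0 top_wt" using mode_degree[OF x' w', of 0] by simp
qed

lemma sl2_top: "sl2_module (eigenspace L0 top_wt) (YE e 0) (YE h 0) (YE f 0)"
  unfolding sl2_module_def
proof (intro conjI ballI)
  show "cvec.subspace (eigenspace L0 top_wt)" by (rule eigenspace_subspace[OF clinear_L0])
  show "clinear (YE e 0)" "clinear (YE h 0)" "clinear (YE f 0)" by (rule clinear_tensor_mod)+
  fix w assume w: "w \<in> eigenspace L0 top_wt"
  show "YE e 0 w \<in> eigenspace L0 top_wt" "YE h 0 w \<in> eigenspace L0 top_wt" "YE f 0 w \<in> eigenspace L0 top_wt"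
    using top_mode(2)[OF _ w] by blast+
  show "YE h 0 (YE e 0 w) - YE e 0 (YE h 0 w) = 2 *\<^sub>C YE e 0 w"
    using T.commutator_0[of h e 0 w] V.generator_products(3)[of 0]
    by (simp add: clinear_scale[OF T.mod_linear_left])
  show "YE h 0 (YE f 0 w) - YE f 0 (YE h 0 w) = (-2) *\<^sub>C YE f 0 w"
    using T.commutator_0[of h f 0 w] V.generator_products(4)[of 0]
    by (simp only: clinear_scale[OF T.mod_linear_left] if_True refl order_refl)
  show "YE e 0 (YE f 0 w) - YE f 0 (YE e 0 w) = YE h 0 w"
    using T.commutator_0[of e f 0 w] V.generator_products(6)[of 0] by simp
qed

lemma h_top: "YE h 0 (E j) = h_wt j *\<^sub>C E j"
proof (rule poly_mapping_eqI)
  fix b :: pi_index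
  obtain i M where b: "b = (i, M)" by (cases b)
  show "lookup (YE h 0 (E j)) b =
      lookup (h_wt j *\<^sub>C E j) b"
    unfolding b h0_lookup lookup_scaleC E_single by (simp add: lookup_single when_def)
qed

text \<open>On the top component the Sugawara operator acts as a multiple of the Casimir element
  \<open>e f + f e + h^2/2\<close>, which determines the action of \<open>f\<close> from those of \<open>e\<close> and \<open>h\<close>.\<close>

lemma casimir_top:
  assumes w: "w \<in> eigenspace L0 top_wt"
  shows "(2 * (k + 2) * top_wt) *\<^sub>C w = YE f 0 (YE e 0 w) + YE e 0 (YE f 0 w) + (1 / 2) *\<^sub>C YE h 0 (YE h 0 w)"
proof -
  have z: "YE x n w = 0" if "x \<in> {e, h, f}" "n > 0" for x n
    by (rule top_mode(1)[OF that(1) w that(2)])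
  note z0 = clinear_0[OF T.mod_linear_right]
  have "YE (YV e (-1) f) 1 w = YE f 0 (YE e 0 w)"
    by (subst T.normal_product_2) (simp_all add: z z0)
  moreover have "YE (YV f (-1) e) 1 w = YE e 0 (YE f 0 w)"
    by (subst T.normal_product_2) (simp_all add: z z0)
  moreover have "YE (YV h (-1) h) 1 w = YE h 0 (YE h 0 w)"
    by (subst T.normal_product_2) (simp_all add: z z0)
  ultimately have "L0 w = (1 / (2 * (k + 2))) *\<^sub>C
      (YE f 0 (YE e 0 w) + YE e 0 (YE f 0 w) + (1 / 2) *\<^sub>C YE h 0 (YE h 0 w))"
    using V.sugawara_mode[OF tensor_va_module, of 1 w] by simp
  moreover have "L0 w = top_wt *\<^sub>C w" using w by (simp add: eigenspace_def)
  ultimately have "(2 * (k + 2)) *\<^sub>C (top_wt *\<^sub>C w) = (2 * (k + 2)) *\<^sub>C (1 / (2 * (k + 2))) *\<^sub>C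
      (YE f 0 (YE e 0 w) + YE e 0 (YE f 0 w) + (1 / 2) *\<^sub>C YE h 0 (YE h 0 w))"
    by simp
  then show ?thesis
    by (simp only: scaleC_scaleC mult.commute[of _ "1 / _"] V.level_cancel scaleC_one)
qed

text \<open>As e shifts E j to E (j + 1), the vector f E (j + 1) is f e E j. It differs from e f E j
  by h E j, so the Casimir equation contains it twice and can be solved for it.\<close>

lemma f_top:
  "YE f 0 (E (j + 1)) =
     ((k + 2) * top_wt + 1 / 4 - ((h_wt j + 1) / 2)\<^sup>2) *\<^sub>C E j"
proof -
  define H where "H = h_wt j"
  let ?F = "YE f 0 (E (j + 1))"
  have "YE e 0 (YE f 0 (E j)) - YE f 0 (YE e 0 (E j)) = YE h 0 (E j)"
    using T.commutator_0[of e f 0 "E j"] V.generator_products(6)[of 0] by simp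
  then have "YE e 0 (YE f 0 (E j)) = H *\<^sub>C E j + ?F"
    by (simp only: diff_eq_eq e_top h_top H_def)
  then have "(2 * (k + 2) * top_wt) *\<^sub>C E j = ?F + (H *\<^sub>C E j + ?F) + (H * H / 2) *\<^sub>C E j"
    using casimir_top[OF E_top[of j]]
    by (simp only: e_top h_top[of j, folded H_def] clinear_scale[OF T.mod_linear_right] scaleC_scaleC) simp
  then have "?F + ?F = (2 * (k + 2) * top_wt) *\<^sub>C E j - H *\<^sub>C E j - (H * H / 2) *\<^sub>C E j"
    by (rule solve_twice)
  also have "\<dots> = (2 * (k + 2) * top_wt - H - H * H / 2) *\<^sub>C E j"
    by (simp only: cvec.scale_left_diff_distrib)
  finally have "(1 / 2) *\<^sub>C (?F + ?F) = (1 / 2) *\<^sub>C ((2 * (k + 2) * top_wt - H - H * H / 2) *\<^sub>C E j)"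
    by simp
  moreover have "(1 / 2) *\<^sub>C (?F + ?F) = ?F"
  proof -
    have "(1 / 2) *\<^sub>C (?F + ?F) = (1 / 2 + 1 / 2) *\<^sub>C ?F"
      by (simp only: scaleC_add_right scaleC_add_left)
    then show ?thesis by simp
  qed
  \<comment> \<open>Completing the square in the weight H turns the coefficient into a difference
    whose zeros are visible.\<close>
  moreover have "(1 / 2) * (2 * (k + 2) * top_wt - H - H * H / 2) = (k + 2) * top_wt + 1 / 4 - ((H + 1) / 2)\<^sup>2"
    by (simp add: field_simps power2_eq_square)
  ultimately show ?thesis by (simp only: scaleC_scaleC H_def)
qed

lemma irreducible_top:
  assumes "\<And>j. (k + 2) * top_wt + 1 / 4 \<noteq> ((h_wt j + 1) / 2)\<^sup>2"
  shows "irreducible_sl2_module (eigenspace L0 top_wt) (YE e 0) (YE h 0) (YE f 0)"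
  unfolding L0_top
proof (rule irreducible_weight_module)
  show "sl2_module (cvec.span (range E)) (YE e 0) (YE h 0) (YE f 0)"
    using sl2_top unfolding L0_top .
  show "YE e 0 (E j) = E (j + 1)" for j by (rule e_top)
  show "YE h 0 (E j) = h_wt j *\<^sub>C E j" for j by (rule h_top)
  show "YE f 0 (E (j + 1)) =
     ((k + 2) * top_wt + 1 / 4 - ((h_wt j + 1) / 2)\<^sup>2) *\<^sub>C E j" for j
    by (rule f_top)
qed (use E_nonzero assms in simp_all)

end

section \<open>Counting the monomials of the Fock space\<close>

lemma finite_pi_degree_le: "finite {M. pi_degree M \<le> n}"
proof -
  have "{M. pi_degree M \<le> n} \<subseteq> mset ` {xs. set xs \<subseteq> UNIV \<times> {..n} \<and> length xs \<le> n}"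
  proof
    fix M assume "M \<in> {M. pi_degree M \<le> n}"
    then have M: "pi_degree M \<le> n" by simp
    obtain xs where xs: "M = mset xs" using ex_mset by metis
    have "length xs \<le> pi_degree M"
      unfolding xs pi_degree_def by (induction xs) auto
    moreover have "snd z \<le> pi_degree M" if "z \<in> set xs" for z
      using that unfolding xs pi_degree_def by (induction xs) auto
    ultimately show "M \<in> mset ` {xs. set xs \<subseteq> UNIV \<times> {..n} \<and> length xs \<le> n}"
      using M by (fastforce simp: xs)
  qed
  moreover have "finite (UNIV :: hgen set)"
  proof -
    have "(UNIV :: hgen set) = {Cgen, Dgen}" using hgen.exhaust by blast
    show ?thesis by (subst \<open>UNIV = {Cgen, Dgen}\<close>) simp
  qed
  then have "finite {xs. set xs \<subseteq> (UNIV :: hgen set) \<times> {..n} \<and> length xs \<le> n}"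
    by (intro finite_lists_length_le) simp
  ultimately show ?thesis by (meson finite_imageI finite_subset)
qed

definition monomial_fps :: "(hgen \<times> nat) set \<Rightarrow> complex fps" where
  "monomial_fps S = Abs_fps (\<lambda>d. of_nat (card {M. set_mset M \<subseteq> S \<and> pi_degree M = d}))"

lemma finite_monomials: "finite {M. set_mset M \<subseteq> S \<and> pi_degree M = d}"
  by (rule finite_subset[OF _ finite_pi_degree_le[of d]]) auto

lemma pi_degree_add: "pi_degree (add_mset z M) = Suc (snd z) + pi_degree M"
  by (simp add: pi_degree_def)

text \<open>A monomial in the enlarged set of variables either avoids z or is z times an arbitrary
  monomial in the same variables, so the new variable contributes a geometric series.\<close>

lemma monomial_fps_insert:
  assumes "z \<notin> S"
  shows "monomial_fps (insert z S) * (1 - fps_X ^ Suc (snd z)) = monomial_fps S"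
proof (rule fps_ext)
  fix d
  let ?A = "\<lambda>S d. {M. set_mset M \<subseteq> S \<and> pi_degree M = d}"
  let ?w = "Suc (snd z)"
  let ?B = "{M. set_mset M \<subseteq> insert z S \<and> ?w + pi_degree M = d}"
  have "?A (insert z S) d = ?A S d \<union> add_mset z ` ?B"
  proof (intro equalityI subsetI)
    fix M assume M: "M \<in> ?A (insert z S) d"
    show "M \<in> ?A S d \<union> add_mset z ` ?B"
    proof (cases "z \<in># M")
      case True
      then obtain N where N: "M = add_mset z N" by (metis multi_member_split)
      with M have "N \<in> ?B" by (auto simp: pi_degree_add)
      then show ?thesis using N by blast
    next
      case False
      then show ?thesis using M by auto
    qed
  next
    fix M assume "M \<in> ?A S d \<union> add_mset z ` ?B"
    then show "M \<in> ?A (insert z S) d" by (auto simp: pi_degree_add)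
  qed
  moreover have "?A S d \<inter> add_mset z ` ?B = {}" using assms by auto
  moreover have fB: "finite ?B"
    by (rule finite_subset[OF _ finite_pi_degree_le[of d]]) auto
  moreover have "card (add_mset z ` ?B) = card ?B"
    by (rule card_image) (simp add: inj_on_def)
  ultimately have "card (?A (insert z S) d) = card (?A S d) + card ?B"
    by (simp only: card_Un_disjoint finite_monomials finite_imageI)
  moreover have "card ?B = (if d < ?w then 0 else card (?A (insert z S) (d - ?w)))"
  proof (cases "d < ?w")
    case True
    then have "?B = {}" by auto
    then show ?thesis using True by simp
  next
    case False
    then have "?B = ?A (insert z S) (d - ?w)" by auto
    then show ?thesis using False by simp
  qed
  ultimately have "(of_nat (card (?A (insert z S) d)) :: complex) = of_nat (card (?A S d))
      + (if d < ?w then 0 else of_nat (card (?A (insert z S) (d - ?w))))"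
    by simp
  moreover have "fps_nth (monomial_fps (insert z S) * (1 - fps_X ^ ?w)) d =
      of_nat (card (?A (insert z S) d)) - (if d < ?w then 0 else of_nat (card (?A (insert z S) (d - ?w))))"
    unfolding right_diff_distrib mult_1_right fps_sub_nth fps_X_power_mult_right_nth
    by (simp add: monomial_fps_def)
  ultimately show "fps_nth (monomial_fps (insert z S) * (1 - fps_X ^ ?w)) d = fps_nth (monomial_fps S) d"
    by (simp add: monomial_fps_def)
qed

lemma monomial_fps_finite:
  assumes "finite S"
  shows "monomial_fps S * (\<Prod>z\<in>S. 1 - fps_X ^ Suc (snd z)) = 1"
  using assms
proof (induction S rule: finite_induct)
  case empty
  have "{M :: (hgen \<times> nat) multiset. M = {#} \<and> pi_degree M = d} = (if d = 0 then {{#}} else {})" for d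
    by (auto simp: pi_degree_def)
  then show ?case by (auto simp: monomial_fps_def intro!: fps_ext)
next
  case (insert z S)
  then show ?case
    by (simp add: mult.assoc[symmetric] monomial_fps_insert del: power_Suc)
qed

text \<open>There are two variables of each degree, one for c and one for d, hence the square. A
  coefficient of the infinite product is compared with that of a finite set of variables, where the
  count is already known.\<close>

lemma inverse_euler_product_squared:
  "fps_nth (inverse (euler_product\<^sup>2)) d = of_nat (card {M. pi_degree M = d})"
proof -
  define P where "P = monomial_fps UNIV"
  let ?Q = "\<lambda>n. \<Prod>i\<le>n. 1 - fps_X ^ Suc i :: complex fps"
  have "euler_product \<noteq> 0" using euler_product_nth_0 by auto
  then have lim: "?Q \<longlonglongrightarrow> euler_product"
    using euler_product_has_prod by (simp add: has_prod_def raw_has_prod_def)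
  have "P * euler_product\<^sup>2 = 1"
  proof (rule fps_ext)
    fix m
    \<comment> \<open>Coefficients of the partial products stabilize; one n is chosen that is good
      for all indices up to m and is itself at least m.\<close>
    have "\<forall>i\<in>{..m}. \<forall>\<^sub>F n in sequentially. fps_nth (?Q n) i = fps_nth euler_product i"
      using lim unfolding tendsto_fps_iff by blast
    then have "\<forall>\<^sub>F n in sequentially. \<forall>i\<in>{..m}. fps_nth (?Q n) i = fps_nth euler_product i"
      by (rule eventually_ball_finite[OF finite_atMost])
    moreover have "\<forall>\<^sub>F n in sequentially. n \<ge> m" by (rule eventually_ge_at_top)
    ultimately have "\<forall>\<^sub>F n in sequentially. (\<forall>i\<in>{..m}. fps_nth (?Q n) i = fps_nth euler_product i) \<and> n \<ge> m"
      by (rule eventually_conj)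
    then have "\<exists>n. (\<forall>i\<in>{..m}. fps_nth (?Q n) i = fps_nth euler_product i) \<and> n \<ge> m"
      by (rule eventually_happens'[OF sequentially_bot])
    then obtain n where Q': "\<forall>i\<in>{..m}. fps_nth (?Q n) i = fps_nth euler_product i" and n: "n \<ge> m"
      by (elim exE conjE)
    have Q: "fps_nth (?Q n) i = fps_nth euler_product i" if "i \<le> m" for i
      using bspec[OF Q', of i] that by (simp only: atMost_iff)
    let ?S = "{Cgen, Dgen} \<times> {..n}"
    have "(\<Prod>z\<in>?S. 1 - fps_X ^ Suc (snd z)) = (\<Prod>g\<in>{Cgen, Dgen}. ?Q n)"
      by (simp only: prod.cartesian_product case_prod_unfold)
    also have "\<dots> = (?Q n)\<^sup>2"
      by (simp add: numeral_2_eq_2 del: power_Suc)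
    finally have prod: "monomial_fps ?S * (?Q n)\<^sup>2 = 1"
      using monomial_fps_finite[of ?S] by (simp del: power_Suc)
    have P: "fps_nth P i = fps_nth (monomial_fps ?S) i" if "i \<le> m" for i
    proof -
      \<comment> \<open>A variable with index above n has degree greater than m, so it cannot divide
        a monomial of degree at most m.\<close>
      have "set_mset M \<subseteq> ?S" if "pi_degree M = i" for M
      proof
        fix z assume "z \<in># M"
        then have "snd z \<le> pi_degree M"
          unfolding pi_degree_def by (induction M) auto
        then show "z \<in> ?S"
          using \<open>i \<le> m\<close> n that hgen.exhaust[of "fst z"] by (cases z) auto
      qed
      then have "{M. set_mset M \<subseteq> UNIV \<and> pi_degree M = i} = {M. set_mset M \<subseteq> ?S \<and> pi_degree M = i}"
        by blast
      then show ?thesis by (simp only: P_def monomial_fps_def fps_nth_Abs_fps)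
    qed
    have E: "fps_nth (euler_product\<^sup>2) i = fps_nth ((?Q n)\<^sup>2) i" if "i \<le> m" for i
      unfolding power2_eq_square fps_mult_nth
    proof (intro sum.cong refl)
      fix j assume "j \<in> {0..i}"
      then have "j \<le> m" "i - j \<le> m" using that by auto
      then show "fps_nth euler_product j * fps_nth euler_product (i - j) = fps_nth (?Q n) j * fps_nth (?Q n) (i - j)"
        by (simp only: Q)
    qed
    have "fps_nth (P * euler_product\<^sup>2) m = fps_nth (monomial_fps ?S * (?Q n)\<^sup>2) m"
      unfolding fps_mult_nth
    proof (intro sum.cong refl)
      fix j assume "j \<in> {0..m}"
      then have "j \<le> m" "m - j \<le> m" by auto
      then show "fps_nth P j * fps_nth (euler_product\<^sup>2) (m - j) = fps_nth (monomial_fps ?S) j * fps_nth ((?Q n)\<^sup>2) (m - j)"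
        by (simp only: P E)
    qed
    then show "fps_nth (P * euler_product\<^sup>2) m = fps_nth 1 m" by (simp only: prod)
  qed
  then have "inverse (euler_product\<^sup>2) = P"
    by (intro fps_inverse_unique) (simp add: mult.commute)
  then show ?thesis by (simp add: P_def monomial_fps_def)
qed

section \<open>Formal characters\<close>

lemma q_series_apply: "q_series F (a, b) = (if b = 0 then F a else 0)"
  by (simp add: q_series_def)

lemma z_power_mult: "(z_power x \<star> F) (a, b) = F (a, b - x)"
proof -
  have "(z_power x \<star> F) (a, b) = (\<Sum>u. if u = (0 :: complex, x) then F (a, b - x) else 0)"
    unfolding qz_mult_def z_power_def by (intro Sum_any.cong) (auto split: if_splits)
  then show ?thesis by simp
qed

text \<open>The delta series has infinite support, but the left factor lives on the single
  z-exponent x, so each coefficient of the product has only one term.\<close>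

lemma z_q_delta_mult:
  "(z_power x \<star> q_series F \<star> delta_z2) (a, b) = (if \<exists>l::int. b = x + 2 * of_int l then F a else 0)"
proof -
  have "(z_power x \<star> q_series F \<star> delta_z2) (a, b) =
      (\<Sum>u. if u = (a, x) then (if \<exists>l::int. b = x + 2 * of_int l then F a else 0) else 0)"
    unfolding qz_mult_def[of "z_power x \<star> q_series F"]
  proof (intro Sum_any.cong)
    fix u :: "complex \<times> complex"
    obtain a' b' where u: "u = (a', b')" by (cases u)
    show "(z_power x \<star> q_series F) u * delta_z2 ((a, b) - u) =
        (if u = (a, x) then (if \<exists>l::int. b = x + 2 * of_int l then F a else 0) else 0)"
      by (auto simp: u z_power_mult q_series_def delta_z2_def algebra_simps)
  qed
  then show ?thesis by simp
qed

lemma z_q_delta_q_mult: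
  "(z_power x \<star> q_series F \<star> delta_z2 \<star> q_series G) (a, b) =
     (if \<exists>l::int. b = x + 2 * of_int l then (q_series F \<star> q_series G) (a, 0) else 0)"
proof -
  let ?c = "\<exists>l::int. b = x + 2 * of_int l"
  \<comment> \<open>The right factor has z-exponent 0, so only exponents b of the left factor
    matter; the translation moves them to 0, where the sum is a product of q-series.\<close>
  have "bij (\<lambda>u :: complex \<times> complex. u + (0, b))"
    by (rule bij_betw_byWitness[where f' = "\<lambda>u. u - (0, b)"]) auto
  from Sum_any_bij[OF this, of "\<lambda>u. (z_power x \<star> q_series F \<star> delta_z2) u * q_series G ((a, b) - u)"]
  have "(z_power x \<star> q_series F \<star> delta_z2 \<star> q_series G) (a, b) =
      (\<Sum>u. (z_power x \<star> q_series F \<star> delta_z2) (u + (0, b)) * q_series G ((a, b) - (u + (0, b))))"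
    by (simp only: qz_mult_def[of "z_power x \<star> q_series F \<star> delta_z2"])
  also have "\<dots> = (\<Sum>u. if ?c then q_series F u * q_series G ((a, 0) - u) else 0)"
  proof (intro Sum_any.cong)
    fix u :: "complex \<times> complex"
    obtain a' b' where u: "u = (a', b')" by (cases u)
    show "(z_power x \<star> q_series F \<star> delta_z2) (u + (0, b)) * q_series G ((a, b) - (u + (0, b))) =
        (if ?c then q_series F u * q_series G ((a, 0) - u) else 0)"
      by (cases "b' = 0") (simp_all add: u z_q_delta_mult q_series_apply)
  qed
  also have "\<dots> = (if ?c then (q_series F \<star> q_series G) (a, 0) else 0)"
    by (simp add: qz_mult_def)
  finally show ?thesis .
qed

section \<open>Dimensions\<close>

text \<open>\<open>V\<close> is the direct sum of the \<open>G b\<close> over K. Placing a basis of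
  each \<open>G b\<close> at index b gives a spanning set, and reading a relation at one index
  reduces independence to that of the basis there.\<close>

lemma dim_supported:
  fixes G :: "'i \<Rightarrow> 'a::complex_vector set"
  assumes K: "finite K" and G: "\<And>b. b \<in> K \<Longrightarrow> cvec.subspace (G b)"
    and fin: "\<And>b. b \<in> K \<Longrightarrow> finite_dimensional (G b)"
  defines "V \<equiv> {w. (\<forall>b\<in>K. lookup w b \<in> G b) \<and> (\<forall>b. b \<notin> K \<longrightarrow> lookup w b = 0)}"
  shows "finite_dimensional V" and "cvec.dim V = (\<Sum>b\<in>K. cvec.dim (G b))"
proof -
  have "\<exists>B. finite B \<and> B \<subseteq> G b \<and> cvec.independent B \<and> cvec.span B = G b \<and> card B = cvec.dim (G b)"
    if b: "b \<in> K" for b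
  proof -
    obtain B where B: "B \<subseteq> G b" "cvec.independent B" "G b \<subseteq> cvec.span B" "card B = cvec.dim (G b)"
      using cvec.basis_exists by metis
    obtain F where "finite F" "cvec.span F = G b" using fin[OF b] by (auto simp: finite_dimensional_def)
    then have "finite B" using B cvec.independent_span_bound by blast
    moreover have "cvec.span B = G b" using B cvec.span_minimal[OF _ G[OF b]] by blast
    ultimately show ?thesis using B by blast
  qed
  then obtain B where B: "\<And>b. b \<in> K \<Longrightarrow> finite (B b)" "\<And>b. b \<in> K \<Longrightarrow> B b \<subseteq> G b"
    "\<And>b. b \<in> K \<Longrightarrow> cvec.independent (B b)" "\<And>b. b \<in> K \<Longrightarrow> cvec.span (B b) = G b"
    "\<And>b. b \<in> K \<Longrightarrow> card (B b) = cvec.dim (G b)"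
    by metis
  define C where "C = (\<Union>b\<in>K. single b ` B b)"
  have inj: "inj_on (single b) X" for b and X :: "'a set"
    by (meson inj_onI inj_single injD)
  have nonzero: "x \<noteq> 0" if "b \<in> K" "x \<in> B b" for b x
    using B(3)[OF that(1)] that(2) cvec.dependent_zero by blast
  have disj: "single b ` B b \<inter> single b' ` B b' = {}"
    if "b \<in> K" "b' \<in> K" "b \<noteq> b'" for b b'
  proof -
    have "single b x \<noteq> single b' y" if "x \<in> B b" for x y
      using nonzero[OF \<open>b \<in> K\<close> that] \<open>b \<noteq> b'\<close>
      by (metis lookup_single_eq lookup_single_not_eq)
    then show ?thesis by blast
  qed
  have finC: "finite C" unfolding C_def using K B(1) by blast
  have card: "card C = (\<Sum>b\<in>K. cvec.dim (G b))"
    unfolding C_def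
    by (subst card_UN_disjoint) (use K B(1,5) disj in \<open>simp_all add: card_image[OF inj]\<close>)
  have indep: "cvec.independent C"
  proof (rule cvec.independent_if_scalars_zero[OF finC])
    fix g z assume g: "(\<Sum>z\<in>C. g z *\<^sub>C z) = 0" and z: "z \<in> C"
    then obtain b x where b: "b \<in> K" and x: "x \<in> B b" and zx: "z = single b x"
      by (auto simp: C_def)
    have fC: "(\<Sum>z\<in>C. lookup (g z *\<^sub>C z) b) =
        (\<Sum>b'\<in>K. \<Sum>x\<in>B b'. lookup (g (single b' x) *\<^sub>C single b' x) b)"
      unfolding C_def
      by (subst sum.UNION_disjoint) (use K B(1) disj in \<open>simp_all add: sum.reindex[OF inj] o_def\<close>)
    have "0 = lookup (\<Sum>z\<in>C. g z *\<^sub>C z) b" by (simp add: g)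
    also have "\<dots> = (\<Sum>b'\<in>K. \<Sum>x\<in>B b'. lookup (g (single b' x) *\<^sub>C single b' x) b)"
      by (simp only: lookup_sum fC)
    also have "\<dots> = (\<Sum>b'\<in>K. if b' = b then \<Sum>x\<in>B b. g (single b x) *\<^sub>C x else 0)"
      by (intro sum.cong refl) (auto simp: lookup_scaleC lookup_single when_def)
    also have "\<dots> = (\<Sum>x\<in>B b. g (single b x) *\<^sub>C x)"
      using K b by (simp add: sum.delta)
    finally have "(\<Sum>x\<in>B b. g (single b x) *\<^sub>C x) = 0" by simp
    from cvec.independentD[OF B(3)[OF b] B(1)[OF b] order_refl this x]
    show "g z = 0" by (simp add: zx)
  qed
  have subV: "cvec.subspace V"
    unfolding V_def cvec.subspace_def
    by (auto simp: lookup_add lookup_scaleC cvec.subspace_0[OF G] cvec.subspace_add[OF G] cvec.subspace_scale[OF G])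
  have span: "cvec.span C = V"
  proof
    have "C \<subseteq> V"
      using B(2) cvec.subspace_0[OF G] by (fastforce simp: C_def V_def lookup_single when_def)
    then show "cvec.span C \<subseteq> V" by (rule cvec.span_minimal[OF _ subV])
    show "V \<subseteq> cvec.span C"
    proof
      fix w assume w: "w \<in> V"
      have single: "single b x \<in> cvec.span C" if b: "b \<in> K" and x: "x \<in> G b" for b x
      proof -
        have "x \<in> cvec.span (B b)" using x B(4)[OF b] by simp
        then show ?thesis
        proof (induction rule: cvec.span_induct_alt)
          case base then show ?case by (simp add: cvec.span_zero)
        next
          case (step a y z)
          have "single b y \<in> C" using step(1) b by (auto simp: C_def)
          then have "a *\<^sub>C single b y + single b z \<in> cvec.span C"
            using step(2) by (intro cvec.span_add cvec.span_scale) (auto intro: cvec.span_base)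
          then show ?case by (simp add: scaleC_single single_add)
        qed
      qed
      have "(\<Sum>b\<in>keys w. single b (lookup w b)) \<in> cvec.span C"
      proof (rule cvec.span_sum)
        fix b assume "b \<in> keys w"
        then have "b \<in> K" using w by (auto simp: V_def in_keys_iff)
        then show "single b (lookup w b) \<in> cvec.span C"
          using w single by (auto simp: V_def)
      qed
      then show "w \<in> cvec.span C" using poly_mapping_expand[of w] by simp
    qed
  qed
  show "finite_dimensional V" using finC span by (auto simp: finite_dimensional_def)
  show "cvec.dim V = (\<Sum>b\<in>K. cvec.dim (G b))"
    using cvec.dim_span_eq_card_independent[OF indep] by (simp add: span card)
qed

lemma dim_trivial: "cvec.dim {0 :: 'a::complex_vector} = 0"
  using cvec.dim_span_eq_card_independent[of "{} :: 'a set"] by (simp add: cvec.independent_empty)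

lemma finite_dimensional_trivial: "finite_dimensional {0 :: 'a::complex_vector}"
  unfolding finite_dimensional_def by (rule exI[of _ "{}"]) simp

lemma mem_if_trivial: "0 \<in> X \<Longrightarrow> z \<in> (if P then X else {0}) \<longleftrightarrow> z \<in> X \<and> (P \<or> z = 0)"
  by auto

context realization_hw
begin

lemma joint_eigenspace_supported:
  "joint_eigenspace L0 h0 x y = {w. \<forall>j M. lookup w (j, M) \<in>
     (if y = h_wt j then eigenspace (YM omL 1) (x - k / 4 - of_nat (pi_degree M)) else {0})}"
proof -
  have h: "w \<in> eigenspace h0 y \<longleftrightarrow>
      (\<forall>j M. y = h_wt j \<or> lookup w (j, M) = 0)" for w
  proof -
    have "w \<in> eigenspace h0 y \<longleftrightarrow> (\<forall>j M. lookup (h0 w) (j, M) = lookup (y *\<^sub>C w) (j, M))"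
      unfolding eigenspace_def mem_Collect_eq by (metis (no_types) poly_mapping_eqI surj_pair)
    then show ?thesis
      unfolding h0_lookup lookup_scaleC cvec.scale_cancel_right by (simp only: eq_commute[of y])
  qed
  have zero: "0 \<in> eigenspace (YM omL 1) z" for z
    by (rule cvec.subspace_0[OF eigenspace_subspace[OF L.mod_linear_right]])
  show ?thesis
    unfolding joint_eigenspace_def eigenspace_L0 mem_if_trivial[OF zero]
    by (simp only: set_eq_iff Int_iff h mem_Collect_eq all_conj_distrib simp_thms)
qed

definition vir_fps :: "complex fps" where
  "vir_fps = Abs_fps (\<lambda>n. of_nat (cvec.dim (eigenspace (YM omL 1) (hw + of_nat n))))"

lemma q_character_vir: "q_character x (YM omL 1) = q_series (q_shift (hw - x / 24) vir_fps)"
proof -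
  have "of_nat (cvec.dim (eigenspace (YM omL 1) (a + x / 24))) = q_shift (hw - x / 24) vir_fps a" for a
  proof (cases "\<exists>n::nat. a = hw - x / 24 + of_nat n")
    case True
    then obtain n :: nat where n: "a = hw - x / 24 + of_nat n" by blast
    then have "a + x / 24 = hw + of_nat n" by simp
    then show ?thesis unfolding n q_shift_eq by (simp add: vir_fps_def)
  next
    case False
    have "eigenspace (YM omL 1) (a + x / 24) = {0}"
    proof (rule vir_trivial, rule notI)
      fix n assume "a + x / 24 = hw + of_nat n"
      then have "a = hw - x / 24 + of_nat n" by (simp add: algebra_simps)
      then show False using False by blast
    qed
    then show ?thesis using False by (simp add: q_shift_def dim_trivial)
  qed
  then show ?thesis by (simp add: q_character_def)
qed

text \<open>The weight of h fixes j, and the eigenvalue of L0 bounds the degree of the monomial by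
  n. What remains is a finite direct sum of Virasoro weight spaces, counted by a Cauchy
  product.\<close>

lemma joint_eigenspace_dim:
  shows "finite_dimensional (joint_eigenspace L0 h0 (top_wt + of_nat n) (h_wt j))"
    and "of_nat (cvec.dim (joint_eigenspace L0 h0 (top_wt + of_nat n) (h_wt j))) =
      fps_nth (vir_fps * inverse (euler_product\<^sup>2)) n"
proof -
  let ?T = "YM omL 1"
  let ?J = "joint_eigenspace L0 h0 (top_wt + of_nat n) (h_wt j)"
  define K where "K = Pair j ` {M. pi_degree M \<le> n}"
  define G where "G b = eigenspace ?T (hw + of_nat (n - pi_degree (snd b)))" for b :: pi_index
  have K: "finite K" unfolding K_def using finite_pi_degree_le by blast
  have "(if h_wt j = h_wt i
      then eigenspace ?T (top_wt + of_nat n - k / 4 - of_nat (pi_degree M)) else {0}) =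
      (if (i, M) \<in> K then G (i, M) else {0})" for i M
  proof (cases "i = j")
    case True
    show ?thesis
    proof (cases "pi_degree M \<le> n")
      case le: True
      then have "top_wt + of_nat n - k / 4 - of_nat (pi_degree M) = hw + of_nat (n - pi_degree M)"
        by (simp add: of_nat_diff)
      moreover have "(i, M) \<in> K" using True le by (simp add: K_def)
      ultimately show ?thesis by (simp only: G_def True refl if_True snd_conv)
    next
      case False
      have "eigenspace ?T (top_wt + of_nat n - k / 4 - of_nat (pi_degree M)) = {0}"
      proof (rule vir_trivial, rule notI)
        fix l assume "top_wt + of_nat n - k / 4 - of_nat (pi_degree M) = hw + of_nat l"
        then have "(of_nat n :: complex) = of_nat (l + pi_degree M)" by (simp add: algebra_simps)
        then have "n = l + pi_degree M" by (simp only: of_nat_eq_iff)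
        then show False using False by simp
      qed
      moreover have "(i, M) \<notin> K" using False by (auto simp: K_def)
      ultimately show ?thesis by (simp only: True refl if_True if_False)
    qed
  next
    case False
    then show ?thesis by (auto simp: K_def)
  qed
  then have J: "?J = {w. \<forall>j M. lookup w (j, M) \<in> (if (j, M) \<in> K then G (j, M) else {0})}"
    unfolding joint_eigenspace_supported by (simp only:)
  also have "\<dots> = {w. (\<forall>b\<in>K. lookup w b \<in> G b) \<and> (\<forall>b. b \<notin> K \<longrightarrow> lookup w b = 0)}"
    by (auto split: if_splits)
  finally have J: "?J = \<dots>" .
  have subG: "cvec.subspace (G b)" for b
    unfolding G_def by (rule eigenspace_subspace[OF L.mod_linear_right])
  have finG: "finite_dimensional (G b)" for b
    unfolding G_def by (rule vir_finite)
  show "finite_dimensional ?J"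
    unfolding J by (rule dim_supported(1)[OF K subG finG])
  have "cvec.dim ?J = (\<Sum>b\<in>K. cvec.dim (G b))"
    unfolding J by (rule dim_supported(2)[OF K subG finG])
  also have "\<dots> = (\<Sum>M\<in>{M. pi_degree M \<le> n}. cvec.dim (eigenspace ?T (hw + of_nat (n - pi_degree M))))"
    unfolding K_def by (subst sum.reindex) (auto simp: inj_on_def G_def)
  \<comment> \<open>The summand depends on the monomial only through its degree, so monomials are
    grouped by degree.\<close>
  also have "\<dots> = (\<Sum>d\<le>n. \<Sum>M\<in>{M. M \<in> {M. pi_degree M \<le> n} \<and> pi_degree M = d}.
      cvec.dim (eigenspace ?T (hw + of_nat (n - pi_degree M))))"
    by (rule sum.group[symmetric]) (auto intro: finite_pi_degree_le)
  also have "\<dots> = (\<Sum>d\<le>n. card {M. pi_degree M = d} * cvec.dim (eigenspace ?T (hw + of_nat (n - d))))"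
  proof (rule sum.cong[OF refl])
    fix d assume "d \<in> {..n}"
    then have "{M. M \<in> {M. pi_degree M \<le> n} \<and> pi_degree M = d} = {M. pi_degree M = d}" by auto
    moreover have "(\<Sum>M\<in>{M. pi_degree M = d}. cvec.dim (eigenspace ?T (hw + of_nat (n - pi_degree M)))) =
        (\<Sum>M\<in>{M. pi_degree M = d}. cvec.dim (eigenspace ?T (hw + of_nat (n - d))))"
      by (rule sum.cong) auto
    ultimately show "(\<Sum>M\<in>{M. M \<in> {M. pi_degree M \<le> n} \<and> pi_degree M = d}.
        cvec.dim (eigenspace ?T (hw + of_nat (n - pi_degree M)))) =
      card {M. pi_degree M = d} * cvec.dim (eigenspace ?T (hw + of_nat (n - d)))"
      by (simp only: sum_constant of_nat_id)
  qed
  finally have "(of_nat (cvec.dim ?J) :: complex) =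
      (\<Sum>d\<le>n. fps_nth (inverse (euler_product\<^sup>2)) d * fps_nth vir_fps (n - d))"
    by (simp only: inverse_euler_product_squared vir_fps_def fps_nth_Abs_fps of_nat_sum of_nat_mult)
  also have "\<dots> = fps_nth (inverse (euler_product\<^sup>2) * vir_fps) n"
    by (simp only: fps_mult_nth atLeast0AtMost)
  finally show "of_nat (cvec.dim ?J) = fps_nth (vir_fps * inverse (euler_product\<^sup>2)) n"
    by (simp only: mult.commute[of vir_fps])
qed

lemma joint_eigenspace_trivial:
  assumes "(\<forall>n. x \<noteq> top_wt + of_nat n) \<or> (\<forall>j::int. y \<noteq> h_wt j)"
  shows "joint_eigenspace L0 h0 x y = {0}"
  using assms
proof
  assume "\<forall>n. x \<noteq> top_wt + of_nat n"
  then have "eigenspace L0 x = {0}" using L0_trivial by blast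
  moreover have "0 \<in> eigenspace h0 y"
    by (rule cvec.subspace_0[OF eigenspace_subspace[OF clinear_tensor_mod(2)]])
  ultimately show ?thesis by (auto simp: joint_eigenspace_def)
next
  assume "\<forall>j::int. y \<noteq> h_wt j"
  then show ?thesis
    unfolding joint_eigenspace_supported by (auto intro!: poly_mapping_eqI)
qed

lemma has_character_L0: "has_character L0 h0"
  unfolding has_character_def
proof (intro conjI allI)
  fix x y
  show "finite_dimensional (joint_eigenspace L0 h0 x y)"
  proof (cases "(\<forall>n. x \<noteq> top_wt + of_nat n) \<or> (\<forall>j::int. y \<noteq> h_wt j)")
    case True
    show ?thesis
      unfolding joint_eigenspace_trivial[OF True] by (rule finite_dimensional_trivial)
  next
    case False
    then show ?thesis using joint_eigenspace_dim(1) by blast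
  qed
next
  show "cvec.span (\<Union>x. \<Union>y. joint_eigenspace L0 h0 x y) = UNIV"
  proof (rule span_eq_UNIV_if_singles[OF vir_span])
    fix b :: pi_index and x
    assume "x \<in> (\<Union>n. eigenspace (YM omL 1) (hw + of_nat n))"
    then obtain n where n: "x \<in> eigenspace (YM omL 1) (hw + of_nat n)" by blast
    obtain j M where b: "b = (j, M)" by (cases b)
    have "single b x \<in> eigenspace h0 (h_wt j)"
      unfolding eigenspace_def mem_Collect_eq
    proof (rule poly_mapping_eqI)
      fix b' :: pi_index
      obtain i N where b': "b' = (i, N)" by (cases b')
      show "lookup (h0 (single b x)) b' =
          lookup (h_wt j *\<^sub>C single b x) b'"
        unfolding b b' h0_lookup lookup_scaleC by (simp add: lookup_single when_def)
    qed
    then show "single b x \<in> (\<Union>x. \<Union>y. joint_eigenspace L0 h0 x y)"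
      using single_eigenvector[OF n, of j M] by (auto simp: joint_eigenspace_def b)
  qed
qed

text \<open>The hypothesis \<open>charge\<close> compares powers of q: k/4 is the lowest weight of
  the lattice factor, and -1/12 comes from the two copies of 1/\<eta>. It says x = c + 2 + 6 k,
  where 2 + 6 k is the central charge of the conformal vector of Pi(0).\<close>

lemma character_L0:
  assumes charge: "k / 4 - x / 24 = - c / 24 - 1 / 12"
  shows "character x L0 h0 =
    z_power (- k + 2 * lam) \<star> q_character c (YM omL 1) \<star> delta_z2 \<star> inverse_eta_squared"
proof
  fix u :: "complex \<times> complex"
  obtain a b where u: "u = (a, b)" by (cases u)
  have shift: "hw - c / 24 + - 1 / 12 = top_wt - x / 24"
    using charge by (simp add: algebra_simps)
  let ?F = "vir_fps * inverse (euler_product\<^sup>2)"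
  have "(z_power (- k + 2 * lam) \<star> q_character c (YM omL 1) \<star> delta_z2 \<star> inverse_eta_squared) (a, b) =
      (if \<exists>j::int. b = h_wt j then q_shift (top_wt - x / 24) ?F a else 0)"
    unfolding q_character_vir inverse_eta_squared_def z_q_delta_q_mult q_series_mult shift q_series_apply
    by simp
  moreover have "character x L0 h0 (a, b) =
      (if \<exists>j::int. b = h_wt j then q_shift (top_wt - x / 24) ?F a else 0)"
  proof (cases "(\<forall>n. a + x / 24 \<noteq> top_wt + of_nat n) \<or> (\<forall>j::int. b \<noteq> h_wt j)")
    case True
    have "q_shift (top_wt - x / 24) ?F a = 0" if "\<forall>n. a + x / 24 \<noteq> top_wt + of_nat n"
    proof -
      have "a \<noteq> top_wt - x / 24 + of_nat n" for n
      proof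
        assume "a = top_wt - x / 24 + of_nat n"
        then have "a + x / 24 = top_wt + of_nat n" by simp
        then show False using that by blast
      qed
      then show ?thesis by (simp add: q_shift_def)
    qed
    moreover have "character x L0 h0 (a, b) = 0"
      by (simp add: character_def joint_eigenspace_trivial[OF True] dim_trivial)
    ultimately show ?thesis using True by auto
  next
    case False
    then obtain n and j :: int where n: "a + x / 24 = top_wt + of_nat n"
      and j: "b = h_wt j" by blast
    have a: "a = top_wt - x / 24 + of_nat n" using n by (simp add: algebra_simps)
    have "character x L0 h0 (a, b) = fps_nth ?F n"
      by (simp only: character_def prod.case n j joint_eigenspace_dim(2))
    then show ?thesis using j unfolding a q_shift_eq by auto
  qed
  ultimately show "character x L0 h0 u = (z_power (- k + 2 * lam) \<star> q_character c (YM omL 1)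
      \<star> delta_z2 \<star> inverse_eta_squared) u"
    by (simp only: u)
qed

end

theorem theorem7p2:
  fixes p p' :: nat and r s :: int and k lam :: complex
    and vacL omL :: "'l::complex_vector" and YL :: "'l \<Rightarrow> int \<Rightarrow> 'l \<Rightarrow> 'l"
    and YM :: "'l \<Rightarrow> int \<Rightarrow> 'm::complex_vector \<Rightarrow> 'm" and v :: 'm
    and YP YW :: "pi_space \<Rightarrow> int \<Rightarrow> pi_space \<Rightarrow> pi_space"
    and vacV e h f :: "'v::complex_vector" and YV :: "'v \<Rightarrow> int \<Rightarrow> 'v \<Rightarrow> 'v"
    and Phi :: "'v \<Rightarrow> 'l tensor_pi"
    and YE :: "'v \<Rightarrow> int \<Rightarrow> 'm tensor_pi \<Rightarrow> 'm tensor_pi"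
    and Lsug0 h0 :: "'m tensor_pi \<Rightarrow> 'm tensor_pi"
  assumes "p \<ge> 2" and "p' \<ge> 2" and "coprime p p'"
    and "k + 2 = of_nat p' / of_nat p"
    and "0 < r" and "r < int p" and "0 < s" and "s < int p'"
    and "simple_virasoro_va (d_vir p p') vacL YL omL"
    and "irreducible_virasoro_va_module (d_vir p p') (h_vir p p' r s) vacL YL omL YM v"
    and "lattice_va k YP"
    and "lattice_va_module k (-1) lam YP YW"
    and "simple_affine_sl2_va k vacV YV e h f"
    and "va_hom vacV YV (tensor vacL (pi_exp 0)) (tensor_Y YL YP) Phi"
    and "Phi e = phi_e vacL" and "Phi h = phi_h k vacL" and "Phi f = phi_f k vacL omL"
    and "YE = (\<lambda>a. tensor_Y YM YW (Phi a))"
    and "Lsug0 = YE (sugawara k YV e h f) 1"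
    and "h0 = YE h 0"
  shows "(nonneg_graded_module vacV YV (sugawara k YV e h f) YE
            (\<lambda>n. eigenspace Lsug0 (top_weight Lsug0 + of_nat n))) \<and>
         (top_component Lsug0 = cvec.span {tensor v (pi_exp j) | j. True} \<and>
          top_weight Lsug0 = k / 4 + h_vir p p' r s \<and>
          ((\<forall>n::int. lam \<noteq> lambda_plus p p' r s + of_int n \<and>
                     lam \<noteq> lambda_minus p p' r s + of_int n) \<longrightarrow>
            irreducible_sl2_module (top_component Lsug0) (YE e 0) (YE h 0) (YE f 0))) \<and>
         (has_character Lsug0 h0 \<and>
          character (3 * k / (k + 2)) Lsug0 h0 =
            z_power (- k + 2 * lam) \<star> q_character (d_vir p p') (YM omL 1)
              \<star> delta_z2 \<star> inverse_eta_squared)"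
proof -
  have p: "of_nat p \<noteq> (0 :: complex)" and p': "of_nat p' \<noteq> (0 :: complex)"
    using assms(1,2) by auto
  have k: "k = of_nat p' / of_nat p - 2" using assms(4) by (simp add: algebra_simps)
  interpret V: affine_sl2 vacV YV k e h f
    using assms(13,4) p p' by (auto simp: simple_affine_sl2_va_def affine_sl2_def affine_sl2_axioms_def)
  have vaL: "va_module vacL YL YM" and irr: "irreducible_virasoro_hw (d_vir p p') (h_vir p p' r s) (\<lambda>n. YM omL (n + 1)) v"
    using assms(10) by (simp_all add: irreducible_virasoro_va_module_def)
  have vaP: "vertex_algebra (pi_exp 0) YP" and vaW: "va_module (pi_exp 0) YP YW"
    using assms(11,12) by (simp_all add: lattice_va_def lattice_va_module_def)
  interpret R: realization_hw k lam vacV e h f YV YP YW vacL omL YL YM Phi "d_vir p p'" "h_vir p p' r s" v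
    using vaL irr vaW assms(11,12,14-17) V.affine_sl2_axioms vaP
    by (simp add: realization_hw_def realization_hw_axioms_def realization_def realization_axioms_def
        lattice_module_def lattice_module_axioms_def lattice_def lattice_axioms_def)
  have L0: "Lsug0 = R.L0" and h0: "h0 = R.h0" and YE: "YE = R.YE"
    using assms(18-20) by simp_all
  define x y :: complex where "x = of_nat p" and "y = of_nat p'"
  have xy: "x \<noteq> 0" "y \<noteq> 0" "k = y / x - 2" using p p' k by (simp_all add: x_def y_def)
  \<comment> \<open>With t = p'/p = k + 2 both sides come from 3 - 6/t = (13 - 6/t - 6 t) + 2 + 6
    k.\<close>
  have charge: "k / 4 - (3 * k / (k + 2)) / 24 = - d_vir p p' / 24 - 1 / 12"
    using xy(1,2) unfolding xy(3) d_vir_def x_def[symmetric] y_def[symmetric]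
    by (simp add: field_simps power2_eq_square)
  \<comment> \<open>The term (p - p')^2 of the highest weight cancels (k + 2) k/4 + 1/4, leaving a
    perfect square.\<close>
  have casimir: "(k + 2) * R.top_wt + 1 / 4 = ((of_int s * x - of_int r * y) / (2 * x))\<^sup>2"
    using xy(1,2) unfolding xy(3) h_vir_def x_def[symmetric] y_def[symmetric]
    by (simp add: field_simps power2_eq_square)
  have irreducible: "irreducible_sl2_module (eigenspace R.L0 R.top_wt) (R.YE e 0) (R.YE h 0) (R.YE f 0)"
    if lam: "\<forall>n::int. lam \<noteq> lambda_plus p p' r s + of_int n \<and> lam \<noteq> lambda_minus p p' r s + of_int n"
  proof (rule R.irreducible_top, rule notI)
    fix j :: int
    let ?u = "(of_int s * x - of_int r * y) / (2 * x)" and ?v = "(- k + 2 * lam + 2 * of_int j + 1) / 2"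
    assume "(k + 2) * R.top_wt + 1 / 4 = ?v\<^sup>2"
    then have "?v = ?u \<or> ?v = - ?u" unfolding casimir by (metis power2_eq_iff)
    \<comment> \<open>Equality of squares means ?v is ?u or its negative; this rewriting of ?v shows
      that the two signs correspond to \<lambda>^+ and \<lambda>^-, up to the integer -(j +
      1).\<close>
    moreover have "?v = lam + of_int (j + 1) - (y - x) / (2 * x)"
      using xy(1) unfolding xy(3) by (simp add: field_simps)
    moreover have "l = d + u + - m \<or> l = d - u + - m" if "w = u \<or> w = - u" "w = l + m - d"
      for l d u m w :: complex
      using that by (auto simp: algebra_simps)
    ultimately have "lam = (y - x) / (2 * x) + ?u + of_int (- (j + 1)) \<or>
        lam = (y - x) / (2 * x) - ?u + of_int (- (j + 1))"
      unfolding of_int_minus by blast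
    then have "lam = lambda_plus p p' r s + of_int (- (j + 1)) \<or> lam = lambda_minus p p' r s + of_int (- (j + 1))"
      by (simp only: lambda_plus_def lambda_minus_def x_def y_def)
    then show False using lam by blast
  qed
  have top: "top_component R.L0 = eigenspace R.L0 R.top_wt"
    by (simp add: top_component_def R.top_weight_L0)
  have "{tensor v (pi_exp j) | j. True} = range R.E" by auto
  then show ?thesis
    unfolding L0 h0 YE top R.top_weight_L0
    using R.graded R.L0_top irreducible R.has_character_L0 R.character_L0[OF charge] by simp
qed

end
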